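(* Let $n\ge 3$ and let $\mathbf{p}$ be a vector of the Minkowski space $\mathbb{R}^{1,n}$. Then there exist a compact set $K\subset\mathbb{R}^n$ and a Riemannian, asymptotically hyperbolic metric $g$ (with spherical conformal infinity) defined on $\mathbb{R}^n\setminus K$, with scalar curvature $R_g\ge -n(n-1)$, such that the energy-momentum vector of $g$ is well defined and coincides with $\mathbf{p}$.
   Context: $\mathbb{R}^{1,n}$ is $\mathbb{R}^{n+1}$ with the form $\eta$ of signature $(+,-,\dots,-)$. Asymptotically hyperbolic (A.H.). A Riemannian $n$-manifold $(M,g)$ is conformally compact if there is a smooth compact manifold $\bar M$ with interior $\mathring M$ and boundary $\partial\bar M=\partial M\cup\partial_\infty M$, $M=\mathring M\cup\partial M$, and a smooth function $\rho:\bar M\to\mathbb{R}_+$ (defining function) with $\rho^{-1}(0)=\partial_\infty M$, $d\rho\neq 0$ on $\partial_\infty M$, such that $\bar g=\rho^2 g$ extends to a smooth metric on $\bar M$. It is asymptotically hyperbolic if moreover $|d\rho|_{\bar g}=1$ on $\partial_\infty M$. For a metric on $\mathbb{R}^n\setminus K$, these conditions concern the end at infinity of $\mathbb{R}^n$, whose boundary at infinity $\partial_\infty M$ is $\mathbb{S}^{n-1}$ with (a metric conformal to) the round metric; no completeness is required towards $K$. Hyperbolic background. In polar coordinates on $\mathbb{R}^n$, the hyperbolic metric is $b=\frac{dr^2}{1+r^2}+r^2\sigma_{n-1}$, where $\sigma_{n-1}$ is the round metric of the unit sphere $\mathbb{S}^{n-1}$; $x^i$ are the Cartesian coordinates ($r^2=\sum_i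 (x^i)^2$). Put $V_{(0)}=\sqrt{1+r^2}$ and $V_{(i)}=x^i$, $i=1,\dots,n$. Energy-momentum vector. Let $\Phi:[R_0,\infty)\times\mathbb{S}^{n-1}\to M_{ext}$ be a diffeomorphism onto the complement of a compact region of the end (a chart at infinity) for which $e=\Phi^*g-b$ decays suitably: $|e|_b+|\nabla e|_b=O(r^{-\tau})$ for some $\tau>n/2$. For $V\in\{V_{(0)},\dots,V_{(n)}\}$ let $$H_\Phi(V)=\lim_{R\to+\infty}\int_{\{r=R\}}\mathbb{U}(V,e)(\nu_r)\,dS_r,\qquad \mathbb{U}(V,e)=V\big(\mathrm{div}\,e-d(\mathrm{tr}\,e)\big)-\iota_{\nabla V}e+(\mathrm{tr}\,e)\,dV,$$ where divergence, trace, gradient, the outward unit normal $\nu_r$ and the induced measure $dS_r$ are those of $b$. The energy-momentum vector of $g$ (relative to the chart $\Phi$) is $\mathbf{p_g}=(p_{(0)},\dots,p_{(n)})$ with $p_{(\mu)}=H_\Phi(V_{(\mu)})$; it is well defined when these limits exist and are finite. Changing $\Phi$ changes $\mathbf{p_g}$ by an element of $O(1,n)$. The statement is that $\mathbf{p_g}=\mathbf{p}$ for some chart at infinity $\Phi:[R_0,\infty)\times\mathbb{S}^{n-1}\to M_{ext}$ satisfying $|\Phi^*g-b|_b+|\nabla(\Phi^*g-b)|_b=O(r^{-\tau})$ for some $\tau>n/2$. *)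

theory Defs
  imports "HOL-Analysis.Analysis" "HOL-Library.Landau_Symbols"
begin

section \<open>Smooth maps and diffeomorphisms between subsets of Euclidean spaces\<close>

fun Ck_on :: "nat \<Rightarrow> 'a::real_normed_vector set \<Rightarrow> ('a \<Rightarrow> 'b::real_normed_vector) \<Rightarrow> bool" where
  "Ck_on 0 U f \<longleftrightarrow> continuous_on U f"
| "Ck_on (Suc k) U f \<longleftrightarrow> (\<forall>x\<in>U. f differentiable (at x)) \<and>
     (\<forall>v. Ck_on k U (\<lambda>x. frechet_derivative f (at x) v))"

text \<open>The derivatives above are two-sided, so \<^const>\<open>Ck_on\<close> is meant for open sets. On an arbitrary
  set, in particular up to the boundary of a domain, smooth means: restriction of a function that is
  smooth on an open neighbourhood.\<close>

definition smooth_on :: "'a::real_normed_vector set \<Rightarrow> ('a \<Rightarrow> 'b::real_normed_vector) \<Rightarrow> bool" where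
  "smooth_on S f \<longleftrightarrow>
     (\<exists>U F. open U \<and> S \<subseteq> U \<and> (\<forall>k. Ck_on k U F) \<and> (\<forall>x\<in>S. F x = f x))"

definition diffeo_onto ::
    "'a::real_normed_vector set \<Rightarrow> 'b::real_normed_vector set \<Rightarrow> ('a \<Rightarrow> 'b) \<Rightarrow> bool" where
  "diffeo_onto S T f \<longleftrightarrow> f ` S = T \<and> smooth_on S f \<and>
     (\<exists>h. smooth_on T h \<and> (\<forall>x\<in>S. h (f x) = x))"

definition partial :: "'n::finite \<Rightarrow> (real^'n \<Rightarrow> real) \<Rightarrow> real^'n \<Rightarrow> real" where
  "partial i f x = frechet_derivative f (at x) (axis i 1)"

section \<open>Riemannian geometry in the Cartesian coordinates\<close>

text \<open>A symmetric 2-tensor field on a subset of \<open>\<real>\<^sup>n\<close> is given by its matrix of components in the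
  Cartesian coordinates.\<close>

type_synonym 'n tensor2 = "real^'n \<Rightarrow> real^'n^'n"

definition riemannian_metric_on :: "(real^'n::finite) set \<Rightarrow> 'n tensor2 \<Rightarrow> bool" where
  "riemannian_metric_on S g \<longleftrightarrow> smooth_on S g \<and>
     (\<forall>x\<in>S. transpose (g x) = g x \<and> (\<forall>v. v \<noteq> 0 \<longrightarrow> v \<bullet> (g x *v v) > 0))"

definition pullback :: "(real^'n::finite \<Rightarrow> real^'n) \<Rightarrow> 'n tensor2 \<Rightarrow> 'n tensor2" where
  "pullback \<Phi> g x = transpose (jacobian \<Phi> (at x)) ** g (\<Phi> x) ** jacobian \<Phi> (at x)"

definition inv_metric :: "'n::finite tensor2 \<Rightarrow> 'n tensor2" where
  "inv_metric g x = matrix_inv (g x)"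

text \<open>\<open>christoffel g k i j\<close> is \<open>\<Gamma>\<^sup>k\<^sub>i\<^sub>j\<close>.\<close>

definition christoffel :: "'n::finite tensor2 \<Rightarrow> 'n \<Rightarrow> 'n \<Rightarrow> 'n \<Rightarrow> real^'n \<Rightarrow> real" where
  "christoffel g k i j x = (\<Sum>l\<in>UNIV. inv_metric g x $ k $ l *
     (partial i (\<lambda>y. g y $ j $ l) x + partial j (\<lambda>y. g y $ i $ l) x
       - partial l (\<lambda>y. g y $ i $ j) x)) / 2"

text \<open>\<open>riemann g l k i j\<close> is the component \<open>l\<close> of \<open>R(\<partial>\<^sub>i, \<partial>\<^sub>j)\<partial>\<^sub>k\<close>, where
  \<open>R(X,Y) = [\<nabla>\<^sub>X, \<nabla>\<^sub>Y] - \<nabla>\<^bsub>[X,Y]\<^esub>\<close>; with these conventions the scalar curvature of round spheres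
  is positive.\<close>

definition riemann :: "'n::finite tensor2 \<Rightarrow> 'n \<Rightarrow> 'n \<Rightarrow> 'n \<Rightarrow> 'n \<Rightarrow> real^'n \<Rightarrow> real" where
  "riemann g l k i j x =
     partial i (christoffel g l j k) x - partial j (christoffel g l i k) x
     + (\<Sum>m\<in>UNIV. christoffel g l i m x * christoffel g m j k x
                  - christoffel g l j m x * christoffel g m i k x)"

definition ricci :: "'n::finite tensor2 \<Rightarrow> 'n \<Rightarrow> 'n \<Rightarrow> real^'n \<Rightarrow> real" where
  "ricci g j k x = (\<Sum>i\<in>UNIV. riemann g i k i j x)"

definition scalar_curvature :: "'n::finite tensor2 \<Rightarrow> real^'n \<Rightarrow> real" where
  "scalar_curvature g x = (\<Sum>j\<in>UNIV. \<Sum>k\<in>UNIV. inv_metric g x $ j $ k * ricci g j k x)"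

text \<open>\<open>cov_deriv b e k i j\<close> is \<open>\<nabla>\<^sub>k e\<^sub>i\<^sub>j\<close> for the Levi-Civita connection of \<open>b\<close>.\<close>

definition cov_deriv ::
    "'n::finite tensor2 \<Rightarrow> 'n tensor2 \<Rightarrow> 'n \<Rightarrow> 'n \<Rightarrow> 'n \<Rightarrow> real^'n \<Rightarrow> real" where
  "cov_deriv b e k i j x = partial k (\<lambda>y. e y $ i $ j) x
     - (\<Sum>l\<in>UNIV. christoffel b l k i x * e x $ l $ j + christoffel b l k j x * e x $ i $ l)"

definition tensor_norm :: "'n::finite tensor2 \<Rightarrow> 'n tensor2 \<Rightarrow> real^'n \<Rightarrow> real" where
  "tensor_norm b e x = sqrt (\<Sum>i\<in>UNIV. \<Sum>j\<in>UNIV. \<Sum>p\<in>UNIV. \<Sum>q\<in>UNIV.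
     inv_metric b x $ i $ p * inv_metric b x $ j $ q * e x $ i $ j * e x $ p $ q)"

definition cov_deriv_norm :: "'n::finite tensor2 \<Rightarrow> 'n tensor2 \<Rightarrow> real^'n \<Rightarrow> real" where
  "cov_deriv_norm b e x = sqrt (\<Sum>k\<in>UNIV. \<Sum>i\<in>UNIV. \<Sum>j\<in>UNIV. \<Sum>m\<in>UNIV. \<Sum>p\<in>UNIV. \<Sum>q\<in>UNIV.
     inv_metric b x $ k $ m * inv_metric b x $ i $ p * inv_metric b x $ j $ q *
     cov_deriv b e k i j x * cov_deriv b e m p q x)"

definition tensor_trace :: "'n::finite tensor2 \<Rightarrow> 'n tensor2 \<Rightarrow> real^'n \<Rightarrow> real" where
  "tensor_trace b e x = (\<Sum>i\<in>UNIV. \<Sum>j\<in>UNIV. inv_metric b x $ i $ j * e x $ i $ j)"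

definition tensor_div :: "'n::finite tensor2 \<Rightarrow> 'n tensor2 \<Rightarrow> 'n \<Rightarrow> real^'n \<Rightarrow> real" where
  "tensor_div b e j x = (\<Sum>i\<in>UNIV. \<Sum>k\<in>UNIV. inv_metric b x $ i $ k * cov_deriv b e i k j x)"

definition gradient :: "'n::finite tensor2 \<Rightarrow> (real^'n \<Rightarrow> real) \<Rightarrow> 'n \<Rightarrow> real^'n \<Rightarrow> real" where
  "gradient b f i x = (\<Sum>j\<in>UNIV. inv_metric b x $ i $ j * partial j f x)"

definition differential_norm :: "'n::finite tensor2 \<Rightarrow> (real^'n \<Rightarrow> real) \<Rightarrow> real^'n \<Rightarrow> real" where
  "differential_norm b f x = sqrt (\<Sum>i\<in>UNIV. partial i f x * gradient b f i x)"

section \<open>Asymptotically hyperbolic ends\<close>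

text \<open>The compactification of the end at infinity of \<open>\<real>\<^sup>n\<close> with boundary at infinity \<open>S\<^sup>n\<^sup>-\<^sup>1\<close> is
  modelled on the half-open collar \<open>(1 - \<delta>, 1] \<times> S\<^sup>n\<^sup>-\<^sup>1\<close>, realised as a one-sided neighbourhood of the
  unit sphere in \<open>\<real>\<^sup>n\<close>.\<close>

definition collar :: "real \<Rightarrow> (real^'n::finite) set" where
  "collar \<delta> = {y. 1 - \<delta> < norm y \<and> norm y \<le> 1}"

definition open_collar :: "real \<Rightarrow> (real^'n::finite) set" where
  "open_collar \<delta> = {y. 1 - \<delta> < norm y \<and> norm y < 1}"

text \<open>\<open>\<Psi>\<close> identifies the interior of the collar with a neighbourhood of infinity in \<open>- K\<close>, the unit
  sphere corresponding to infinity; \<open>\<rho>\<close> is the defining function and \<open>gb\<close> the smooth extension of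
  \<open>\<rho>\<^sup>2 g\<close> to the boundary. Asking for smoothness of \<open>\<rho>\<close> on an open \<open>W\<close> around the collar makes its
  two-sided derivatives at boundary points meaningful; they are determined by \<open>\<rho>\<close> on the collar.\<close>

definition conformal_compactification ::
    "(real^'n::finite) set \<Rightarrow> 'n tensor2 \<Rightarrow> real \<Rightarrow> (real^'n \<Rightarrow> real^'n) \<Rightarrow>
     (real^'n \<Rightarrow> real) \<Rightarrow> 'n tensor2 \<Rightarrow> bool" where
  "conformal_compactification K g \<delta> \<Psi> \<rho> gb \<longleftrightarrow>
     0 < \<delta> \<and> \<delta> < 1 \<and>
     (\<exists>E. E \<subseteq> - K \<and> compact (- E) \<and> diffeo_onto (open_collar \<delta>) E \<Psi>) \<and>
     (\<forall>z\<in>sphere 0 1. filterlim \<Psi> at_infinity (at z within ball 0 1)) \<and>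
     (\<exists>W. open W \<and> collar \<delta> \<subseteq> W \<and> smooth_on W \<rho>) \<and>
     (\<forall>y\<in>collar \<delta>. \<rho> y \<ge> 0 \<and> (\<rho> y = 0 \<longleftrightarrow> norm y = 1)) \<and>
     (\<forall>y\<in>sphere 0 1. \<exists>i. partial i \<rho> y \<noteq> 0) \<and>
     riemannian_metric_on (collar \<delta>) gb \<and>
     (\<forall>y\<in>open_collar \<delta>. gb y = (\<rho> y)\<^sup>2 *\<^sub>R pullback \<Psi> g y)"

definition conformal_to_round :: "'n::finite tensor2 \<Rightarrow> bool" where
  "conformal_to_round gb \<longleftrightarrow>
     (\<exists>f::real^'n \<Rightarrow> real. smooth_on (sphere 0 1) f \<and> (\<forall>y\<in>sphere 0 1. f y > 0 \<and>
        (\<forall>v w. v \<bullet> y = 0 \<longrightarrow> w \<bullet> y = 0 \<longrightarrow> v \<bullet> (gb y *v w) = f y * (v \<bullet> w))))"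

definition asymptotically_hyperbolic :: "(real^'n::finite) set \<Rightarrow> 'n tensor2 \<Rightarrow> bool" where
  "asymptotically_hyperbolic K g \<longleftrightarrow>
     (\<exists>\<delta> \<Psi> \<rho> gb. conformal_compactification K g \<delta> \<Psi> \<rho> gb \<and>
        (\<forall>y\<in>sphere 0 1. differential_norm gb \<rho> y = 1) \<and>
        conformal_to_round gb)"

section \<open>The energy-momentum vector\<close>

text \<open>\<open>b = dr\<^sup>2 / (1 + r\<^sup>2) + r\<^sup>2 \<sigma>\<close>, where \<open>dr = \<Sum>\<^sub>i (x\<^sup>i / r) dx\<^sup>i\<close> and \<open>r\<^sup>2 \<sigma>\<close> is the Euclidean
  metric minus \<open>dr\<^sup>2\<close>. Since \<open>0 / 0 = 0\<close>, the formula is also right at the origin.\<close>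

definition hyperbolic_metric :: "'n::finite tensor2" where
  "hyperbolic_metric x = (\<chi> i j.
     (x $ i / norm x) * (x $ j / norm x) / (1 + (norm x)\<^sup>2)
     + ((if i = j then 1 else 0) - (x $ i / norm x) * (x $ j / norm x)))"

definition V_time :: "real^'n::finite \<Rightarrow> real" where
  "V_time x = sqrt (1 + (norm x)\<^sup>2)"

definition V_space :: "'n::finite \<Rightarrow> real^'n \<Rightarrow> real" where
  "V_space i x = x $ i"

definition charge_form ::
    "(real^'n::finite \<Rightarrow> real) \<Rightarrow> 'n tensor2 \<Rightarrow> 'n \<Rightarrow> real^'n \<Rightarrow> real" where
  "charge_form V e j x = (let b = hyperbolic_metric in
     V x * (tensor_div b e j x - partial j (tensor_trace b e) x)
     - (\<Sum>i\<in>UNIV. gradient b V i x * e x $ i $ j)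
     + tensor_trace b e x * partial j V x)"

text \<open>The coordinate field \<open>\<partial>\<^sub>r = x / r\<close> is orthogonal to the spheres \<open>{r = R}\<close> and has \<open>b\<close>-length
  \<open>1 / sqrt (1 + r\<^sup>2)\<close>.\<close>

definition unit_normal :: "real^'n::finite \<Rightarrow> real^'n" where
  "unit_normal x = sqrt (1 + (norm x)\<^sup>2) *\<^sub>R (x /\<^sub>R norm x)"

text \<open>The surface measure of the round unit sphere in polar coordinates: the measure of \<open>A\<close> is \<open>n\<close> times
  the volume of the cone \<open>{t \<omega> | 0 < t < 1, \<omega> \<in> A}\<close>.\<close>

definition sphere_measure :: "(real^'n::finite) measure" where
  "sphere_measure = scale_measure (of_nat CARD('n))
     (distr (restrict_space lborel (ball 0 1)) borel (\<lambda>y. y /\<^sub>R norm y))"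

text \<open>The metric induced by \<open>b\<close> on \<open>{r = R}\<close> is \<open>R\<^sup>2 \<sigma>\<close>, hence \<open>dS\<^sub>R = R\<^sup>n\<^sup>-\<^sup>1 d\<sigma>\<close>.\<close>

definition flux :: "(real^'n::finite \<Rightarrow> real) \<Rightarrow> 'n tensor2 \<Rightarrow> real \<Rightarrow> real" where
  "flux V e R = (\<integral>\<omega>. (\<Sum>j\<in>UNIV. charge_form V e j (R *\<^sub>R \<omega>) * unit_normal (R *\<^sub>R \<omega>) $ j)
      * R ^ (CARD('n) - 1) \<partial>sphere_measure)"

definition chart_error :: "'n::finite tensor2 \<Rightarrow> (real^'n \<Rightarrow> real^'n) \<Rightarrow> 'n tensor2" where
  "chart_error g \<Phi> x = pullback \<Phi> g x - hyperbolic_metric x"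

text \<open>\<open>[R\<^sub>0, \<infinity>) \<times> S\<^sup>n\<^sup>-\<^sup>1\<close> is identified with \<open>{x. norm x \<ge> R\<^sub>0}\<close> by polar coordinates.\<close>

definition chart_at_infinity ::
    "(real^'n::finite) set \<Rightarrow> 'n tensor2 \<Rightarrow> real \<Rightarrow> (real^'n \<Rightarrow> real^'n) \<Rightarrow> bool" where
  "chart_at_infinity K g R0 \<Phi> \<longleftrightarrow>
     R0 > 0 \<and>
     (\<exists>M_ext. M_ext \<subseteq> - K \<and> compact (closure (- M_ext)) \<and>
        diffeo_onto {x. norm x \<ge> R0} M_ext \<Phi>) \<and>
     (\<exists>\<tau>. \<tau> > real CARD('n) / 2 \<and>
        (\<lambda>x. tensor_norm hyperbolic_metric (chart_error g \<Phi>) x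
             + cov_deriv_norm hyperbolic_metric (chart_error g \<Phi>) x)
          \<in> O[at_infinity](\<lambda>x. norm x powr (- \<tau>)))"

text \<open>A vector of \<open>\<real>\<^bsup>1,n\<^esup>\<close> is a pair of its time component and its space components. The predicate says
  that the limits defining the energy-momentum vector exist, are finite and are the components of \<open>p\<close>.\<close>

definition has_energy_momentum ::
    "'n::finite tensor2 \<Rightarrow> (real^'n \<Rightarrow> real^'n) \<Rightarrow> real \<times> (real^'n) \<Rightarrow> bool" where
  "has_energy_momentum g \<Phi> p \<longleftrightarrow>
     (flux V_time (chart_error g \<Phi>) \<longlongrightarrow> fst p) at_top \<and>
     (\<forall>i. (flux (V_space i) (chart_error g \<Phi>) \<longlongrightarrow> snd p $ i) at_top)"

end

theory Submission
  imports Defs "HOL-Real_Asymp.Real_Asymp"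
begin

text \<open>The metric is a conformal multiple \<open>g = (1 + f) b\<close> of the hyperbolic metric, with
  \<open>f = a v\<^sup>n + (c \<bullet> x - 1) v\<^bsup>n+1\<^esup>\<close> and \<open>v = 1 / V\<^sub>(\<^sub>0\<^sub>)\<close>. The linearisation of \<open>R + n(n-1)\<close> at \<open>b\<close>
  in the direction \<open>f b\<close> is \<open>(n-1)(n f - \<Delta> f)\<close>, and \<open>(\<Delta> - n) v\<^sup>k = (k-n)(k+1) v\<^sup>k + O(v\<^bsup>k+2\<^esup>)\<close>. So the
  terms of order \<open>r\<^bsup>-n\<^esup>\<close>, which carry the energy-momentum vector, do not contribute to leading order, while \<open>- v\<^bsup>n+1\<^esup>\<close>
  contributes \<open>(n-1)(n+2) v\<^bsup>n+1\<^esup> > 0\<close>. This dominates the remaining linear terms, which are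
  \<open>O(v\<^bsup>n+2\<^esup>)\<close>, and the quadratic ones, which are \<open>O(v\<^bsup>2n\<^esup>)\<close>; hence \<open>R \<ge> -n(n-1)\<close> outside a large
  ball. The chart is the identity. On the sphere of radius \<open>r\<close> the flux density tends to
  \<open>(n\<^sup>2-1)(a + c \<bullet> \<omega>) V / r\<close>, so \<open>a\<close> and \<open>c\<close> can be adjusted to give any prescribed vector.

  The Cartesian coordinates \<open>x\<close> are the space components of the hyperboloid embedding, whence
  \<open>b\<^sub>i\<^sub>j = \<delta>\<^sub>i\<^sub>j - x\<^sub>i x\<^sub>j / (1 + r\<^sup>2)\<close> and \<open>\<Gamma>\<^sup>k\<^sub>i\<^sub>j = - b\<^sub>i\<^sub>j x\<^sub>k\<close>.\<close>

section \<open>Smooth functions\<close>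

text \<open>The components of the prescribed vector have arbitrary signs and sizes, so the terms
  that carry it cannot also give the curvature a sign; the sign has to come from a term that the
  flux does not see in the limit. The exponent n+1 is the integer strictly between n, the order of
  the flux, and n+2, the order of the first errors. The gain is a single power of v, so the estimate
  holds only for large r, and the closed ball where it may fail becomes the compact set. On complete
  manifolds positive mass theorems restrict the vector, so some region has to be discarded.

  The functions V pair with the spherical harmonics of degree 0 and 1, which is why a constant and a
  linear function occur at order r^(-n). The conformal ansatz keeps every tensor an expression in
  the Kronecker symbol, x and the derivatives of the factor, so the curvature is obtained from its
  definition by contracting indices. In the Poincare ball v becomes (1 - |y|^2)/(1 + |y|^2), regular
  across the boundary, which yields the smooth compactification.\<close>

lemma Ck_on_cong:
  assumes "open U" "\<And>x. x \<in> U \<Longrightarrow> f x = g x"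
  shows "Ck_on k U f \<longleftrightarrow> Ck_on k U g"
  using assms(2)
proof (induction k arbitrary: f g)
  case 0
  then show ?case by (simp cong: continuous_on_cong)
next
  case (Suc k)
  have 1: "f differentiable (at x) \<longleftrightarrow> g differentiable (at x)" if "x \<in> U" for x
    unfolding differentiable_def
    using has_derivative_transform_within_open[OF _ assms(1) that, of f _ UNIV g]
      has_derivative_transform_within_open[OF _ assms(1) that, of g _ UNIV f] Suc.prems by auto
  have 2: "frechet_derivative f (at x) = frechet_derivative g (at x)" if "x \<in> U" for x
  proof (cases "f differentiable (at x)")
    case True
    then show ?thesis
      using frechet_derivative_transform_within_open[OF _ assms(1) that] Suc.prems by metis
  next
    \<comment> \<open>Where a function is not differentiable, \<open>frechet_derivative\<close> is
      still a choice from its set of derivatives, so the two choices agree once the two sets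
      do.\<close>
    case False
    have "(f has_derivative D) (at x) \<longleftrightarrow> (g has_derivative D) (at x)" for D
      using has_derivative_transform_within_open[OF _ assms(1) that, of f _ UNIV g]
      has_derivative_transform_within_open[OF _ assms(1) that, of g _ UNIV f] Suc.prems by auto
    then show ?thesis by (simp add: frechet_derivative_def)
  qed
  have "Ck_on k U (\<lambda>x. frechet_derivative f (at x) v) \<longleftrightarrow>
      Ck_on k U (\<lambda>x. frechet_derivative g (at x) v)" for v
    by (rule Suc.IH) (simp add: 2)
  with 1 show ?case by simp
qed

text \<open>Derivatives are computed by hand below; this trades the choice operator in
  \<open>frechet_derivative\<close> for any family of derivatives known on the open set.\<close>

lemma Ck_on_Suc_has_derivative:
  assumes "open U" "\<And>x. x \<in> U \<Longrightarrow> (f has_derivative f' x) (at x)"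
  shows "Ck_on (Suc k) U f \<longleftrightarrow> (\<forall>v. Ck_on k U (\<lambda>x. f' x v))"
proof -
  have "frechet_derivative f (at x) = f' x" if "x \<in> U" for x
    using frechet_derivative_at[OF assms(2)[OF that]] by simp
  then have "Ck_on k U (\<lambda>x. frechet_derivative f (at x) v) \<longleftrightarrow> Ck_on k U (\<lambda>x. f' x v)" for v
    by (intro Ck_on_cong[OF assms(1)]) simp
  with assms(2) show ?thesis by (auto simp: differentiable_def)
qed

lemma Ck_on_SucI:
  assumes "open U" "\<And>x. x \<in> U \<Longrightarrow> (f has_derivative f' x) (at x)"
    "\<And>v. Ck_on k U (\<lambda>x. f' x v)"
  shows "Ck_on (Suc k) U f"
  using Ck_on_Suc_has_derivative[OF assms(1,2)] assms(3) by blast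

lemma Ck_on_SucD:
  assumes "Ck_on (Suc k) U f" "x \<in> U"
  shows "(f has_derivative frechet_derivative f (at x)) (at x)"
  using assms frechet_derivative_works by (simp; blast)

text \<open>Lowers the order for the Leibniz rule, in whose derivative an undifferentiated factor
  reappears.\<close>

lemma Ck_on_pred: "Ck_on (Suc k) U f \<Longrightarrow> Ck_on k U f"
proof (induction k arbitrary: f)
  case 0
  then show ?case
    by (auto intro!: continuous_at_imp_continuous_on differentiable_imp_continuous_within)
qed simp

lemma Ck_on_const: "Ck_on k U (\<lambda>x. c)"
  by (induction k arbitrary: c) auto

lemma Ck_on_linear:
  assumes "open U" "bounded_linear f"
  shows "Ck_on k U f"
proof (cases k)
  case 0
  then show ?thesis using assms(2) by (simp add: linear_continuous_on)
next
  case (Suc m)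
  show ?thesis unfolding Suc
    by (rule Ck_on_SucI[OF assms(1), of _ "\<lambda>x. f"])
      (auto intro: bounded_linear_imp_has_derivative assms Ck_on_const)
qed

lemma Ck_on_add:
  assumes "open U" "Ck_on k U f" "Ck_on k U g"
  shows "Ck_on k U (\<lambda>x. f x + g x)"
  using assms(2,3)
proof (induction k arbitrary: f g)
  case 0
  then show ?case by (simp add: continuous_on_add)
next
  case (Suc k)
  show ?case
    by (rule Ck_on_SucI[OF assms(1), of _ "\<lambda>x v. frechet_derivative f (at x) v + frechet_derivative g (at x) v"])
      (use Suc in \<open>auto intro!: has_derivative_add Ck_on_SucD\<close>)
qed

lemma Ck_on_scaleR:
  assumes "open U" "Ck_on k U f" "Ck_on k U g"
  shows "Ck_on k U (\<lambda>x. f x *\<^sub>R g x)"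
  using assms(2,3)
proof (induction k arbitrary: f g)
  case 0
  then show ?case by (simp add: continuous_on_scaleR)
next
  case (Suc k)
  have "Ck_on k U f" "Ck_on k U g" using Suc.prems Ck_on_pred by blast+
  then show ?case
    by (intro Ck_on_SucI[OF assms(1), of _ "\<lambda>x v. f x *\<^sub>R frechet_derivative g (at x) v + frechet_derivative f (at x) v *\<^sub>R g x"]
         has_derivative_scaleR Ck_on_add[OF assms(1)] Suc.IH)
      (use Suc.prems in \<open>auto intro!: Ck_on_SucD\<close>)
qed

lemma Ck_on_mult:
  fixes f g :: "'a::real_normed_vector \<Rightarrow> real"
  assumes "open U" "Ck_on k U f" "Ck_on k U g"
  shows "Ck_on k U (\<lambda>x. f x * g x)"
  using Ck_on_scaleR[OF assms] by simp

lemma Ck_on_uminus: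
  assumes "open U" "Ck_on k U f"
  shows "Ck_on k U (\<lambda>x. - f x)"
  using Ck_on_scaleR[OF assms(1) Ck_on_const assms(2), of "-1"] by simp

lemma Ck_on_diff:
  assumes "open U" "Ck_on k U f" "Ck_on k U g"
  shows "Ck_on k U (\<lambda>x. f x - g x)"
  using Ck_on_add[OF assms(1,2) Ck_on_uminus[OF assms(1,3)]] by simp

lemma Ck_on_power:
  fixes f :: "'a::real_normed_vector \<Rightarrow> real"
  assumes "open U" "Ck_on k U f"
  shows "Ck_on k U (\<lambda>x. f x ^ m)"
  by (induction m) (auto intro: Ck_on_const Ck_on_mult assms)

text \<open>The derivative of 1/f contains 1/f itself, so smoothness is bootstrapped: order k of 1/f
  yields order k of its derivative. The square root below is treated alike.\<close>

lemma Ck_on_inverse: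
  fixes f :: "'a::real_normed_vector \<Rightarrow> real"
  assumes "open U" "\<And>x. x \<in> U \<Longrightarrow> f x \<noteq> 0" "Ck_on k U f"
  shows "Ck_on k U (\<lambda>x. inverse (f x))"
  using assms(3)
proof (induction k)
  case 0
  then show ?case using assms(2) by (auto intro!: continuous_on_inverse)
next
  case (Suc k)
  have 1: "Ck_on k U (\<lambda>x. inverse (f x))" using Suc Ck_on_pred by blast
  show ?case
  proof (rule Ck_on_SucI[OF assms(1)])
    show "((\<lambda>x. inverse (f x)) has_derivative
        (\<lambda>v. - (inverse (f x) * frechet_derivative f (at x) v * inverse (f x)))) (at x)" if "x \<in> U" for x
      by (rule Deriv.has_derivative_inverse[OF assms(2)[OF that] Ck_on_SucD[OF Suc.prems that]])
    show "Ck_on k U (\<lambda>x. - (inverse (f x) * frechet_derivative f (at x) v * inverse (f x)))" for v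
      by (intro Ck_on_uminus Ck_on_mult 1 assms(1)) (use Suc.prems in auto)
  qed
qed

lemma Ck_on_divide:
  fixes f g :: "'a::real_normed_vector \<Rightarrow> real"
  assumes "open U" "\<And>x. x \<in> U \<Longrightarrow> g x \<noteq> 0" "Ck_on k U f" "Ck_on k U g"
  shows "Ck_on k U (\<lambda>x. f x / g x)"
  unfolding divide_inverse by (intro Ck_on_mult Ck_on_inverse assms)

lemma Ck_on_sqrt:
  fixes f :: "'a::real_normed_vector \<Rightarrow> real"
  assumes "open U" "\<And>x. x \<in> U \<Longrightarrow> f x > 0" "Ck_on k U f"
  shows "Ck_on k U (\<lambda>x. sqrt (f x))"
  using assms(3)
proof (induction k)
  case 0
  then show ?case by (simp add: continuous_on_real_sqrt)
next
  case (Suc k)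
  have 1: "Ck_on k U (\<lambda>x. sqrt (f x))" using Suc Ck_on_pred by blast
  have nz: "f x \<noteq> 0" if "x \<in> U" for x using assms(2)[OF that] by simp
  show ?case
  proof (rule Ck_on_SucI[OF assms(1)])
    show "((\<lambda>x. sqrt (f x)) has_derivative
        (\<lambda>v. frechet_derivative f (at x) v * (inverse (sqrt (f x)) / 2))) (at x)" if "x \<in> U" for x
      by (rule has_derivative_real_sqrt[OF assms(2)[OF that] Ck_on_SucD[OF Suc.prems that], THEN has_derivative_eq_rhs])
         auto
    show "Ck_on k U (\<lambda>x. frechet_derivative f (at x) v * (inverse (sqrt (f x)) / 2))" for v
      by (intro Ck_on_mult Ck_on_divide Ck_on_inverse Ck_on_const 1 assms(1)) (use Suc.prems nz in auto)
  qed
qed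

section \<open>Maps into Euclidean spaces, component by component\<close>

lemma bounded_linear_axis: "bounded_linear (axis i :: 'b::real_normed_vector \<Rightarrow> 'b ^ 'n::finite)"
proof (rule bounded_linear_intro[where K = 1])
  fix x y :: 'b and r :: real
  show "axis i (x + y) = (axis i x + axis i y :: 'b ^ 'n)"
    "axis i (r *\<^sub>R x) = (r *\<^sub>R axis i x :: 'b ^ 'n)"
    by (auto simp: vec_eq_iff axis_def)
  have "(\<Sum>j\<in>UNIV. (norm (if j = i then x else 0))\<^sup>2) = (norm x)\<^sup>2"
    by (subst sum.remove[of _ i]) auto
  then show "norm (axis i x :: 'b ^ 'n) \<le> norm x * 1"
    by (simp add: norm_vec_def L2_set_def axis_def)
qed

lemma vec_eq_sum_axis: "x = (\<Sum>i\<in>UNIV. axis i (x $ i))"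
  by (simp add: vec_eq_iff axis_def)

lemma has_derivative_vec:
  fixes f :: "'a::real_normed_vector \<Rightarrow> 'b::real_normed_vector ^ 'n::finite"
  assumes "\<And>i. ((\<lambda>x. f x $ i) has_derivative f' i) F"
  shows "(f has_derivative (\<lambda>v. \<chi> i. f' i v)) F"
proof -
  have "((\<lambda>x. \<Sum>i\<in>UNIV. axis i (f x $ i)) has_derivative
      (\<lambda>v. \<Sum>i\<in>UNIV. axis i (f' i v))) F"
    by (intro has_derivative_sum bounded_linear.has_derivative[OF bounded_linear_axis] assms)
  moreover have "(\<lambda>v. \<Sum>i\<in>UNIV. axis i (f' i v)) = (\<lambda>v. \<chi> i. f' i v)"
    by (simp add: fun_eq_iff vec_eq_iff axis_def)
  ultimately show ?thesis by (simp flip: vec_eq_sum_axis)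
qed

lemma Ck_on_vec:
  fixes f :: "'a::real_normed_vector \<Rightarrow> 'b::real_normed_vector ^ 'n::finite"
  assumes "open U" "\<And>i. Ck_on k U (\<lambda>x. f x $ i)"
  shows "Ck_on k U f"
  using assms(2)
proof (induction k arbitrary: f)
  case 0
  then have "continuous_on U (\<lambda>x. \<chi> i. f x $ i)"
    by (intro continuous_on_vec_lambda) simp
  then show ?case by simp
next
  case (Suc k)
  show ?case
    by (rule Ck_on_SucI[OF assms(1), of _ "\<lambda>x v. \<chi> i. frechet_derivative (\<lambda>x. f x $ i) (at x) v"])
      (use Suc in \<open>auto intro!: has_derivative_vec simp: frechet_derivative_works\<close>)
qed

section \<open>Conformal changes of the hyperbolic metric\<close>

lemma partial_eq_gradient: "GDERIV f x :> D \<Longrightarrow> partial i f x = D $ i"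
  unfolding partial_def gderiv_def
  by (simp add: frechet_derivative_at[symmetric] inner_axis' )

text \<open>A partial derivative depends only on the germ at the point. The closed form of the
  Christoffel symbols is known only where the conformal factor does not vanish, and it is
  differentiated through this.\<close>

lemma partial_cong:
  assumes "open S" "x \<in> S" "\<And>y. y \<in> S \<Longrightarrow> f y = g y" "GDERIV g x :> D"
  shows "partial i f x = D $ i"
proof -
  have "GDERIV f x :> D"
    unfolding gderiv_def
    by (rule has_derivative_transform_within_open[OF assms(4)[unfolded gderiv_def] assms(1,2)])
      (use assms(3) in auto)
  then show ?thesis by (rule partial_eq_gradient)
qed

lemma GDERIV_component: "GDERIV (\<lambda>x. x $ i) x :> axis i 1"
  unfolding gderiv_def
  by (simp add: inner_axis bounded_linear_imp_has_derivative bounded_linear_vec_nth)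

lemma GDERIV_inner_left: "GDERIV (\<lambda>x. c \<bullet> x) x :> c"
  unfolding gderiv_def
  by (subst inner_commute, intro bounded_linear_imp_has_derivative bounded_linear_inner_right)

lemma GDERIV_inner_self: "GDERIV (\<lambda>x. x \<bullet> x) x :> 2 *\<^sub>R x"
  unfolding gderiv_def
  by (rule has_derivative_inner[OF has_derivative_ident has_derivative_ident, THEN has_derivative_eq_rhs])
     (auto simp: inner_commute)

lemma GDERIV_sum:
  assumes "\<And>i. i \<in> I \<Longrightarrow> GDERIV (f i) x :> D i"
  shows "GDERIV (\<lambda>x. \<Sum>i\<in>I. f i x) x :> (\<Sum>i\<in>I. D i)"
  using assms unfolding gderiv_def by (simp add: inner_sum_right has_derivative_sum)

lemma GDERIV_cmult: "GDERIV f x :> D \<Longrightarrow> GDERIV (\<lambda>x. c * f x) x :> c *\<^sub>R D"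
  using GDERIV_mult[OF GDERIV_const, of f x D c] by simp

lemma GDERIV_unique: "GDERIV f x :> D \<Longrightarrow> GDERIV f x :> D' \<Longrightarrow> D = D'"
  unfolding gderiv_def
  by (drule (1) has_derivative_unique) (metis vector_eq_rdot inner_commute)

text \<open>The Kronecker symbol as a constant of its own, so that contractions collapse by
  \<open>sum_kd\<close> without splitting conditionals.\<close>

definition kd :: "'n \<Rightarrow> 'n \<Rightarrow> real" where
  "kd i j = (if i = j then 1 else 0)"

lemma sum_kd [simp]:
  "(\<Sum>i\<in>UNIV. kd i j * w i) = w (j::'n::finite)" "(\<Sum>i\<in>UNIV. kd j i * w i) = w j"
  "(\<Sum>i\<in>UNIV. w i * kd i j) = w j" "(\<Sum>i\<in>UNIV. w i * kd j i) = w j"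
  by (simp_all add: kd_def if_distrib if_distribR cong: if_cong)

lemma sum_kd_one [simp]: "(\<Sum>i\<in>UNIV. kd i (j::'n::finite)) = 1"
  using sum_kd(1)[of j "\<lambda>_. 1"] by simp

lemma kd_self [simp]: "kd i i = 1"
  by (simp add: kd_def)

lemma kd_commute: "kd i j = kd j i" by (simp add: kd_def)

lemma axis_kd: "axis i 1 $ j = kd j i" by (simp add: axis_def kd_def)

lemma inner_vec_eq: "(x::real^'n::finite) \<bullet> y = (\<Sum>i\<in>UNIV. x $ i * y $ i)"
  by (simp add: inner_vec_def)

lemma one_plus_inner_pos: "1 + x \<bullet> x > 0" "1 + x \<bullet> x \<noteq> 0"
  by (metis add_pos_nonneg inner_ge_zero zero_less_one)
     (metis add_pos_nonneg inner_ge_zero zero_less_one less_irrefl)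

text \<open>The two occurrences of dr^2 combine because 1/(1 + r^2) - 1 = -r^2/(1 + r^2), and this
  r^2 cancels the denominators.\<close>

lemma hyperbolic_metric_component:
  "hyperbolic_metric x $ i $ j = kd i j - x $ i * x $ j / (1 + x \<bullet> x)"
proof (cases "x = 0")
  case True
  then show ?thesis by (simp add: hyperbolic_metric_def kd_def)
next
  case False
  have alg: "a / r * (b / r) / (1 + r\<^sup>2) + (d - a / r * (b / r)) = d - a * b / (1 + r\<^sup>2)"
    if "r > 0" for a b r d :: real
  proof -
    have "1 + r\<^sup>2 \<noteq> 0" by (metis one_plus_inner_pos(2) inner_real_def power2_eq_square)
    then have "a / r * (b / r) / (1 + r\<^sup>2) = a / r * (b / r) - a * b / (1 + r\<^sup>2)"
      using that by (simp add: divide_simps) (simp add: algebra_simps power2_eq_square)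
    then show ?thesis by simp
  qed
  show ?thesis
    unfolding hyperbolic_metric_def kd_def power2_norm_eq_inner[symmetric]
    using alg[of "norm x" "x $ i" "x $ j"] False by simp
qed

text \<open>The inverse of the metric, by the Sherman-Morrison formula for the identity minus a
  matrix of rank one.\<close>

definition hyperbolic_inverse :: "real^'n::finite \<Rightarrow> real^'n^'n" where
  "hyperbolic_inverse x = (\<chi> i j. kd i j + x $ i * x $ j)"

lemma sum_hyperbolic_inverse:
  "(\<Sum>l\<in>UNIV. hyperbolic_inverse x $ k $ l * w $ l) = w $ k + x $ k * (x \<bullet> w)"
  by (simp add: hyperbolic_inverse_def distrib_right sum.distrib inner_vec_eq mult.assoc
      flip: sum_distrib_left)

lemma sum_hyperbolic_metric:
  "(\<Sum>l\<in>UNIV. hyperbolic_metric x $ k $ l * w $ l) = w $ k - x $ k * (x \<bullet> w) / (1 + x \<bullet> x)"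
proof -
  have "hyperbolic_metric x $ k $ l * w $ l = kd k l * w $ l - x $ k / (1 + x \<bullet> x) * (x $ l * w $ l)" for l
    by (simp add: hyperbolic_metric_component algebra_simps)
  then show ?thesis
    by (simp only: sum_subtractf sum_kd inner_vec_eq[of x w] flip: sum_distrib_left) simp
qed

lemma hyperbolic_symmetric:
  "hyperbolic_metric x $ i $ j = hyperbolic_metric x $ j $ i"
  "hyperbolic_inverse x $ i $ j = hyperbolic_inverse x $ j $ i"
  by (simp_all add: hyperbolic_metric_component hyperbolic_inverse_def kd_commute)

lemma hyperbolic_inverse_mult:
  "(\<Sum>l\<in>UNIV. hyperbolic_inverse x $ k $ l * hyperbolic_metric x $ j $ l) = kd k j"
proof -
  \<comment> \<open>The position vector is an eigenvector of the metric with eigenvalue 1/(1 +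
    r^2).\<close>
  have 1: "x \<bullet> (hyperbolic_metric x $ j) = x $ j / (1 + x \<bullet> x)"
  proof -
    have "x \<bullet> (hyperbolic_metric x $ j) = (\<Sum>l\<in>UNIV. hyperbolic_metric x $ j $ l * x $ l)"
      by (simp add: inner_vec_eq mult.commute)
    also have "\<dots> = x $ j - x $ j * (x \<bullet> x) / (1 + x \<bullet> x)"
      by (rule sum_hyperbolic_metric)
    also have "\<dots> = x $ j / (1 + x \<bullet> x)"
      using one_plus_inner_pos(2)[of x] by (simp add: field_simps)
    finally show ?thesis .
  qed
  show ?thesis
    unfolding sum_hyperbolic_inverse 1
    by (simp add: hyperbolic_metric_component kd_commute algebra_simps)
qed

lemma matrix_inv_eqI:
  fixes A B :: "real^'n^'n"
  assumes "A ** B = mat 1" "B ** A = mat 1"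
  shows "matrix_inv A = B"
proof -
  have uniq: "C = B" if "C ** A = mat 1" for C
  proof -
    have "C ** (A ** B) = B" unfolding matrix_mul_assoc that by (rule matrix_mul_lid)
    then show ?thesis unfolding assms(1) matrix_mul_rid .
  qed
  show ?thesis
    unfolding matrix_inv_def
  proof (rule some_equality)
    show "A ** B = mat 1 \<and> B ** A = mat 1" by (intro conjI assms)
    show "C = B" if "A ** C = mat 1 \<and> C ** A = mat 1" for C
      by (rule uniq, rule conjunct2, rule that)
  qed
qed

lemma inv_metric_conformal:
  assumes "u \<noteq> 0"
  shows "matrix_inv (u *\<^sub>R hyperbolic_metric x) = inverse u *\<^sub>R hyperbolic_inverse x"
proof -
  have 1: "hyperbolic_inverse x ** hyperbolic_metric x = mat 1"
    using hyperbolic_inverse_mult[of x]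
    by (simp add: vec_eq_iff matrix_matrix_mult_def mat_def kd_def hyperbolic_symmetric(1)[of x])
  then have 2: "hyperbolic_metric x ** hyperbolic_inverse x = mat 1"
    using matrix_left_right_inverse by blast
  have "(u *\<^sub>R hyperbolic_metric x) ** (inverse u *\<^sub>R hyperbolic_inverse x) = mat 1"
    "(inverse u *\<^sub>R hyperbolic_inverse x) ** (u *\<^sub>R hyperbolic_metric x) = mat 1"
    using 1 2 assms by (simp_all add: scalar_matrix_assoc[symmetric] matrix_scalar_ac)
  then show ?thesis by (rule matrix_inv_eqI)
qed

text \<open>The partial derivative of index \<open>m\<close> of the metric component
  \<open>i j\<close>.\<close>

definition d_hyp :: "real^'n::finite \<Rightarrow> 'n \<Rightarrow> 'n \<Rightarrow> 'n \<Rightarrow> real" where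
  "d_hyp x m i j = - (kd m i * x $ j + kd m j * x $ i) / (1 + x \<bullet> x)
     + 2 * x $ m * x $ i * x $ j / (1 + x \<bullet> x)\<^sup>2"

lemma GDERIV_hyperbolic_metric:
  "GDERIV (\<lambda>x. hyperbolic_metric x $ i $ j) x :> (\<chi> m. d_hyp x m i j)"
proof -
  let ?q = "1 + x \<bullet> x"
  have "GDERIV (\<lambda>x. kd i j - x $ i * x $ j * inverse (1 + x \<bullet> x)) x :>
      0 - ((x $ i * x $ j) *\<^sub>R (- (inverse (1 + x \<bullet> x))\<^sup>2 *\<^sub>R (0 + 2 *\<^sub>R x)) +
        inverse ?q *\<^sub>R (x $ i *\<^sub>R axis j 1 + x $ j *\<^sub>R axis i 1))"
    by (intro GDERIV_diff GDERIV_const GDERIV_mult GDERIV_component GDERIV_inverse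
      GDERIV_add GDERIV_inner_self one_plus_inner_pos)
  then show ?thesis
    unfolding hyperbolic_metric_component divide_inverse
    by (rule GDERIV_subst)
      (simp add: vec_eq_iff d_hyp_def axis_kd divide_inverse power_inverse algebra_simps)
qed

text \<open>For a conformal factor \<open>u\<close> with \<open>du = 2 u p\<close>, these are the Christoffel symbols of \<open>u b\<close>.\<close>

definition conf_Y :: "real^'n::finite \<Rightarrow> real^'n \<Rightarrow> real^'n" where
  "conf_Y x p = p + (1 + x \<bullet> p) *\<^sub>R x"

definition conf_Gamma :: "real^'n::finite \<Rightarrow> real^'n \<Rightarrow> 'n \<Rightarrow> 'n \<Rightarrow> 'n \<Rightarrow> real" where
  "conf_Gamma x p k i j = kd k i * p $ j + kd k j * p $ i - hyperbolic_metric x $ i $ j * conf_Y x p $ k"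

lemma GDERIV_conformal:
  assumes "GDERIV u x :> du"
  shows "GDERIV (\<lambda>y. (u y *\<^sub>R hyperbolic_metric y) $ i $ j) x :>
     (\<chi> m. du $ m * hyperbolic_metric x $ i $ j + u x * d_hyp x m i j)"
  using GDERIV_mult[OF assms GDERIV_hyperbolic_metric]
  by (simp, rule GDERIV_subst) (simp_all add: vec_eq_iff)

text \<open>The usual conformal change with the background symbol -b_ij x_k absorbed: raising the
  index of \<open>p\<close> gives p + (x . p) x, and adding x gives \<open>conf_Y\<close>.\<close>

lemma christoffel_conformal:
  assumes "u x \<noteq> 0" "GDERIV u x :> (2 * u x) *\<^sub>R p"
  shows "christoffel (\<lambda>y. u y *\<^sub>R hyperbolic_metric y) k i j x = conf_Gamma x p k i j"
proof -
  let ?b = "hyperbolic_metric x" and ?Q = "hyperbolic_inverse x" and ?q = "1 + x \<bullet> x"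
  have par: "partial m (\<lambda>y. (u y *\<^sub>R hyperbolic_metric y) $ i $ j) x =
      u x * (2 * p $ m * ?b $ i $ j + d_hyp x m i j)" for m i j
    unfolding partial_eq_gradient[OF GDERIV_conformal[OF assms(2)]] by (simp add: algebra_simps)
  \<comment> \<open>Twice the background Christoffel symbols of the first kind. Raising
    \<open>l\<close> multiplies x by 1 + r^2 and so leaves -b_ij x_k.\<close>
  have d: "d_hyp x i j l + d_hyp x j i l - d_hyp x l i j = - 2 * x $ l * ?b $ i $ j / ?q" for l
  proof -
    define q where "q = ?q"
    have "q \<noteq> 0" by (simp add: q_def one_plus_inner_pos)
    then show ?thesis
      unfolding d_hyp_def hyperbolic_metric_component q_def[symmetric]
        kd_commute[of l i] kd_commute[of l j] kd_commute[of j i]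
      by (simp add: field_simps power2_eq_square)
  qed
  have "christoffel (\<lambda>y. u y *\<^sub>R hyperbolic_metric y) k i j x = 
     (\<Sum>l\<in>UNIV. inverse (u x) * ?Q $ k $ l * (u x * (2 * p $ i * ?b $ j $ l + 2 * p $ j * ?b $ i $ l
        - 2 * p $ l * ?b $ i $ j + (d_hyp x i j l + d_hyp x j i l - d_hyp x l i j)))) / 2"
    unfolding christoffel_def par inv_metric_def inv_metric_conformal[OF assms(1)]
    by (simp add: algebra_simps)
  also have "\<dots> = (\<Sum>l\<in>UNIV. p $ i * (?Q $ k $ l * ?b $ j $ l) + p $ j * (?Q $ k $ l * ?b $ i $ l)
        - ?b $ i $ j * (?Q $ k $ l * p $ l) - ?b $ i $ j / ?q * (?Q $ k $ l * x $ l))"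
    unfolding sum_divide_distrib
  proof (intro sum.cong refl)
    fix l
    show "inverse (u x) * ?Q $ k $ l * (u x * (2 * p $ i * ?b $ j $ l + 2 * p $ j * ?b $ i $ l
        - 2 * p $ l * ?b $ i $ j + (d_hyp x i j l + d_hyp x j i l - d_hyp x l i j))) / 2 =
      p $ i * (?Q $ k $ l * ?b $ j $ l) + p $ j * (?Q $ k $ l * ?b $ i $ l)
        - ?b $ i $ j * (?Q $ k $ l * p $ l) - ?b $ i $ j / ?q * (?Q $ k $ l * x $ l)"
    proof -
      have e: "inverse (u x) * ?Q $ k $ l * (u x * E) / 2 = ?Q $ k $ l * E / 2" for E
        using assms(1) by simp
      define q where "q = ?q"
      have "q \<noteq> 0" by (simp add: q_def one_plus_inner_pos)
      then show ?thesis unfolding e d q_def[symmetric] by (simp add: field_simps)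
    qed
  qed
  also have "\<dots> = p $ i * kd k j + p $ j * kd k i - ?b $ i $ j * (p $ k + x $ k * (x \<bullet> p))
      - ?b $ i $ j / ?q * (x $ k + x $ k * (x \<bullet> x))"
    by (simp only: sum.distrib sum_subtractf sum_distrib_left[symmetric] hyperbolic_inverse_mult
      sum_hyperbolic_inverse)
  also have "\<dots> = conf_Gamma x p k i j"
    using one_plus_inner_pos(2)[of x]
    by (simp add: conf_Gamma_def conf_Y_def field_simps)
  finally show ?thesis .
qed

section \<open>Derivatives and contractions of the Christoffel symbols\<close>

lemma GDERIV_conf_Y:
  assumes p: "\<And>i. GDERIV (\<lambda>y. p y $ i) x :> dp $ i"
  shows "GDERIV (\<lambda>y. conf_Y y (p y) $ k) x :>
    (\<chi> m. dp $ k $ m + (1 + x \<bullet> p x) * kd k m + x $ k * (p x $ m + (\<Sum>l\<in>UNIV. x $ l * dp $ l $ m)))"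
proof -
  have "GDERIV (\<lambda>y. p y $ k + (1 + (\<Sum>l\<in>UNIV. y $ l * p y $ l)) * y $ k) x :>
     dp $ k + ((1 + (\<Sum>l\<in>UNIV. x $ l * p x $ l)) *\<^sub>R axis k 1
       + x $ k *\<^sub>R (0 + (\<Sum>l\<in>UNIV. x $ l *\<^sub>R dp $ l + p x $ l *\<^sub>R axis l 1)))"
    by (intro GDERIV_add GDERIV_mult GDERIV_component GDERIV_const GDERIV_sum p)
  moreover have "(\<Sum>l\<in>UNIV. p x $ l *\<^sub>R axis l 1) = p x"
    by (simp add: vec_eq_iff axis_kd)
  ultimately have "GDERIV (\<lambda>y. p y $ k + (1 + (\<Sum>l\<in>UNIV. y $ l * p y $ l)) * y $ k) x :>
     dp $ k + ((1 + (x \<bullet> p x)) *\<^sub>R axis k 1 + x $ k *\<^sub>R ((\<Sum>l\<in>UNIV. x $ l *\<^sub>R dp $ l) + p x))"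
    by (simp add: inner_vec_eq sum.distrib)
  then show ?thesis
    unfolding conf_Y_def vector_add_component vector_scaleR_component inner_vec_eq real_scaleR_def
    by (rule GDERIV_subst) (auto simp: vec_eq_iff axis_def kd_def algebra_simps inner_vec_eq)
qed

lemma GDERIV_conf_Gamma:
  assumes p: "\<And>i. GDERIV (\<lambda>y. p y $ i) x :> dp $ i"
  shows "GDERIV (\<lambda>y. conf_Gamma y (p y) k i j) x :>
    (\<chi> m. kd k i * dp $ j $ m + kd k j * dp $ i $ m - d_hyp x m i j * conf_Y x (p x) $ k
       - hyperbolic_metric x $ i $ j * (dp $ k $ m + (1 + x \<bullet> p x) * kd k m
           + x $ k * (p x $ m + (\<Sum>l\<in>UNIV. x $ l * dp $ l $ m))))"
  unfolding conf_Gamma_def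
  by (rule GDERIV_subst[OF GDERIV_diff[OF GDERIV_add[OF GDERIV_cmult[OF p] GDERIV_cmult[OF p]]
       GDERIV_mult[OF GDERIV_hyperbolic_metric GDERIV_conf_Y[OF p]]]])
    (simp add: vec_eq_iff algebra_simps)

text \<open>The trace is the logarithmic derivative of the volume density: the determinant of b is
  1/(1 + r^2), which accounts for the second term, and the factor u contributes n p.\<close>

lemma conf_Gamma_trace:
  "(\<Sum>i\<in>UNIV. conf_Gamma x p i i k) = real CARD('n) * p $ k - x $ k / (1 + x \<bullet> x)"
  for x p :: "real^'n::finite"
proof -
  let ?q = "1 + x \<bullet> x"
  have "conf_Gamma x p i i k = p $ k + kd i k * p $ i - hyperbolic_metric x $ k $ i * conf_Y x p $ i" for i
    by (simp add: conf_Gamma_def hyperbolic_symmetric(1)[of x k])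
  then have "(\<Sum>i\<in>UNIV. conf_Gamma x p i i k) = real CARD('n) * p $ k + p $ k
      - (conf_Y x p $ k - x $ k * (x \<bullet> conf_Y x p) / ?q)"
    by (simp add: sum.distrib sum_subtractf sum_hyperbolic_metric)
  also have "\<dots> = real CARD('n) * p $ k - x $ k / ?q"
  proof -
    have "x \<bullet> conf_Y x p = (1 + x \<bullet> p) * ?q - 1"
      by (simp add: conf_Y_def inner_add_right algebra_simps)
    then have "x $ k * (x \<bullet> conf_Y x p) / ?q = x $ k * (1 + x \<bullet> p) - x $ k / ?q"
      using one_plus_inner_pos(2)[of x] by (simp only: right_diff_distrib diff_divide_distrib) simp
    then show ?thesis by (simp add: conf_Y_def algebra_simps)
  qed
  finally show ?thesis .
qed

lemma conf_Gamma_contract: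
  "(\<Sum>k\<in>UNIV. w $ k * conf_Gamma x p k i j) =
     p $ j * w $ i + p $ i * w $ j - hyperbolic_metric x $ i $ j * (w \<bullet> conf_Y x p)"
proof -
  have "w $ k * conf_Gamma x p k i j = p $ j * (kd k i * w $ k) + p $ i * (kd k j * w $ k)
       - hyperbolic_metric x $ i $ j * (w $ k * conf_Y x p $ k)" for k
    by (simp add: conf_Gamma_def algebra_simps)
  then show ?thesis
    by (simp only: sum.distrib sum_subtractf sum_kd inner_vec_eq sum_distrib_left[symmetric])
qed

text \<open>Only the first factor is expanded into its three terms; the sum over \<open>m\<close>
  then consists of contractions of the second factor, which \<open>conf_Gamma_contract\<close> and
  \<open>conf_Gamma_trace\<close> evaluate. The vector \<beta> is \<open>conf_Y\<close> with its
  index lowered by b.\<close>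

lemma conf_Gamma_quadratic:
  fixes x p :: "real^'n::finite"
  defines "\<beta> \<equiv> p + (1 / (1 + x \<bullet> x)) *\<^sub>R x"
  shows "(\<Sum>i\<in>UNIV. \<Sum>m\<in>UNIV. conf_Gamma x p i j m * conf_Gamma x p m i k) =
     (real CARD('n) + 2) * p $ j * p $ k - hyperbolic_metric x $ j $ k * (p \<bullet> conf_Y x p)
     - p $ j * x $ k / (1 + x \<bullet> x)
     - (p $ k * \<beta> $ j + p \<bullet> conf_Y x p * hyperbolic_metric x $ j $ k - \<beta> $ k * \<beta> $ j)"
proof -
  let ?b = "hyperbolic_metric x" and ?Y = "conf_Y x p"
  have bY: "(\<Sum>i\<in>UNIV. ?b $ k $ i * ?Y $ i) = \<beta> $ k" for k
  proof -
    have "x \<bullet> ?Y = (1 + x \<bullet> p) * (1 + x \<bullet> x) - 1"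
      by (simp add: conf_Y_def inner_add_right algebra_simps)
    then have "x $ k * (x \<bullet> ?Y) / (1 + x \<bullet> x) = x $ k * (1 + x \<bullet> p) - x $ k / (1 + x \<bullet> x)"
      using one_plus_inner_pos(2)[of x] by (simp only: right_diff_distrib diff_divide_distrib) simp
    then show ?thesis
      unfolding sum_hyperbolic_metric by (simp add: conf_Y_def \<beta>_def algebra_simps)
  qed
  have bY': "?b $ j \<bullet> ?Y = \<beta> $ j" for j
    using bY by (simp add: inner_vec_eq)
  have inner: "(\<Sum>m\<in>UNIV. conf_Gamma x p i j m * conf_Gamma x p m i k) =
      2 * p $ j * p $ k * kd i j - ?b $ j $ k * (p \<bullet> ?Y) * kd i j
      + p $ j * conf_Gamma x p i i k
      - p $ k * (?b $ j $ i * ?Y $ i) - ?b $ j $ k * (p $ i * ?Y $ i) + \<beta> $ j * (?b $ k $ i * ?Y $ i)" for i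
  proof -
    have "conf_Gamma x p i j m * conf_Gamma x p m i k =
        kd i j * (p $ m * conf_Gamma x p m i k) + p $ j * (kd m i * conf_Gamma x p m i k)
        - ?Y $ i * (?b $ j $ m * conf_Gamma x p m i k)" for m
      by (simp add: conf_Gamma_def[of x p i j m] kd_commute[of i m] algebra_simps)
    then have "(\<Sum>m\<in>UNIV. conf_Gamma x p i j m * conf_Gamma x p m i k) =
        kd i j * (p $ k * p $ i + p $ i * p $ k - ?b $ i $ k * (p \<bullet> ?Y)) + p $ j * conf_Gamma x p i i k
        - ?Y $ i * (p $ k * ?b $ j $ i + p $ i * ?b $ j $ k - ?b $ i $ k * \<beta> $ j)"
      by (simp only: sum.distrib sum_subtractf sum_distrib_left[symmetric] conf_Gamma_contract sum_kd bY')
    also have "kd i j * (p $ k * p $ i + p $ i * p $ k - ?b $ i $ k * (p \<bullet> ?Y)) =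
        kd i j * (2 * p $ j * p $ k - ?b $ j $ k * (p \<bullet> ?Y))"
      by (simp add: kd_def)
    finally show ?thesis
      by (simp add: hyperbolic_symmetric(1)[of x i k] algebra_simps)
  qed
  have "(\<Sum>i\<in>UNIV. \<Sum>m\<in>UNIV. conf_Gamma x p i j m * conf_Gamma x p m i k) =
     2 * p $ j * p $ k - ?b $ j $ k * (p \<bullet> ?Y) + p $ j * (real CARD('n) * p $ k - x $ k / (1 + x \<bullet> x))
     - p $ k * \<beta> $ j - ?b $ j $ k * (p \<bullet> ?Y) + \<beta> $ j * \<beta> $ k"
    unfolding inner
    by (simp only: sum.distrib sum_subtractf sum_distrib_left[symmetric] conf_Gamma_trace bY
        inner_vec_eq[of p ?Y] sum_kd_one mult_1_right)
  then show ?thesis by (simp add: algebra_simps)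
qed

section \<open>Traces with respect to the hyperbolic metric\<close>

definition hyp_trace :: "real^'n::finite \<Rightarrow> ('n \<Rightarrow> 'n \<Rightarrow> real) \<Rightarrow> real" where
  "hyp_trace x E = (\<Sum>j\<in>UNIV. \<Sum>k\<in>UNIV. hyperbolic_inverse x $ j $ k * E j k)"

lemma hyp_trace_linear:
  "hyp_trace x (\<lambda>j k. E j k + F j k) = hyp_trace x E + hyp_trace x F"
  "hyp_trace x (\<lambda>j k. E j k - F j k) = hyp_trace x E - hyp_trace x F"
  "hyp_trace x (\<lambda>j k. c * E j k) = c * hyp_trace x E"
  by (simp_all add: hyp_trace_def algebra_simps sum.distrib sum_subtractf sum_distrib_left)

lemma hyp_trace_commute: "hyp_trace x (\<lambda>j k. E k j) = hyp_trace x E"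
  unfolding hyp_trace_def by (subst sum.swap) (simp add: hyperbolic_symmetric(2)[of x])

lemma hyp_trace_metric: "hyp_trace x (\<lambda>j k. hyperbolic_metric x $ j $ k) = real CARD('n)"
  for x :: "real^'n::finite"
  unfolding hyp_trace_def
  by (subst hyperbolic_symmetric(1)) (simp add: hyperbolic_inverse_mult hyperbolic_symmetric(1)[of x])

lemma hyp_trace_prod: "hyp_trace x (\<lambda>j k. v $ j * w $ k) = v \<bullet> w + (x \<bullet> v) * (x \<bullet> w)"
proof -
  have "hyp_trace x (\<lambda>j k. v $ j * w $ k) = (\<Sum>j\<in>UNIV. v $ j * (\<Sum>k\<in>UNIV. hyperbolic_inverse x $ j $ k * w $ k))"
    by (simp add: hyp_trace_def sum_distrib_left mult_ac)
  also have "\<dots> = (\<Sum>j\<in>UNIV. v $ j * w $ j + (x \<bullet> w) * (x $ j * v $ j))"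
    unfolding sum_hyperbolic_inverse by (simp add: algebra_simps)
  finally show ?thesis
    by (simp add: sum.distrib inner_vec_eq flip: sum_distrib_left)
qed

lemma hyp_trace_eq:
  "hyp_trace x E = (\<Sum>j\<in>UNIV. E j j) + (\<Sum>j\<in>UNIV. \<Sum>k\<in>UNIV. x $ j * x $ k * E j k)"
  by (simp add: hyp_trace_def hyperbolic_inverse_def distrib_right sum.distrib)

lemma hyp_trace_kd: "hyp_trace x kd = real CARD('n) + x \<bullet> x" for x :: "real^'n::finite"
proof -
  have "kd j k = hyperbolic_metric x $ j $ k + 1 / (1 + x \<bullet> x) * (x $ j * x $ k)" for j k
    by (simp add: hyperbolic_metric_component)
  then have "hyp_trace x kd = hyp_trace x (\<lambda>j k. hyperbolic_metric x $ j $ k + 1 / (1 + x \<bullet> x) * (x $ j * x $ k))"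
    by (intro arg_cong[where f = "hyp_trace x"] ext)
  also have "\<dots> = real CARD('n) + 1 / (1 + x \<bullet> x) * (x \<bullet> x * (1 + x \<bullet> x))"
    unfolding hyp_trace_linear hyp_trace_metric hyp_trace_prod by (simp add: algebra_simps)
  finally show ?thesis using one_plus_inner_pos(2)[of x] by simp
qed

text \<open>The four groups in parentheses are the four terms of the contracted Riemann tensor, in
  the order of \<open>riemann\<close>. \<open>T\<close> is the trace of the Christoffel symbols,
  \<beta> is \<open>Y\<close> with its index lowered, and \<open>D\<close> is the Euclidean
  divergence of the field \<open>conf_Y\<close>.\<close>

lemma ricci_conformal:
  fixes x :: "real^'n::finite" and p :: "real^'n \<Rightarrow> real^'n" and dp :: "real^'n^'n"
  assumes S: "open S" "x \<in> S"
    and u: "\<And>y. y \<in> S \<Longrightarrow> u y \<noteq> 0" "\<And>y. y \<in> S \<Longrightarrow> GDERIV u y :> (2 * u y) *\<^sub>R p y"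
    and p: "\<And>i. GDERIV (\<lambda>y. p y $ i) x :> dp $ i"
  defines "n \<equiv> real CARD('n)" and "q \<equiv> 1 + x \<bullet> x" and "b \<equiv> hyperbolic_metric x"
    and "P \<equiv> p x" and "Y \<equiv> conf_Y x (p x)"
  defines "\<beta> \<equiv> P + (1 / q) *\<^sub>R x" and "T \<equiv> n *\<^sub>R P - (1 / q) *\<^sub>R x"
  defines "D \<equiv> hyp_trace x (\<lambda>j k. dp $ j $ k) + n * (1 + x \<bullet> P) + x \<bullet> P"
  shows "ricci (\<lambda>y. u y *\<^sub>R hyperbolic_metric y) j k x =
     (dp $ k $ j + dp $ j $ k + (Y $ j * x $ k + x $ j * Y $ k) / q - 2 * (x \<bullet> Y) / q\<^sup>2 * (x $ j * x $ k)
        - D * b $ j $ k)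
     - (n * dp $ k $ j - kd j k / q + 2 * (x $ j * x $ k) / q\<^sup>2)
     + (T $ j * P $ k + T $ k * P $ j - b $ j $ k * (T \<bullet> Y))
     - ((n + 2) * P $ j * P $ k - b $ j $ k * (P \<bullet> Y) - P $ j * x $ k / q
         - (P $ k * \<beta> $ j + P \<bullet> Y * b $ j $ k - \<beta> $ k * \<beta> $ j))"
proof -
  let ?G = "\<lambda>k i j. christoffel (\<lambda>y. u y *\<^sub>R hyperbolic_metric y) k i j"
  have G: "?G k i j y = conf_Gamma y (p y) k i j" if "y \<in> S" for k i j y
    using christoffel_conformal[OF u(1,2)[OF that]] .
  have dG: "partial m (?G k i j) x = kd k i * dp $ j $ m + kd k j * dp $ i $ m - d_hyp x m i j * Y $ k
      - b $ i $ j * (dp $ k $ m + (1 + x \<bullet> P) * kd k m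
           + x $ k * (P $ m + (\<Sum>l\<in>UNIV. x $ l * dp $ l $ m)))" for m k i j
    by (subst partial_cong[OF S _ GDERIV_conf_Gamma[OF p]]) (simp_all add: G Y_def P_def b_def)
  have q: "q \<noteq> 0" by (simp add: q_def one_plus_inner_pos)
  have S1: "(\<Sum>i\<in>UNIV. partial i (?G i j k) x) =
     dp $ k $ j + dp $ j $ k + (Y $ j * x $ k + x $ j * Y $ k) / q - 2 * (x \<bullet> Y) / q\<^sup>2 * (x $ j * x $ k)
        - D * b $ j $ k"
  proof -
    let ?W = "\<lambda>i. \<Sum>l\<in>UNIV. x $ l * dp $ l $ i"
    define E where "E = (\<lambda>i. dp $ i $ i + (1 + x \<bullet> P) + x $ i * P $ i + x $ i * ?W i)"
    have 1: "partial i (?G i j k) x = kd i j * dp $ k $ i + kd i k * dp $ j $ i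
        + (x $ k / q) * (kd i j * Y $ i) + (x $ j / q) * (kd i k * Y $ i)
        - (2 * x $ j * x $ k / q\<^sup>2) * (x $ i * Y $ i)
        - b $ j $ k * E i" for i
      unfolding E_def dG d_hyp_def q_def[symmetric]
      by (simp add: algebra_simps add_divide_distrib diff_divide_distrib)
    have 2: "(\<Sum>i\<in>UNIV. x $ i * ?W i) = (\<Sum>j\<in>UNIV. \<Sum>k\<in>UNIV. x $ j * x $ k * dp $ j $ k)"
      by (simp add: sum_distrib_left) (subst sum.swap, simp add: mult_ac)
    have 3: "(\<Sum>i\<in>UNIV. E i) = D"
      by (simp only: E_def sum.distrib 2 D_def hyp_trace_eq inner_vec_eq[of x P]) (simp add: n_def algebra_simps)
    show ?thesis
      unfolding 1
      by (simp only: sum.distrib sum_subtractf sum_distrib_left[symmetric] sum_kd 3 inner_vec_eq[of x Y])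
         (simp add: algebra_simps add_divide_distrib)
  qed
  \<comment> \<open>The trace is differentiated in its closed form \<open>conf_Gamma_trace\<close>;
    uniqueness of gradients equates the result with the sum of the derivatives.\<close>
  have S2: "(\<Sum>i\<in>UNIV. partial j (?G i i k) x) = n * dp $ k $ j - kd j k / q + 2 * (x $ j * x $ k) / q\<^sup>2"
  proof -
    have "GDERIV (\<lambda>y. \<Sum>i\<in>UNIV. conf_Gamma y (p y) i i k) x :>
       (\<Sum>i\<in>UNIV. (\<chi> m. partial m (?G i i k) x))"
      unfolding dG Y_def b_def P_def by (intro GDERIV_sum GDERIV_conf_Gamma[OF p])
    moreover have "GDERIV (\<lambda>y. \<Sum>i\<in>UNIV. conf_Gamma y (p y) i i k) x :>
       n *\<^sub>R dp $ k - (x $ k *\<^sub>R (- (inverse (1 + x \<bullet> x))\<^sup>2 *\<^sub>R (0 + 2 *\<^sub>R x)) + inverse (1 + x \<bullet> x) *\<^sub>R axis k 1)"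
      unfolding conf_Gamma_trace n_def divide_inverse
      by (intro GDERIV_diff GDERIV_cmult GDERIV_const GDERIV_mult GDERIV_component GDERIV_inverse
         GDERIV_add GDERIV_inner_self one_plus_inner_pos p)
    ultimately have "(\<Sum>i\<in>UNIV. (\<chi> m. partial m (?G i i k) x)) = 
       n *\<^sub>R dp $ k - (x $ k *\<^sub>R (- (inverse (1 + x \<bullet> x))\<^sup>2 *\<^sub>R (0 + 2 *\<^sub>R x)) + inverse (1 + x \<bullet> x) *\<^sub>R axis k 1)"
      by (rule GDERIV_unique)
    then have "(\<Sum>i\<in>UNIV. (\<chi> m. partial m (?G i i k) x)) $ j = 
       (n *\<^sub>R dp $ k - (x $ k *\<^sub>R (- (inverse (1 + x \<bullet> x))\<^sup>2 *\<^sub>R (0 + 2 *\<^sub>R x)) + inverse (1 + x \<bullet> x) *\<^sub>R axis k 1)) $ j"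
      by simp
    then show ?thesis
      by (simp add: axis_kd flip: q_def) (simp add: divide_inverse power_inverse algebra_simps)
  qed
  have S3: "(\<Sum>i\<in>UNIV. \<Sum>m\<in>UNIV. ?G i i m x * ?G m j k x) =
      T $ j * P $ k + T $ k * P $ j - b $ j $ k * (T \<bullet> Y)"
  proof -
    have "(\<Sum>i\<in>UNIV. \<Sum>m\<in>UNIV. ?G i i m x * ?G m j k x) =
        (\<Sum>m\<in>UNIV. (\<Sum>i\<in>UNIV. conf_Gamma x P i i m) * conf_Gamma x P m j k)"
      unfolding G[OF S(2)] P_def by (subst sum.swap) (simp add: sum_distrib_right)
    also have "\<dots> = (\<Sum>m\<in>UNIV. T $ m * conf_Gamma x P m j k)"
      by (simp add: conf_Gamma_trace T_def n_def q_def)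
    finally show ?thesis
      unfolding conf_Gamma_contract by (simp add: Y_def P_def b_def)
  qed
  have S4: "(\<Sum>i\<in>UNIV. \<Sum>m\<in>UNIV. ?G i j m x * ?G m i k x) =
      (n + 2) * P $ j * P $ k - b $ j $ k * (P \<bullet> Y) - P $ j * x $ k / q
         - (P $ k * \<beta> $ j + P \<bullet> Y * b $ j $ k - \<beta> $ k * \<beta> $ j)"
    unfolding G[OF S(2)] conf_Gamma_quadratic
    by (simp add: n_def P_def b_def q_def Y_def \<beta>_def)
  show ?thesis
    unfolding ricci_def riemann_def
    by (simp only: sum.distrib sum_subtractf S1 S2 S3 S4) 
qed

text \<open>For u = e^(2 phi) the field \<open>p\<close> is d phi. Because the background symbols
  are -b_ij x_k, the trace of \<open>dp\<close> plus n (x . p) is the hyperbolic Laplacian of phi,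
  while p . p + (x . p)^2 is the squared hyperbolic length of d phi. This is the classical formula
  for a conformal change.\<close>

theorem scalar_curvature_conformal_log:
  fixes x :: "real^'n::finite" and p :: "real^'n \<Rightarrow> real^'n" and dp :: "real^'n^'n"
  assumes S: "open S" "x \<in> S"
    and u: "\<And>y. y \<in> S \<Longrightarrow> u y \<noteq> 0" "\<And>y. y \<in> S \<Longrightarrow> GDERIV u y :> (2 * u y) *\<^sub>R p y"
    and p: "\<And>i. GDERIV (\<lambda>y. p y $ i) x :> dp $ i"
  defines "n \<equiv> real CARD('n)"
  shows "scalar_curvature (\<lambda>y. u y *\<^sub>R hyperbolic_metric y) x =
     (- n * (n - 1) - 2 * (n - 1) * (hyp_trace x (\<lambda>j k. dp $ j $ k) + n * (x \<bullet> p x))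
       - (n - 1) * (n - 2) * (p x \<bullet> p x + (x \<bullet> p x)\<^sup>2)) / u x"
proof -
  define P where "P = p x"
  define X where "X = x \<bullet> x"
  define s where "s = x \<bullet> P"
  define PP where "PP = P \<bullet> P"
  define q where "q = 1 + x \<bullet> x"
  define D where "D = hyp_trace x (\<lambda>j k. dp $ j $ k)"
  define Y where "Y = conf_Y x P"
  define \<beta> where "\<beta> = P + (1 / q) *\<^sub>R x"
  define T where "T = n *\<^sub>R P - (1 / q) *\<^sub>R x"
  define \<sigma> where "\<sigma> = x \<bullet> Y"
  define \<pi> where "\<pi> = P \<bullet> Y"
  define \<theta> where "\<theta> = T \<bullet> Y"
  define D' where "D' = D + n * (1 + x \<bullet> P) + x \<bullet> P"
  let ?b = "hyperbolic_metric x"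
  have q: "q \<noteq> 0" and qX: "q = 1 + X" by (simp_all add: q_def one_plus_inner_pos X_def)
  \<comment> \<open>Sorted into dyads, the Kronecker symbol, the metric and \<open>dp\<close>, so
    that the trace can be read off term by term.\<close>
  have ric: "ricci (\<lambda>y. u y *\<^sub>R hyperbolic_metric y) j k x =
     dp $ j $ k + (1 - n) * dp $ k $ j + (1 / q) * (Y $ j * x $ k) + (1 / q) * (x $ j * Y $ k)
     - (2 * \<sigma> / q\<^sup>2 + 2 / q\<^sup>2) * (x $ j * x $ k) + (1 / q) * kd j k
     + T $ j * P $ k + P $ j * T $ k - (n + 2) * (P $ j * P $ k) + (1 / q) * (P $ j * x $ k)
     + \<beta> $ j * P $ k - \<beta> $ j * \<beta> $ k
     - (D' + \<theta> - 2 * \<pi>) * ?b $ j $ k" for j k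
  proof -
    show ?thesis
      using ricci_conformal[OF S u p, of j k]
      unfolding n_def[symmetric] q_def[symmetric] P_def[symmetric] Y_def[symmetric] D_def[symmetric]
        \<beta>_def[symmetric] T_def[symmetric] D'_def[symmetric] \<sigma>_def[symmetric] \<pi>_def[symmetric] \<theta>_def[symmetric]
      by (simp add: algebra_simps add_divide_distrib diff_divide_distrib)
  qed
  have "scalar_curvature (\<lambda>y. u y *\<^sub>R hyperbolic_metric y) x =
      hyp_trace x (\<lambda>j k. ricci (\<lambda>y. u y *\<^sub>R hyperbolic_metric y) j k x) / u x"
    unfolding scalar_curvature_def inv_metric_def inv_metric_conformal[OF u(1)[OF S(2)]] hyp_trace_def
    by (simp add: sum_divide_distrib field_simps)
  also have "hyp_trace x (\<lambda>j k. ricci (\<lambda>y. u y *\<^sub>R hyperbolic_metric y) j k x) =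
      D + (1 - n) * D + (1 / q) * (Y \<bullet> x + \<sigma> * X) + (1 / q) * (x \<bullet> Y + X * \<sigma>)
     - (2 * \<sigma> / q\<^sup>2 + 2 / q\<^sup>2) * (X + X * X) + (1 / q) * (n + X)
     + (T \<bullet> P + (x \<bullet> T) * s) + (P \<bullet> T + s * (x \<bullet> T)) - (n + 2) * (PP + s * s) + (1 / q) * (P \<bullet> x + s * X)
     + (\<beta> \<bullet> P + (x \<bullet> \<beta>) * s) - (\<beta> \<bullet> \<beta> + (x \<bullet> \<beta>) * (x \<bullet> \<beta>))
     - (D' + \<theta> - 2 * \<pi>) * n"
    unfolding ric hyp_trace_linear hyp_trace_metric hyp_trace_kd hyp_trace_prod
      hyp_trace_commute[of x "\<lambda>j k. dp $ j $ k"]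
    by (simp add: D_def n_def X_def s_def PP_def \<sigma>_def)
  also have "\<dots> = - n * (n - 1) - 2 * (n - 1) * (D + n * s) - (n - 1) * (n - 2) * (PP + s\<^sup>2)"
  proof -
    \<comment> \<open>In terms of t = 1/q the relation t X = 1 - t ties the scalars together, and
      the claim becomes a polynomial identity.\<close>
    define t where "t = 1 / q"
    have tX: "t * X = 1 - t" and qt: "t * q = 1" using q by (auto simp: t_def qX field_simps)
    have \<sigma>: "\<sigma> = s + (1 + s) * X"
      by (simp add: \<sigma>_def Y_def conf_Y_def inner_add_right s_def X_def)
    have xP: "P \<bullet> x = s" "x \<bullet> P = s" by (simp_all add: s_def inner_commute)
    have \<pi>: "\<pi> = PP + (1 + s) * s"
      by (simp add: \<pi>_def Y_def conf_Y_def inner_add_right PP_def xP)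
    have \<theta>: "\<theta> = n * \<pi> - t * \<sigma>"
      by (simp add: \<theta>_def T_def inner_diff_left \<pi>_def \<sigma>_def t_def)
    have a1: "Y \<bullet> x = \<sigma>" "x \<bullet> Y = \<sigma>" by (simp_all add: \<sigma>_def inner_commute)
    have a2: "T \<bullet> P = n * PP - t * s" "P \<bullet> T = n * PP - t * s" "x \<bullet> T = n * s - t * X"
      by (simp_all add: T_def inner_diff_left inner_diff_right PP_def xP t_def X_def)
    have a3: "\<beta> \<bullet> P = PP + t * s" "x \<bullet> \<beta> = s + t * X"
      by (simp_all add: \<beta>_def inner_add_left inner_add_right PP_def xP t_def X_def)
    have a4: "\<beta> \<bullet> \<beta> = PP + 2 * t * s + t * t * X"
      unfolding \<beta>_def inner_add_left inner_add_right inner_scaleR_left inner_scaleR_right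
      by (simp add: PP_def[symmetric] X_def[symmetric] xP t_def add_divide_distrib)
    have t\<sigma>: "t * \<sigma> = s + 1 - t" using tX unfolding \<sigma> by algebra
    have t2: "2 * \<sigma> / q\<^sup>2 + 2 / q\<^sup>2 = 2 * t * (t * \<sigma>) + 2 * t * t"
      by (simp add: t_def power2_eq_square)
    have D': "D' = D + n * (1 + s) + s" by (simp add: D'_def xP)
    show ?thesis
      unfolding a1 a2 a3 a4 t2 t_def[symmetric] \<theta> D' xP t\<sigma> \<pi>
      using tX t\<sigma> by algebra
  qed
  finally show ?thesis
    by (simp add: D_def s_def PP_def P_def)
qed

text \<open>Obtained by inserting p = du/(2u). The squared gradient receives n-1 from the Laplacian
  of log u and -(n-1)(n-2)/4 from the quadratic term, together -(n-1)(n-6)/4. For u > 0 and n > 1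
  the sign is that of the last bracket.\<close>

theorem scalar_curvature_conformal:
  fixes x :: "real^'n::finite" and du :: "real^'n \<Rightarrow> real^'n" and ddu :: "real^'n^'n"
  assumes S: "open S" "x \<in> S"
    and u: "\<And>y. y \<in> S \<Longrightarrow> u y \<noteq> 0" "\<And>y. y \<in> S \<Longrightarrow> GDERIV u y :> du y"
    and du: "\<And>i. GDERIV (\<lambda>y. du y $ i) x :> ddu $ i"
  defines "n \<equiv> real CARD('n)"
  defines "lap \<equiv> hyp_trace x (\<lambda>j k. ddu $ j $ k) + n * (x \<bullet> du x)"
    and "sq \<equiv> du x \<bullet> du x + (x \<bullet> du x)\<^sup>2"
  shows "scalar_curvature (\<lambda>y. u y *\<^sub>R hyperbolic_metric y) x + n * (n - 1) =
     (n - 1) / u x ^ 3 * (u x * (n * u x * (u x - 1) - lap) - (n - 6) / 4 * sq)"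
proof -
  define p where "p y = (1 / (2 * u y)) *\<^sub>R du y" for y
  define dp where "dp = (\<chi> i. (1 / (2 * u x)) *\<^sub>R ddu $ i - (1 / (2 * (u x)\<^sup>2)) *\<^sub>R (du x $ i *\<^sub>R du x))"
  have ux: "u x \<noteq> 0" by (rule u(1)[OF S(2)])
  have 1: "GDERIV u y :> (2 * u y) *\<^sub>R p y" if "y \<in> S" for y
    using u[OF that] by (simp add: p_def)
  have 2: "GDERIV (\<lambda>y. p y $ i) x :> dp $ i" for i
  proof -
    have "GDERIV (\<lambda>y. 1 / 2 * (inverse (u y) * du y $ i)) x :>
       (1 / 2) *\<^sub>R (inverse (u x) *\<^sub>R ddu $ i + du x $ i *\<^sub>R (- (inverse (u x))\<^sup>2 *\<^sub>R du x))"
      by (intro GDERIV_cmult GDERIV_mult GDERIV_inverse du u S ux)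
    moreover have "(\<lambda>y. p y $ i) = (\<lambda>y. 1 / 2 * (inverse (u y) * du y $ i))"
      by (simp add: p_def fun_eq_iff field_simps)
    ultimately show ?thesis
      by (simp only:, elim GDERIV_subst) 
         (simp add: dp_def vec_eq_iff power_inverse field_simps)
  qed
  have dp: "hyp_trace x (\<lambda>j k. dp $ j $ k) =
      1 / (2 * u x) * hyp_trace x (\<lambda>j k. ddu $ j $ k) - 1 / (2 * (u x)\<^sup>2) * sq"
  proof -
    have "dp $ j $ k = 1 / (2 * u x) * ddu $ j $ k - 1 / (2 * (u x)\<^sup>2) * (du x $ j * du x $ k)" for j k
      by (simp add: dp_def)
    then show ?thesis
      by (simp only: hyp_trace_linear hyp_trace_prod sq_def power2_eq_square)
  qed
  define k where "k = inverse (u x)"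
  define s where "s = x \<bullet> du x"
  define H where "H = hyp_trace x (\<lambda>j k. ddu $ j $ k)"
  define Q where "Q = sq / 4"
  have k: "k * u x = 1" using ux by (simp add: k_def)
  have p: "p x = (k / 2) *\<^sub>R du x" by (simp add: p_def k_def field_simps)
  have 3: "p x \<bullet> p x + (x \<bullet> p x)\<^sup>2 = k\<^sup>2 * Q"
    unfolding p inner_scaleR_left inner_scaleR_right Q_def sq_def
    by (simp add: power2_eq_square algebra_simps)
  have 4: "x \<bullet> p x = k / 2 * s" by (simp add: p s_def)
  have 5: "hyp_trace x (\<lambda>j k. dp $ j $ k) = k / 2 * H - 2 * k\<^sup>2 * Q"
    unfolding dp H_def[symmetric] Q_def k_def using ux by (simp add: field_simps)
  have sc: "scalar_curvature (\<lambda>y. u y *\<^sub>R hyperbolic_metric y) x =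
     (- n * (n - 1) - 2 * (n - 1) * (hyp_trace x (\<lambda>j k. dp $ j $ k) + n * (x \<bullet> p x))
       - (n - 1) * (n - 2) * (p x \<bullet> p x + (x \<bullet> p x)\<^sup>2)) / u x"
    unfolding n_def by (rule scalar_curvature_conformal_log[OF S]) (erule u(1) 1 | rule 2)+
  have "scalar_curvature (\<lambda>y. u y *\<^sub>R hyperbolic_metric y) x + n * (n - 1) =
     (- n * (n - 1) - 2 * (n - 1) * (k / 2 * H - 2 * k\<^sup>2 * Q + n * (k / 2 * s))
       - (n - 1) * (n - 2) * (k\<^sup>2 * Q)) * k + n * (n - 1)"
    unfolding sc 3
    unfolding 4 5
    by (simp only: k_def divide_inverse[of _ "u x"])
  also have "\<dots> = (- n * (n - 1) - (n - 1) * (k * H - 4 * k\<^sup>2 * Q + n * (k * s))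
       - (n - 1) * (n - 2) * (k\<^sup>2 * Q)) * k + n * (n - 1)"
    by (simp add: algebra_simps add_divide_distrib diff_divide_distrib)
  also have "\<dots> = (n - 1) * k ^ 3 * (u x * (n * u x * (u x - 1) - (H + n * s)) - (n - 6) * Q)"
    using k by algebra
  also have "(n - 1) * k ^ 3 = (n - 1) / u x ^ 3"
    by (simp add: k_def divide_inverse power_inverse)
  also have "H + n * s = lap" by (simp only: lap_def H_def s_def)
  also have "(n - 6) * Q = (n - 6) / 4 * sq" by (simp add: Q_def)
  finally show ?thesis .
qed

section \<open>The perturbation\<close>

definition inv_V :: "real^'n::finite \<Rightarrow> real" where
  "inv_V x = inverse (V_time x)"

lemma V_time_eq: "V_time x = sqrt (1 + x \<bullet> x)"
  unfolding V_time_def power2_norm_eq_inner ..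

lemma inv_V_pos: "inv_V x > 0"
  by (simp add: inv_V_def V_time_def add_pos_nonneg)

lemma inv_V_sq: "(inv_V x)\<^sup>2 * (1 + x \<bullet> x) = 1"
  using one_plus_inner_pos[of x] by (simp add: inv_V_def V_time_eq power_inverse)

lemma inv_V_le_1: "inv_V x \<le> 1"
  by (simp add: inv_V_def V_time_def inverse_le_1_iff)

text \<open>The basis of all decay estimates: each factor x costs one power of
  \<open>inv_V\<close>.\<close>

lemma norm_mult_inv_V: "norm x * inv_V x \<le> 1"
proof -
  have "norm x \<le> V_time x"
    unfolding V_time_def by (rule real_le_rsqrt) simp
  then show ?thesis
    using inv_V_pos[of x] by (simp add: inv_V_def field_simps)
qed

lemma GDERIV_V_time: "GDERIV V_time x :> inv_V x *\<^sub>R x"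
proof -
  have "GDERIV (\<lambda>x. sqrt (1 + x \<bullet> x)) x :> (inverse (sqrt (1 + x \<bullet> x)) / 2) *\<^sub>R (0 + 2 *\<^sub>R x)"
    by (intro GDERIV_DERIV_compose[of "\<lambda>x. 1 + x \<bullet> x"] GDERIV_add GDERIV_const GDERIV_inner_self
        DERIV_real_sqrt one_plus_inner_pos)
  then show ?thesis
    by (simp add: inv_V_def V_time_eq[abs_def])
qed

lemma GDERIV_inv_V: "GDERIV inv_V x :> - (inv_V x ^ 3) *\<^sub>R x"
proof -
  have "V_time x \<noteq> 0" using inv_V_pos[of x] by (auto simp: inv_V_def)
  from GDERIV_inverse[OF GDERIV_V_time this] show ?thesis
    by (simp add: inv_V_def[abs_def] power3_eq_cube power2_eq_square)
qed

lemma GDERIV_inv_V_power: "GDERIV (\<lambda>x. inv_V x ^ m) x :> (- (real m * inv_V x ^ (m + 2))) *\<^sub>R x"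
proof -
  have "GDERIV (\<lambda>x. inv_V x ^ m) x :> (real m * inv_V x ^ (m - 1)) *\<^sub>R (- (inv_V x ^ 3) *\<^sub>R x)"
    by (rule GDERIV_DERIV_compose[OF GDERIV_inv_V]) (auto intro!: derivative_eq_intros)
  \<comment> \<open>For m = 0 the truncated exponent m - 1 does no harm, because the factor
    \<open>real m\<close> vanishes.\<close>
  moreover have "real m * inv_V x ^ (m - 1) * inv_V x ^ 3 = real m * inv_V x ^ (m + 2)"
    by (cases m) (simp_all add: algebra_simps power3_eq_cube power2_eq_square)
  ultimately show ?thesis
    by (elim GDERIV_subst) (simp add: vec_eq_iff del: power_Suc)
qed

context
  fixes a :: real and c :: "real^'n::finite"
begin

definition pert :: "real^'n \<Rightarrow> real" where
  "pert x = a * inv_V x ^ CARD('n) + (c \<bullet> x - 1) * inv_V x ^ (CARD('n) + 1)"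

text \<open>The coefficient of -x in the gradient: differentiating a power of \<open>inv_V\<close>
  raises its exponent by 2 and produces a multiple of -x.\<close>

definition pert_radial :: "real^'n \<Rightarrow> real" where
  "pert_radial x = a * CARD('n) * inv_V x ^ (CARD('n) + 2)
     + (CARD('n) + 1) * (c \<bullet> x - 1) * inv_V x ^ (CARD('n) + 3)"

definition grad_pert :: "real^'n \<Rightarrow> real^'n" where
  "grad_pert x = inv_V x ^ (CARD('n) + 1) *\<^sub>R c - pert_radial x *\<^sub>R x"

definition grad_pert_radial :: "real^'n \<Rightarrow> real^'n" where
  "grad_pert_radial x = ((CARD('n) + 1) * inv_V x ^ (CARD('n) + 3)) *\<^sub>R c
     - (a * CARD('n) * (CARD('n) + 2) * inv_V x ^ (CARD('n) + 4)
        + (CARD('n) + 1) * (CARD('n) + 3) * (c \<bullet> x - 1) * inv_V x ^ (CARD('n) + 5)) *\<^sub>R x"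

definition hess_pert :: "real^'n \<Rightarrow> real^'n^'n" where
  "hess_pert x = (\<chi> i. (- (c $ i * ((CARD('n) + 1) * inv_V x ^ (CARD('n) + 3)))) *\<^sub>R x
      - (pert_radial x *\<^sub>R axis i 1 + x $ i *\<^sub>R grad_pert_radial x))"

lemma GDERIV_pert: "GDERIV pert x :> grad_pert x"
proof -
  have "GDERIV pert x :> a *\<^sub>R ((- (real CARD('n) * inv_V x ^ (CARD('n) + 2))) *\<^sub>R x)
     + ((c \<bullet> x - 1) *\<^sub>R ((- (real (CARD('n) + 1) * inv_V x ^ (CARD('n) + 1 + 2))) *\<^sub>R x)
        + inv_V x ^ (CARD('n) + 1) *\<^sub>R (c - 0))"
    unfolding pert_def
    by (intro GDERIV_add GDERIV_cmult GDERIV_inv_V_power GDERIV_mult GDERIV_diff GDERIV_const GDERIV_inner_left)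
  then show ?thesis
    by (rule GDERIV_subst) (simp add: grad_pert_def pert_radial_def vec_eq_iff algebra_simps numeral_3_eq_3)
qed

lemma GDERIV_pert_radial: "GDERIV pert_radial x :> grad_pert_radial x"
proof -
  have "GDERIV pert_radial x :>
     (a * CARD('n)) *\<^sub>R ((- (real (CARD('n) + 2) * inv_V x ^ (CARD('n) + 2 + 2))) *\<^sub>R x)
     + (((CARD('n) + 1) * (c \<bullet> x - 1)) *\<^sub>R ((- (real (CARD('n) + 3) * inv_V x ^ (CARD('n) + 3 + 2))) *\<^sub>R x)
        + inv_V x ^ (CARD('n) + 3) *\<^sub>R ((CARD('n) + 1) *\<^sub>R (c - 0)))"
    unfolding pert_radial_def
    by (intro GDERIV_add GDERIV_cmult GDERIV_inv_V_power GDERIV_mult GDERIV_diff GDERIV_const GDERIV_inner_left)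
  then show ?thesis
    by (rule GDERIV_subst) (simp add: grad_pert_radial_def vec_eq_iff algebra_simps eval_nat_numeral)
qed

lemma GDERIV_grad_pert: "GDERIV (\<lambda>x. grad_pert x $ i) x :> hess_pert x $ i"
proof -
  have "GDERIV (\<lambda>x. c $ i * inv_V x ^ (CARD('n) + 1) - pert_radial x * x $ i) x :>
     c $ i *\<^sub>R ((- (real (CARD('n) + 1) * inv_V x ^ (CARD('n) + 1 + 2))) *\<^sub>R x)
     - (pert_radial x *\<^sub>R axis i 1 + x $ i *\<^sub>R grad_pert_radial x)"
    by (intro GDERIV_diff GDERIV_cmult GDERIV_inv_V_power GDERIV_mult GDERIV_component GDERIV_pert_radial)
  moreover have "(\<lambda>x. grad_pert x $ i) = (\<lambda>x. c $ i * inv_V x ^ (CARD('n) + 1) - pert_radial x * x $ i)"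
    by (simp add: fun_eq_iff grad_pert_def)
  ultimately show ?thesis
    by (simp, elim GDERIV_subst) (simp add: hess_pert_def vec_eq_iff algebra_simps numeral_3_eq_3)
qed

text \<open>The left side is the hyperbolic Laplacian of \<open>pert\<close>. All of its terms of
  order v^n are matched by n \<open>pert\<close>; in the remainder the first summand, which comes
  from -v^(n+1), has order v^(n+1), and the other two are O(v^(n+2)).\<close>

lemma laplacian_pert:
  fixes x :: "real^'n"
  defines "n \<equiv> real CARD('n)"
  shows "hyp_trace x (\<lambda>j k. hess_pert x $ j $ k) + n * (x \<bullet> grad_pert x) =
     n * pert x - ((n + 2) * inv_V x ^ (CARD('n) + 1) + a * n * (n + 1) * inv_V x ^ (CARD('n) + 2)
       + (n + 1) * (n + 2) * (c \<bullet> x - 1) * inv_V x ^ (CARD('n) + 3))"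
proof -
  define v where "v = inv_V x"
  define w where "w = v ^ CARD('n)"
  define X where "X = x \<bullet> x"
  define y where "y = c \<bullet> x"
  have vX: "v\<^sup>2 * (1 + X) = 1" using inv_V_sq[of x] by (simp add: v_def X_def)
  have h: "hess_pert x $ j $ k = (- ((n + 1) * (w * v ^ 3))) * (c $ j * x $ k)
      - (pert_radial x * kd j k + x $ j * grad_pert_radial x $ k)" for j k
    by (simp add: hess_pert_def n_def w_def v_def axis_kd kd_commute[of k j] power_add)
  \<comment> \<open>Replacing v^2 r^2 by 1 - v^2 eliminates r, after which both sides are
    polynomials in \<open>v\<close>, \<open>w\<close> and \<open>y\<close>.\<close>
  define z where "z = v\<^sup>2 * X"
  have z: "z = 1 - v\<^sup>2" using vX by (simp add: z_def algebra_simps)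
  have tr: "hyp_trace x (\<lambda>j k. hess_pert x $ j $ k) =
     (- ((n + 1) * (w * v ^ 3))) * (y + y * X)
      - (pert_radial x * (n + X) + (x \<bullet> grad_pert_radial x) * (1 + X))"
    unfolding h hyp_trace_linear hyp_trace_prod hyp_trace_kd
    by (simp add: y_def X_def n_def inner_commute algebra_simps)
  have r: "pert_radial x = a * n * (w * v\<^sup>2) + (n + 1) * (y - 1) * (w * v ^ 3)"
    by (simp add: pert_radial_def n_def y_def w_def v_def power_add power2_eq_square algebra_simps)
  have rX: "pert_radial x * X = a * n * (w * z) + (n + 1) * (y - 1) * (w * v * z)"
  proof -
    have "(a * n * (w * v\<^sup>2) + (n + 1) * (y - 1) * (w * v ^ 3)) * X =
        a * n * (w * (v\<^sup>2 * X)) + (n + 1) * (y - 1) * (w * v * (v\<^sup>2 * X))"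
      by (simp add: algebra_simps power2_eq_square power3_eq_cube)
    then show ?thesis by (simp only: r z_def)
  qed
  have "x \<bullet> grad_pert_radial x = (n + 1) * (w * v ^ 3) * y
      - (a * n * (n + 2) * (w * v ^ 4) + (n + 1) * (n + 3) * (y - 1) * (w * v ^ 5)) * X"
    unfolding grad_pert_radial_def inner_diff_right inner_scaleR_right
    by (simp add: n_def y_def w_def v_def X_def power_add inner_commute[of x c])
       (simp add: algebra_simps)
  also have "\<dots> = v\<^sup>2 * ((n + 1) * (w * v) * y
      - (a * n * (n + 2) * w + (n + 1) * (n + 3) * (y - 1) * (w * v)) * z)"
    unfolding z_def by (simp add: algebra_simps eval_nat_numeral)
  finally have xg: "x \<bullet> grad_pert_radial x = v\<^sup>2 * ((n + 1) * (w * v) * y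
      - (a * n * (n + 2) * w + (n + 1) * (n + 3) * (y - 1) * (w * v)) * z)" .
  have vX': "v\<^sup>2 * E * (1 + X) = E" for E
    using arg_cong[OF vX, of "\<lambda>t. E * t"] by (simp add: mult_ac)
  have gX: "(x \<bullet> grad_pert_radial x) * (1 + X) = (n + 1) * (w * v) * y
      - (a * n * (n + 2) * w + (n + 1) * (n + 3) * (y - 1) * (w * v)) * z"
    unfolding xg by (rule vX')
  have y1: "(- ((n + 1) * (w * v ^ 3))) * (y + y * X) = - ((n + 1) * (w * v * y))"
  proof -
    have "(- ((n + 1) * (w * v ^ 3))) * (y + y * X) = - ((n + 1) * (w * v * y)) * (v\<^sup>2 * (1 + X))"
      by (simp add: algebra_simps power2_eq_square power3_eq_cube)
    then show ?thesis by (simp add: vX)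
  qed
  have g: "x \<bullet> grad_pert x = w * v * y - pert_radial x * X"
    unfolding grad_pert_def inner_diff_right inner_scaleR_right
    by (simp add: y_def w_def v_def X_def inner_commute[of x c])
  have p: "pert x = a * w + (y - 1) * (w * v)"
    by (simp add: pert_def y_def w_def v_def)
  have pw: "inv_V x ^ (CARD('n) + 1) = w * v" "inv_V x ^ (CARD('n) + 2) = w * v\<^sup>2"
    "inv_V x ^ (CARD('n) + 3) = w * v ^ 3"
    by (simp_all add: w_def v_def power_add power2_eq_square)
  show ?thesis
    unfolding tr y1 gX distrib_left[of "pert_radial x"] g rX p pw y_def[symmetric]
    unfolding r z
    by (simp add: algebra_simps power2_eq_square power3_eq_cube)
qed

section \<open>Decay estimates and the sign of the scalar curvature\<close>

lemma abs_linear_mult_inv_V: "\<bar>c \<bullet> x\<bar> * inv_V x \<le> norm c" "\<bar>c \<bullet> x - 1\<bar> * inv_V x \<le> norm c + 1"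
proof -
  have "\<bar>c \<bullet> x\<bar> * inv_V x \<le> norm c * norm x * inv_V x"
    by (intro mult_right_mono Cauchy_Schwarz_ineq2 less_imp_le inv_V_pos)
  also have "\<dots> \<le> norm c * 1"
    unfolding mult.assoc by (intro mult_left_mono norm_mult_inv_V) simp
  finally show 1: "\<bar>c \<bullet> x\<bar> * inv_V x \<le> norm c" by simp
  have "\<bar>c \<bullet> x - 1\<bar> * inv_V x \<le> (\<bar>c \<bullet> x\<bar> + 1) * inv_V x"
    by (rule mult_right_mono) (use inv_V_pos[of x] in auto)
  with 1 inv_V_le_1[of x] show "\<bar>c \<bullet> x - 1\<bar> * inv_V x \<le> norm c + 1"
    by (simp add: distrib_right)
qed

text \<open>One constant for both estimates: the first three summands bound \<open>pert\<close>,
  while the gradient takes \<open>norm c\<close> and the parenthesis, which bounds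
  \<open>pert_radial\<close>.\<close>

definition pert_bound :: real where
  "pert_bound = \<bar>a\<bar> + norm c + 1 + (CARD('n) * \<bar>a\<bar> + (CARD('n) + 1) * (norm c + 1))"

lemma pert_bound_ge_1: "pert_bound \<ge> 1"
  unfolding pert_bound_def by (simp add: add_nonneg_nonneg)

lemma abs_pert_le: "\<bar>pert x\<bar> \<le> pert_bound * inv_V x ^ CARD('n)"
proof -
  let ?w = "inv_V x ^ CARD('n)"
  have w: "?w \<ge> 0" using inv_V_pos[of x] by simp
  have "\<bar>pert x\<bar> \<le> \<bar>a * ?w\<bar> + \<bar>(c \<bullet> x - 1) * inv_V x ^ (CARD('n) + 1)\<bar>"
    unfolding pert_def by (rule abs_triangle_ineq)
  also have "\<dots> = \<bar>a\<bar> * ?w + \<bar>c \<bullet> x - 1\<bar> * inv_V x * ?w"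
    using inv_V_pos[of x] by (simp add: abs_mult)
  also have "\<dots> \<le> \<bar>a\<bar> * ?w + (norm c + 1) * ?w"
    by (intro add_left_mono mult_right_mono abs_linear_mult_inv_V w)
  also have "\<dots> = (\<bar>a\<bar> + norm c + 1) * ?w" by (simp add: algebra_simps)
  also have "\<dots> \<le> pert_bound * ?w"
    by (intro mult_right_mono w) (simp add: pert_bound_def)
  finally show ?thesis .
qed

lemma norm_grad_pert_le: "norm (grad_pert x) \<le> pert_bound * inv_V x ^ (CARD('n) + 1)"
proof -
  let ?w = "inv_V x ^ (CARD('n) + 1)"
  let ?M = "CARD('n) * \<bar>a\<bar> + (CARD('n) + 1) * (norm c + 1)"
  have w: "?w \<ge> 0" using inv_V_pos[of x] by simp
  have "\<bar>pert_radial x\<bar> \<le> \<bar>a * CARD('n) * inv_V x ^ (CARD('n) + 2)\<bar>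
      + \<bar>(CARD('n) + 1) * (c \<bullet> x - 1) * inv_V x ^ (CARD('n) + 3)\<bar>"
    unfolding pert_radial_def by (rule abs_triangle_ineq)
  also have "\<dots> = CARD('n) * \<bar>a\<bar> * (inv_V x * ?w)
      + (CARD('n) + 1) * (\<bar>c \<bullet> x - 1\<bar> * inv_V x) * (inv_V x * ?w)"
    using inv_V_pos[of x] by (simp add: abs_mult) (simp add: eval_nat_numeral algebra_simps)
  also have "\<dots> \<le> CARD('n) * \<bar>a\<bar> * (inv_V x * ?w)
      + (CARD('n) + 1) * (norm c + 1) * (inv_V x * ?w)"
    by (intro add_left_mono mult_right_mono mult_left_mono abs_linear_mult_inv_V)
      (use w inv_V_pos[of x] in auto)
  also have "\<dots> = ?M * (inv_V x * ?w)" by (simp add: algebra_simps)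
  finally have r: "\<bar>pert_radial x\<bar> \<le> ?M * (inv_V x * ?w)" .
  have "norm (grad_pert x) \<le> ?w * norm c + \<bar>pert_radial x\<bar> * norm x"
    unfolding grad_pert_def using w by (intro order_trans[OF norm_triangle_ineq4]) simp
  also have "\<dots> \<le> ?w * norm c + ?M * (inv_V x * ?w) * norm x"
    by (intro add_left_mono mult_right_mono r) simp
  also have "\<dots> = ?w * norm c + ?M * ?w * (norm x * inv_V x)" by simp
  also have "\<dots> \<le> ?w * norm c + ?M * ?w * 1"
    by (intro add_left_mono mult_left_mono norm_mult_inv_V mult_nonneg_nonneg w) auto
  also have "\<dots> = (norm c + ?M) * ?w" by (simp add: algebra_simps)
  also have "\<dots> \<le> pert_bound * ?w"
    by (intro mult_right_mono w) (simp add: pert_bound_def)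
  finally show ?thesis .
qed

text \<open>The left side is the squared hyperbolic length of the differential. The Euclidean
  estimate has one power of \<open>inv_V\<close> to spare, which the factor x in the radial term
  uses up.\<close>

lemma grad_pert_sq_le:
  "grad_pert x \<bullet> grad_pert x + (x \<bullet> grad_pert x)\<^sup>2 \<le> 2 * (pert_bound * inv_V x ^ CARD('n))\<^sup>2"
proof -
  let ?K = "pert_bound * inv_V x ^ CARD('n)"
  have K: "?K \<ge> 0" using pert_bound_ge_1 inv_V_pos[of x] by simp
  have 1: "norm (grad_pert x) \<le> inv_V x * ?K"
    using norm_grad_pert_le[of x] by (simp add: mult_ac)
  have 2: "norm (grad_pert x) \<le> ?K"
    using 1 mult_right_mono[OF inv_V_le_1 K, of x] by linarith
  have "\<bar>x \<bullet> grad_pert x\<bar> \<le> norm x * norm (grad_pert x)" by (rule Cauchy_Schwarz_ineq2)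
  also have "\<dots> \<le> norm x * (inv_V x * ?K)" by (intro mult_left_mono 1) simp
  also have "\<dots> = (norm x * inv_V x) * ?K" by simp
  also have "\<dots> \<le> 1 * ?K" by (intro mult_right_mono norm_mult_inv_V K)
  finally have 3: "\<bar>x \<bullet> grad_pert x\<bar> \<le> ?K" by simp
  have "grad_pert x \<bullet> grad_pert x = (norm (grad_pert x))\<^sup>2" by (rule dot_square_norm)
  also have "\<dots> \<le> ?K\<^sup>2" by (intro power_mono 2) simp
  finally have 4: "grad_pert x \<bullet> grad_pert x \<le> ?K\<^sup>2" .
  have "(x \<bullet> grad_pert x)\<^sup>2 \<le> ?K\<^sup>2"
    using 3 power2_le_iff_abs_le[OF K] by blast
  with 4 show ?thesis by linarith
qed

lemma inv_V_less:
  assumes "norm x > 1 / e" "e > 0"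
  shows "inv_V x < e"
proof -
  have "1 < e * norm x" using assms by (simp add: field_simps)
  then have "inv_V x * 1 < inv_V x * (e * norm x)"
    using inv_V_pos[of x] by (intro mult_strict_left_mono)
  also have "\<dots> = e * (norm x * inv_V x)" by simp
  also have "\<dots> \<le> e * 1" using assms(2) by (intro mult_left_mono norm_mult_inv_V) simp
  finally show ?thesis by simp
qed

lemma scalar_curvature_pert:
  assumes "CARD('n) \<ge> 3"
  obtains R where "R > 0" "\<And>x. norm x > R \<Longrightarrow> 1 + pert x \<ge> 1 / 2"
    "\<And>x. norm x > R \<Longrightarrow> scalar_curvature (\<lambda>y. (1 + pert y) *\<^sub>R hyperbolic_metric y) x
      \<ge> - (real CARD('n) * (real CARD('n) - 1))"
proof -
  define n where "n = real CARD('n)"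
  have n3: "n \<ge> 3" using assms by (simp add: n_def)
  define K where "K = pert_bound"
  have K: "K \<ge> 1" by (simp add: K_def pert_bound_ge_1)
  \<comment> \<open>Bounds the part of \<open>E\<close> of order t w = v^(n+2); there the linear
    function is bounded after absorbing one factor t.\<close>
  define L where "L = \<bar>a\<bar> * n * (n + 1) + (n + 1) * (n + 2) * (norm c + 1)"
  have L: "L \<ge> 0" using n3 by (simp add: L_def)
  \<comment> \<open>The first entry forces |\<open>pert\<close>| <= 1/2. The second makes the linear
    errors, with constant \<open>L\<close>, and the quadratic ones, with 2 n K^2, together at most w
    = v^(n+1).\<close>
  define e where "e = min (1 / (2 * K)) (1 / (L + 2 * n * K\<^sup>2 + 1))"
  have LK: "L + 2 * n * K\<^sup>2 + 1 > 0" using L n3 by (intro add_nonneg_pos) auto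
  have e: "e > 0" using K LK by (simp add: e_def)
  define R where "R = 1 / e"
  have main: "1 + pert x \<ge> 1 / 2 \<and> (1 + pert x) * (n * (1 + pert x) * pert x
        - (hyp_trace x (\<lambda>j k. hess_pert x $ j $ k) + n * (x \<bullet> grad_pert x)))
      - (n - 6) / 4 * (grad_pert x \<bullet> grad_pert x + (x \<bullet> grad_pert x)\<^sup>2) \<ge> 0" if "norm x > R" for x
  proof -
    define t where "t = inv_V x"
    define w where "w = t ^ (CARD('n) + 1)"
    define E where "E = (n + 2) * w + a * n * (n + 1) * (t * w) + (n + 1) * (n + 2) * ((c \<bullet> x - 1) * t) * (t * w)"
    have t: "t > 0" "t \<le> 1" "t < e"
      using inv_V_pos[of x] inv_V_le_1[of x] inv_V_less[of e x] that e by (auto simp: t_def R_def)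
    have w: "w > 0" using t by (simp add: w_def)
    have t1: "t * (2 * K) \<le> 1" and t2: "t * (L + 2 * n * K\<^sup>2 + 1) \<le> 1"
      using t(3) K LK by (auto simp: e_def field_simps)
    have "\<bar>pert x\<bar> \<le> K * t ^ CARD('n)" using abs_pert_le[of x] by (simp add: K_def t_def)
    also have "\<dots> \<le> K * t ^ 1" using t K assms by (intro mult_left_mono power_decreasing) auto
    also have "\<dots> \<le> 1 / 2" using t1 by (simp add: field_simps)
    finally have u: "1 + pert x \<ge> 1 / 2" by linarith
    have lap: "n * pert x - (hyp_trace x (\<lambda>j k. hess_pert x $ j $ k) + n * (x \<bullet> grad_pert x)) = E"
      unfolding n_def laplacian_pert E_def w_def t_def by (simp add: eval_nat_numeral algebra_simps)
    have q: "(L + 2 * n * K\<^sup>2) * (t * w) \<le> w"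
    proof -
      have "(L + 2 * n * K\<^sup>2) * (t * w) \<le> t * (L + 2 * n * K\<^sup>2 + 1) * w"
        using t w by (simp add: algebra_simps)
      also have "\<dots> \<le> 1 * w" using t2 w by (intro mult_right_mono) auto
      finally show ?thesis by simp
    qed
    have "- (\<bar>a\<bar> * n * (n + 1) * (t * w)) \<le> a * n * (n + 1) * (t * w)"
    proof -
      have "(- \<bar>a\<bar>) * (n * (n + 1) * (t * w)) \<le> a * (n * (n + 1) * (t * w))"
        using t w n3 by (intro mult_right_mono) auto
      then show ?thesis by (simp add: mult_ac)
    qed
    moreover have "- ((n + 1) * (n + 2) * (norm c + 1) * (t * w)) \<le>
        (n + 1) * (n + 2) * ((c \<bullet> x - 1) * t) * (t * w)"
    proof -
      have "\<bar>(c \<bullet> x - 1) * t\<bar> \<le> norm c + 1"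
        using abs_linear_mult_inv_V(2)[of x] t by (simp add: abs_mult t_def)
      then have "- (norm c + 1) \<le> (c \<bullet> x - 1) * t" by linarith
      then have "- (norm c + 1) * ((n + 1) * (n + 2) * (t * w)) \<le> (c \<bullet> x - 1) * t * ((n + 1) * (n + 2) * (t * w))"
        using t w n3 by (intro mult_right_mono) auto
      then show ?thesis by (simp add: algebra_simps)
    qed
    ultimately have EL: "E \<ge> (n + 2) * w - L * (t * w)"
      unfolding E_def L_def by (simp add: algebra_simps)
    have nK: "0 \<le> n * K\<^sup>2 * (t * w)" using n3 t w by simp
    have E0: "E \<ge> 0"
    proof -
      have "0 \<le> n * w" using n3 w by simp
      then show ?thesis using EL q nK w by (simp add: algebra_simps)
    qed
    \<comment> \<open>The square is O(v^(2n)), and 2n >= n+2 with t <= 1 lets it count as an error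
      of order v^(n+2).\<close>
    have sq: "grad_pert x \<bullet> grad_pert x + (x \<bullet> grad_pert x)\<^sup>2 \<le> 2 * K\<^sup>2 * (t * w)"
    proof -
      have "t ^ (2 * CARD('n)) \<le> t ^ (CARD('n) + 2)" using t assms by (intro power_decreasing) auto
      then have "2 * K\<^sup>2 * t ^ (2 * CARD('n)) \<le> 2 * K\<^sup>2 * (t * w)"
        by (intro mult_left_mono) (auto simp: w_def)
      then show ?thesis
        using grad_pert_sq_le[of x] by (simp add: K_def t_def power_mult_distrib power_even_eq power_mult mult_ac)
    qed
    have sq0: "grad_pert x \<bullet> grad_pert x + (x \<bullet> grad_pert x)\<^sup>2 \<ge> 0" by simp
    \<comment> \<open>The coefficient n - 6 may have either sign; since it multiplies a nonnegative
      quantity it can be raised to n.\<close>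
    have "(n - 6) / 4 * (grad_pert x \<bullet> grad_pert x + (x \<bullet> grad_pert x)\<^sup>2)
        \<le> n / 4 * (grad_pert x \<bullet> grad_pert x + (x \<bullet> grad_pert x)\<^sup>2)"
      by (intro mult_right_mono sq0) auto
    also have "\<dots> \<le> n / 4 * (2 * K\<^sup>2 * (t * w))" using n3 by (intro mult_left_mono sq) auto
    finally have s: "(n - 6) / 4 * (grad_pert x \<bullet> grad_pert x + (x \<bullet> grad_pert x)\<^sup>2)
        \<le> n * K\<^sup>2 * (t * w) / 2" by (simp add: mult_ac)
    \<comment> \<open>For u = 1 + f one has n u (u - 1) = n f + n f^2, so the inner bracket is n f^2
      + \<open>E\<close>. The square is dropped and u >= 1/2 is used.\<close>
    have "1 / 2 * E \<le> (1 + pert x) * (n * (pert x)\<^sup>2 + E)"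
      using u E0 n3 by (intro mult_mono) auto
    moreover have "n * (1 + pert x) * pert x
        - (hyp_trace x (\<lambda>j k. hess_pert x $ j $ k) + n * (x \<bullet> grad_pert x)) = n * (pert x)\<^sup>2 + E"
      unfolding lap[symmetric] by (simp add: algebra_simps power2_eq_square)
    moreover have "n * K\<^sup>2 * (t * w) / 2 \<le> 1 / 2 * E"
    proof -
      have "0 \<le> n * w" using n3 w by simp
      then show ?thesis using EL q nK w by (simp add: algebra_simps)
    qed
    ultimately show ?thesis using u s by simp
  qed
  show ?thesis
  proof
    show "R > 0" using e by (simp add: R_def)
    show u: "1 + pert x \<ge> 1 / 2" if "norm x > R" for x using main[OF that] by simp
    show "scalar_curvature (\<lambda>y. (1 + pert y) *\<^sub>R hyperbolic_metric y) x
      \<ge> - (real CARD('n) * (real CARD('n) - 1))" if "norm x > R" for x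
    proof -
      have "scalar_curvature (\<lambda>y. (1 + pert y) *\<^sub>R hyperbolic_metric y) x
         + real CARD('n) * (real CARD('n) - 1) =
        (real CARD('n) - 1) / (1 + pert x) ^ 3 * ((1 + pert x) * (real CARD('n) * (1 + pert x) * (1 + pert x - 1)
           - (hyp_trace x (\<lambda>j k. hess_pert x $ j $ k) + real CARD('n) * (x \<bullet> grad_pert x)))
         - (real CARD('n) - 6) / 4 * (grad_pert x \<bullet> grad_pert x + (x \<bullet> grad_pert x)\<^sup>2))"
      proof (rule scalar_curvature_conformal)
        show "open {y::real^'n. norm y > R}" by (intro open_Collect_less continuous_intros)
        show "x \<in> {y. norm y > R}" using that by simp
        show "1 + pert y \<noteq> 0" if "y \<in> {y. norm y > R}" for y using u[of y] that by auto
        show "GDERIV (\<lambda>y. 1 + pert y) y :> grad_pert y" for y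
          using GDERIV_add[OF GDERIV_const[of 1] GDERIV_pert, of y] by simp
        show "GDERIV (\<lambda>y. grad_pert y $ i) x :> hess_pert x $ i" for i by (rule GDERIV_grad_pert)
      qed
      also have "\<dots> \<ge> 0"
      proof (rule mult_nonneg_nonneg)
        show "(real CARD('n) - 1) / (1 + pert x) ^ 3 \<ge> 0" using u[OF that] n3 by (simp add: n_def)
      qed (use main[OF that] in \<open>simp add: n_def\<close>)
      finally show ?thesis by simp
    qed
  qed
qed

end

section \<open>The conformal compactification\<close>

lemma smooth_onI: "(\<And>k. Ck_on k UNIV f) \<Longrightarrow> smooth_on S f"
  unfolding smooth_on_def by (rule exI[of _ UNIV], rule exI[of _ f]) auto

section \<open>Smoothness and positivity of the perturbed metric\<close>

lemma Ck_on_component: "open U \<Longrightarrow> Ck_on k U (\<lambda>x::real^'n::finite. x $ i)"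
  by (intro Ck_on_linear bounded_linear_vec_nth)

lemma Ck_on_inner: "open U \<Longrightarrow> Ck_on k U (\<lambda>x::'a::real_inner. c \<bullet> x)"
  by (intro Ck_on_linear bounded_linear_inner_right)

lemma Ck_on_sum:
  assumes "open U" "\<And>i. i \<in> I \<Longrightarrow> Ck_on k U (f i)"
  shows "Ck_on k U (\<lambda>x. \<Sum>i\<in>I. f i x)"
  using assms(2) by (induction I rule: infinite_finite_induct) (auto intro: Ck_on_const Ck_on_add assms(1))

lemma Ck_on_inner_self: "open U \<Longrightarrow> Ck_on k U (\<lambda>x::real^'n::finite. x \<bullet> x)"
  unfolding inner_vec_eq by (intro Ck_on_sum Ck_on_mult Ck_on_component)

lemma Ck_on_one_plus_inner_self: "open U \<Longrightarrow> Ck_on k U (\<lambda>x::real^'n::finite. 1 + x \<bullet> x)"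
  by (intro Ck_on_add Ck_on_const Ck_on_inner_self)

lemma Ck_on_V_time: "open U \<Longrightarrow> Ck_on k U (V_time :: real^'n::finite \<Rightarrow> real)"
  unfolding V_time_eq[abs_def] by (intro Ck_on_sqrt Ck_on_one_plus_inner_self one_plus_inner_pos)

lemma V_time_pos: "V_time x > 0"
  using inv_V_pos[of x] by (simp add: inv_V_def)

lemma Ck_on_pert: "open U \<Longrightarrow> Ck_on k U (pert a c)"
  unfolding pert_def inv_V_def
  by (intro Ck_on_add Ck_on_mult Ck_on_const Ck_on_power Ck_on_inverse Ck_on_V_time Ck_on_diff Ck_on_inner)
    (simp_all add: V_time_pos less_imp_neq[symmetric])

lemma Ck_on_hyperbolic_metric:
  "open U \<Longrightarrow> Ck_on k U (\<lambda>x::real^'n::finite. hyperbolic_metric x $ i $ j)"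
  unfolding hyperbolic_metric_component
  by (intro Ck_on_diff Ck_on_const Ck_on_divide Ck_on_mult Ck_on_component Ck_on_one_plus_inner_self one_plus_inner_pos)

definition pert_metric :: "real \<Rightarrow> real^'n::finite \<Rightarrow> 'n tensor2" where
  "pert_metric a c x = (1 + pert a c x) *\<^sub>R hyperbolic_metric x"

lemma hyperbolic_metric_mult_vec:
  "hyperbolic_metric x *v v = v - ((x \<bullet> v) / (1 + x \<bullet> x)) *\<^sub>R x"
  by (simp add: vec_eq_iff matrix_vector_mult_def sum_hyperbolic_metric)

lemma hyperbolic_metric_pos:
  assumes "v \<noteq> 0"
  shows "v \<bullet> (hyperbolic_metric x *v v) > 0"
proof -
  have v: "v \<bullet> v > 0" using assms by simp
  have "(x \<bullet> v)\<^sup>2 \<le> (x \<bullet> x) * (v \<bullet> v)" by (rule Cauchy_Schwarz_ineq)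
  also have "\<dots> < (1 + x \<bullet> x) * (v \<bullet> v)" using v by (simp add: distrib_right)
  finally have "(x \<bullet> v)\<^sup>2 / (1 + x \<bullet> x) < v \<bullet> v"
    by (simp add: pos_divide_less_eq one_plus_inner_pos mult.commute)
  then show ?thesis
    by (simp add: hyperbolic_metric_mult_vec inner_diff_right inner_commute[of v x] power2_eq_square)
qed

lemma riemannian_pert_metric:
  fixes c :: "real^'n::finite"
  assumes "\<And>x. x \<in> S \<Longrightarrow> 1 + pert a c x > 0"
  shows "riemannian_metric_on S (pert_metric a c)"
  unfolding riemannian_metric_on_def
proof (intro conjI ballI allI impI)
  show "smooth_on S (pert_metric a c)"
    by (intro smooth_onI Ck_on_vec open_UNIV)
       (simp add: pert_metric_def Ck_on_mult Ck_on_add Ck_on_const Ck_on_pert Ck_on_hyperbolic_metric)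
  fix x v :: "real^'n" assume x: "x \<in> S"
  show "transpose (pert_metric a c x) = pert_metric a c x"
    by (simp add: vec_eq_iff transpose_def pert_metric_def hyperbolic_symmetric(1)[of x])
  assume "v \<noteq> 0"
  then show "v \<bullet> (pert_metric a c x *v v) > 0"
    using hyperbolic_metric_pos[of v x] assms[OF x]
    by (simp add: pert_metric_def scaleR_matrix_vector_assoc[symmetric])
qed

text \<open>The map from the Poincare ball to the hyperboloid inverse to stereographic projection,
  read in the space components. \<open>to_ball\<close> is the projection, and the unit sphere stands
  for infinity.\<close>

definition from_ball :: "real^'n::finite \<Rightarrow> real^'n" where
  "from_ball y = (2 / (1 - y \<bullet> y)) *\<^sub>R y"

definition to_ball :: "real^'n::finite \<Rightarrow> real^'n" where
  "to_ball x = inverse (1 + V_time x) *\<^sub>R x"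

lemma inner_less_1_iff: "y \<bullet> y < 1 \<longleftrightarrow> norm y < 1" for y :: "'a::real_inner"
  by (simp add: norm_eq_sqrt_inner)

text \<open>The reciprocal is a rational function of y without singularity on the unit sphere; hence
  powers of \<open>inv_V\<close> extend smoothly to the boundary.\<close>

lemma V_time_from_ball:
  assumes "norm y < 1"
  shows "V_time (from_ball y) = (1 + y \<bullet> y) / (1 - y \<bullet> y)"
proof -
  define s where "s = y \<bullet> y"
  have s: "s < 1" "s \<ge> 0" using assms by (simp_all add: s_def inner_less_1_iff)
  have "1 + from_ball y \<bullet> from_ball y = 1 + (2 / (1 - s)) * ((2 / (1 - s)) * s)"
    by (simp add: from_ball_def s_def)
  also have "\<dots> = ((1 + s) / (1 - s))\<^sup>2"
    using s by (simp add: divide_simps) (simp add: algebra_simps power2_eq_square)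
  finally show ?thesis
    using s unfolding V_time_eq s_def[symmetric] by (simp add: real_sqrt_abs)
qed

lemma inv_V_from_ball: "norm y < 1 \<Longrightarrow> inv_V (from_ball y) = (1 - y \<bullet> y) / (1 + y \<bullet> y)"
  by (simp add: inv_V_def V_time_from_ball)

lemma to_ball_from_ball: "norm y < 1 \<Longrightarrow> to_ball (from_ball y) = y"
proof -
  assume y: "norm y < 1"
  define s where "s = y \<bullet> y"
  have s: "s < 1" using y by (simp add: s_def inner_less_1_iff)
  have e: "1 + (1 + s) / (1 - s) = 2 / (1 - s)" using s by (simp add: field_simps)
  have l: "inverse (2 / (1 - s)) * (2 / (1 - s)) = 1" using s by (intro left_inverse) simp
  show ?thesis
    unfolding to_ball_def V_time_from_ball[OF y] s_def[symmetric] e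
    unfolding from_ball_def scaleR_scaleR s_def[symmetric] l by (rule scaleR_one)
qed

lemma inner_to_ball: "to_ball x \<bullet> to_ball x = (V_time x - 1) / (V_time x + 1)"
proof -
  have X: "x \<bullet> x = (V_time x - 1) * (V_time x + 1)"
    using one_plus_inner_pos(1)[of x] by (simp add: V_time_eq algebra_simps)
  have "1 + V_time x \<noteq> 0" using V_time_pos[of x] by simp
  then have "inverse (1 + V_time x) * (V_time x + 1) = 1" by (simp add: add.commute)
  then have "inverse (1 + V_time x) * (inverse (1 + V_time x) * ((V_time x - 1) * (V_time x + 1)))
      = inverse (1 + V_time x) * (V_time x - 1)" by (simp add: mult_ac)
  then show ?thesis
    by (simp add: to_ball_def X divide_inverse add.commute mult.commute)
qed

lemma from_ball_to_ball: "from_ball (to_ball x) = x"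
proof -
  have W: "V_time x + 1 \<noteq> 0" using V_time_pos[of x] by simp
  have "1 - to_ball x \<bullet> to_ball x = 2 / (V_time x + 1)"
    using W by (simp add: inner_to_ball field_simps)
  then have "from_ball (to_ball x) = (V_time x + 1) *\<^sub>R to_ball x"
    by (simp add: from_ball_def)
  then show ?thesis using W by (simp add: to_ball_def add.commute)
qed

text \<open>The radius in the ball that corresponds to r = t, that is tanh(arsinh(t)/2).\<close>

definition ball_radius :: "real \<Rightarrow> real" where
  "ball_radius t = t / (1 + sqrt (1 + t\<^sup>2))"

lemma norm_to_ball: "norm (to_ball x) = ball_radius (norm x)"
  using V_time_pos[of x]
  by (simp add: to_ball_def ball_radius_def V_time_def field_simps abs_of_pos)

lemma norm_to_ball_less_1: "norm (to_ball x) < 1"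
proof -
  have "V_time x + 1 > 0" using V_time_pos[of x] by simp
  then have "to_ball x \<bullet> to_ball x < 1" by (simp add: inner_to_ball)
  then show ?thesis by (simp add: inner_less_1_iff)
qed

lemma ball_radius_mono:
  assumes "0 \<le> r" "r < t"
  shows "ball_radius r < ball_radius t"
proof -
  have "(r * sqrt (1 + t\<^sup>2))\<^sup>2 \<le> (t * sqrt (1 + r\<^sup>2))\<^sup>2"
    using assms power_mono[of r t 2] by (simp add: power_mult_distrib algebra_simps)
  then have "r * sqrt (1 + t\<^sup>2) \<le> t * sqrt (1 + r\<^sup>2)"
    by (rule power2_le_imp_le) (use assms in simp)
  then have "r * (1 + sqrt (1 + t\<^sup>2)) < t * (1 + sqrt (1 + r\<^sup>2))"
    using assms by (simp add: distrib_left)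
  moreover have "1 + sqrt (1 + s\<^sup>2) > 0" for s by (simp add: add_pos_nonneg)
  ultimately show ?thesis
    unfolding ball_radius_def by (simp add: divide_less_eq less_divide_eq pos_divide_less_eq pos_less_divide_eq mult.commute)
qed

lemma less_norm_from_ball_iff:
  assumes "norm y < 1" "r \<ge> 0"
  shows "norm (from_ball y) > r \<longleftrightarrow> norm y > ball_radius r"
proof -
  have "norm y = ball_radius (norm (from_ball y))"
    using norm_to_ball[of "from_ball y"] to_ball_from_ball[OF assms(1)] by simp
  then show ?thesis
    using ball_radius_mono[of r "norm (from_ball y)"] ball_radius_mono[of "norm (from_ball y)" r] assms(2)
    by (cases "norm (from_ball y)" r rule: linorder_cases) auto
qed

lemma Ck_on_to_ball: "Ck_on k UNIV (to_ball :: real^'n::finite \<Rightarrow> real^'n)"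
proof -
  have "1 + V_time x \<noteq> 0" for x :: "real^'n" using V_time_pos[of x] by simp
  then show ?thesis
    unfolding to_ball_def
    by (intro Ck_on_scaleR Ck_on_inverse Ck_on_add Ck_on_const Ck_on_V_time open_UNIV Ck_on_linear bounded_linear_ident)
qed

lemma Ck_on_from_ball: "Ck_on k (ball 0 1) (from_ball :: real^'n::finite \<Rightarrow> real^'n)"
proof -
  have "1 - y \<bullet> y \<noteq> 0" if "y \<in> ball 0 1" for y :: "real^'n" using that inner_less_1_iff[of y] by simp
  then show ?thesis
    unfolding from_ball_def
    by (intro Ck_on_scaleR Ck_on_divide Ck_on_diff Ck_on_const Ck_on_inner_self open_ball Ck_on_linear bounded_linear_ident)
qed

lemma diffeo_from_ball:
  assumes "R > 0"
  shows "diffeo_onto (open_collar (1 - ball_radius R)) {x. norm x > R} (from_ball :: real^'n::finite \<Rightarrow> real^'n)"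
proof -
  let ?C = "open_collar (1 - ball_radius R) :: (real^'n) set"
  have C: "y \<in> ?C \<longleftrightarrow> norm y > ball_radius R \<and> norm y < 1" for y
    by (auto simp: open_collar_def)
  have "from_ball ` ?C = {x. norm x > R}"
  proof (intro set_eqI iffI)
    fix x :: "real^'n" assume "x \<in> from_ball ` ?C"
    then show "x \<in> {x. norm x > R}" using assms less_norm_from_ball_iff[of "_ :: real^'n" R] by (auto simp: C)
  next
    fix x :: "real^'n" assume x: "x \<in> {x. norm x > R}"
    have "to_ball x \<in> ?C"
      using x norm_to_ball_less_1[of x] assms ball_radius_mono[of R "norm x"] by (simp add: C norm_to_ball)
    then show "x \<in> from_ball ` ?C" by (metis from_ball_to_ball imageI)
  qed
  moreover have "smooth_on ?C (from_ball :: real^'n \<Rightarrow> real^'n)"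
    unfolding smooth_on_def
    by (rule exI[of _ "ball 0 1"], rule exI[of _ from_ball]) (auto simp: C Ck_on_from_ball)
  moreover have "smooth_on {x. norm x > R} (to_ball :: real^'n \<Rightarrow> real^'n)"
    by (intro smooth_onI Ck_on_to_ball)
  ultimately show ?thesis
    unfolding diffeo_onto_def by (auto simp: C to_ball_from_ball intro!: exI[of _ to_ball])
qed

lemma filterlim_from_ball:
  assumes "norm z = 1"
  shows "filterlim (from_ball :: real^'n::finite \<Rightarrow> real^'n) at_infinity (at z within ball 0 1)"
  unfolding filterlim_at_infinity[OF order_refl]
proof (intro allI impI)
  fix r :: real assume r: "r > 0"
  have "ball_radius r < 1"
    using add_pos_nonneg[of 1 "sqrt (1 + r\<^sup>2)"] real_less_rsqrt[of r "1 + r\<^sup>2"]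
    by (simp add: ball_radius_def)
  moreover have "((\<lambda>y. norm y) \<longlongrightarrow> 1) (at z within ball 0 1)"
    using tendsto_norm[OF tendsto_ident_at, of z "ball 0 1"] assms by simp
  ultimately have "eventually (\<lambda>y. ball_radius r < norm y) (at z within ball 0 1)"
    by (rule order_tendstoD(1)[rotated])
  moreover have "eventually (\<lambda>y. y \<in> ball 0 1) (at z within ball 0 1)"
    by (simp add: eventually_at_filter)
  ultimately show "eventually (\<lambda>y. r \<le> norm (from_ball y)) (at z within ball 0 1)"
  proof eventually_elim
    case (elim y)
    then show ?case using less_norm_from_ball_iff[of y r] r by simp
  qed
qed


section \<open>The metric in ball coordinates\<close>

lemma jacobian_from_ball:
  fixes y :: "real^'n::finite"
  assumes "norm y < 1"
  defines "\<alpha> \<equiv> 2 / (1 - y \<bullet> y)"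
  shows "jacobian from_ball (at y) $ i $ j = \<alpha> * kd i j + \<alpha>\<^sup>2 * y $ i * y $ j"
proof -
  have s: "1 - y \<bullet> y \<noteq> 0" using assms inner_less_1_iff[of y] by simp
  have "((\<lambda>y. 1 - y \<bullet> y) has_derivative (\<lambda>v. - (2 * (y \<bullet> v)))) (at y)"
    by (auto intro!: derivative_eq_intros simp: inner_commute)
  \<comment> \<open>The scalar factor 2/(1 - |y|^2) has the derivative \<alpha>^2 (y . v), which
    gives the term of rank one.\<close>
  from has_derivative_scaleR[OF has_derivative_mult_right[OF Deriv.has_derivative_inverse[OF s this], of 2] has_derivative_ident]
  have "(from_ball has_derivative (\<lambda>v. \<alpha> *\<^sub>R v + (\<alpha>\<^sup>2 * (y \<bullet> v)) *\<^sub>R y)) (at y)"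
    unfolding from_ball_def
    by (rule has_derivative_eq_rhs[OF has_derivative_transform_within_open[of _ _ _ _ UNIV]])
       (auto simp: \<alpha>_def field_simps power2_eq_square fun_eq_iff)
  then have "frechet_derivative from_ball (at y) = (\<lambda>v. \<alpha> *\<^sub>R v + (\<alpha>\<^sup>2 * (y \<bullet> v)) *\<^sub>R y)"
    by (rule frechet_derivative_at[symmetric])
  then show ?thesis
    by (simp add: jacobian_def matrix_def axis_kd inner_axis)
qed

text \<open>The Poincare ball is conformally flat: the terms of rank one, from the Jacobian and from
  the metric, cancel each other.\<close>

lemma pullback_pert_metric:
  fixes y :: "real^'n::finite"
  assumes "norm y < 1"
  shows "pullback from_ball (pert_metric a c) y
    = ((1 + pert a c (from_ball y)) * (2 / (1 - y \<bullet> y))\<^sup>2) *\<^sub>R mat 1"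
proof -
  define \<alpha> where "\<alpha> = 2 / (1 - y \<bullet> y)"
  \<comment> \<open>The value of \<open>V_time\<close> at the image point. Its second form, W = 1 +
    \<alpha> s, is what cancels the terms of rank one.\<close>
  define W where "W = \<alpha> - 1"
  define s where "s = y \<bullet> y"
  define J where "J = jacobian from_ball (at y)"
  define x where "x = from_ball y"
  define u where "u = 1 + pert a c x"
  have s: "s < 1" "s \<ge> 0" using assms by (simp_all add: s_def inner_less_1_iff)
  have W: "W = (1 + s) / (1 - s)" "W = 1 + \<alpha> * s" "W \<noteq> 0"
    using s by (simp_all add: W_def \<alpha>_def s_def[symmetric] field_simps)
  have V: "V_time x = W" unfolding x_def V_time_from_ball[OF assms] W(1) s_def ..
  have q: "1 + x \<bullet> x = W\<^sup>2"
    unfolding V[symmetric] V_time_eq using one_plus_inner_pos(1)[of x] by simp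
  have J: "J $ i $ j = \<alpha> * kd i j + \<alpha>\<^sup>2 * y $ i * y $ j" for i j
    unfolding J_def \<alpha>_def by (rule jacobian_from_ball[OF assms])
  have x: "x = \<alpha> *\<^sub>R y" by (simp add: x_def from_ball_def \<alpha>_def)
  have gJ: "(pert_metric a c x ** J) $ l $ j = u * (\<alpha> * kd l j - \<alpha>\<^sup>2 / W * y $ l * y $ j)" for l j
  proof -
    define w where "w = (\<chi> m. J $ m $ j)"
    have "w = \<alpha> *\<^sub>R axis j 1 + (\<alpha>\<^sup>2 * y $ j) *\<^sub>R y"
      by (simp add: w_def vec_eq_iff J axis_kd)
    then have "x \<bullet> w = \<alpha>\<^sup>2 * y $ j * (1 + \<alpha> * s)"
      by (simp add: x inner_add_right inner_axis s_def algebra_simps power2_eq_square)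
    then have xw: "x \<bullet> w = \<alpha>\<^sup>2 * y $ j * W" by (simp add: W(2))
    have "(pert_metric a c x ** J) $ l $ j = u * (\<Sum>m\<in>UNIV. hyperbolic_metric x $ l $ m * w $ m)"
      by (simp add: matrix_matrix_mult_def pert_metric_def u_def w_def sum_distrib_left mult.assoc)
    also have "\<dots> = u * (J $ l $ j - \<alpha> * y $ l * (\<alpha>\<^sup>2 * y $ j * W) / W\<^sup>2)"
      unfolding sum_hyperbolic_metric xw q by (simp add: w_def x)
    also have "\<alpha> * y $ l * (\<alpha>\<^sup>2 * y $ j * W) / W\<^sup>2 = \<alpha>\<^sup>2 * (\<alpha> / W) * y $ l * y $ j"
      using W(3) by (simp add: field_simps power2_eq_square)
    also have "\<alpha> / W = 1 + 1 / W" using W(3) by (simp add: W_def field_simps)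
    finally show ?thesis by (simp add: J algebra_simps)
  qed
  have "(pullback from_ball (pert_metric a c) y) $ i $ j = (u * \<alpha>\<^sup>2) * kd i j" for i j
  proof -
    have "(pullback from_ball (pert_metric a c) y) $ i $ j = (\<Sum>l\<in>UNIV. J $ l $ i * (pert_metric a c x ** J) $ l $ j)"
    proof -
      have "(transpose J ** N) $ i $ j = (\<Sum>l\<in>UNIV. J $ l $ i * N $ l $ j)" for N :: "real^'n^'n"
        by (simp add: matrix_matrix_mult_def transpose_def)
      then show ?thesis
        unfolding pullback_def J_def[symmetric] x_def[symmetric] matrix_mul_assoc[symmetric] .
    qed
    also have "\<dots> = (\<Sum>l\<in>UNIV. \<alpha> * (kd l i * (u * (\<alpha> * kd l j - \<alpha>\<^sup>2 / W * y $ l * y $ j)))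
        + (\<alpha>\<^sup>2 * y $ i * u * \<alpha>) * (y $ l * kd l j) - (\<alpha>\<^sup>2 * y $ i * u * (\<alpha>\<^sup>2 / W) * y $ j) * (y $ l * y $ l))"
      unfolding gJ J by (intro sum.cong refl) (simp add: algebra_simps)
    also have "\<dots> = \<alpha> * (u * (\<alpha> * kd i j - \<alpha>\<^sup>2 / W * y $ i * y $ j))
        + (\<alpha>\<^sup>2 * y $ i * u * \<alpha>) * y $ j - (\<alpha>\<^sup>2 * y $ i * u * (\<alpha>\<^sup>2 / W) * y $ j) * s"
      by (simp only: sum.distrib sum_subtractf sum_distrib_left[symmetric] sum_kd s_def inner_vec_eq)
    also have "\<dots> = u * \<alpha>\<^sup>2 * kd i j + u * \<alpha> ^ 3 * y $ i * y $ j * (1 - (1 + \<alpha> * s) / W)"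
      by (simp add: field_simps power2_eq_square power3_eq_cube W(3))
    finally show ?thesis using W by simp
  qed
  then show ?thesis
    by (simp add: vec_eq_iff mat_def kd_def u_def x_def \<alpha>_def)
qed

text \<open>The conformal factor 1 + \<open>pert\<close> read in the ball with its singularity
  removed: c . x blows up at the unit sphere, but c . x times \<open>inv_V\<close> is 2 (c . y)/(1 +
  |y|^2).\<close>

definition compact_factor :: "real \<Rightarrow> real^'n::finite \<Rightarrow> real^'n \<Rightarrow> real" where
  "compact_factor a c y = 1 + a * ((1 - y \<bullet> y) / (1 + y \<bullet> y)) ^ CARD('n)
     + 2 * (c \<bullet> y) / (1 + y \<bullet> y) * ((1 - y \<bullet> y) / (1 + y \<bullet> y)) ^ CARD('n)
     - ((1 - y \<bullet> y) / (1 + y \<bullet> y)) ^ (CARD('n) + 1)"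

lemma compact_factor_eq:
  fixes c y :: "real^'n::finite"
  assumes "norm y < 1"
  shows "compact_factor a c y = 1 + pert a c (from_ball y)"
proof -
  define s where "s = y \<bullet> y"
  define z where "z = (1 - s) / (1 + s)"
  define \<beta> where "\<beta> = c \<bullet> y"
  have s: "s < 1" "s \<ge> 0" using assms by (simp_all add: s_def inner_less_1_iff)
  have "2 / d * (d / e) = 2 / e" if "d \<noteq> 0" for d e :: real using that by simp
  from this[of "1 - s" "1 + s"] s have "2 / (1 - s) * z = 2 / (1 + s)" by (simp add: z_def del: times_divide_times_eq)
  then have "2 / (1 - s) * \<beta> * z = 2 * \<beta> / (1 + s)" by (simp add: mult_ac) (metis mult.commute times_divide_eq_left)
  then have "(2 / (1 - s) * \<beta> - 1) * z ^ (CARD('n) + 1) = 2 * \<beta> / (1 + s) * z ^ CARD('n) - z ^ (CARD('n) + 1)"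
    by (simp add: left_diff_distrib mult.assoc[symmetric])
  then show ?thesis
    unfolding compact_factor_def pert_def inv_V_from_ball[OF assms] s_def[symmetric] z_def[symmetric]
    by (simp add: from_ball_def s_def[symmetric] \<beta>_def)
qed

lemma compact_factor_sphere: "norm y = 1 \<Longrightarrow> compact_factor a c y = 1"
  by (simp add: compact_factor_def dot_square_norm power_0_left)

lemma Ck_on_compact_factor: "Ck_on k UNIV (compact_factor a c)"
  unfolding compact_factor_def
  by (intro Ck_on_add Ck_on_mult Ck_on_const Ck_on_power Ck_on_divide Ck_on_diff Ck_on_inner
    Ck_on_inner_self open_UNIV one_plus_inner_pos)

text \<open>The defining function (1 - |y|^2)/2 is the reciprocal of the length factor of the ball,
  so its square times the metric is \<open>compact_factor\<close> times the Euclidean metric. On the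
  unit sphere this is the Euclidean metric itself, and the gradient -y of the defining function has
  length 1.\<close>

theorem asymptotically_hyperbolic_pert_metric:
  fixes c :: "real^'n::finite"
  assumes R: "R > 0" and pos: "\<And>x. norm x > R \<Longrightarrow> 1 + pert a c x > 0"
  shows "asymptotically_hyperbolic (cball 0 R) (pert_metric a c)"
proof -
  \<comment> \<open>Makes the open collar correspond exactly to the points with norm greater than
    \<open>R\<close>.\<close>
  define \<delta> where "\<delta> = 1 - ball_radius R"
  define \<rho> where "\<rho> = (\<lambda>y::real^'n. (1 - y \<bullet> y) / 2)"
  define gb where "gb = (\<lambda>y::real^'n. compact_factor a c y *\<^sub>R (mat 1 :: real^'n^'n))"
  have br: "0 < ball_radius R" "ball_radius R < 1"
    using R add_pos_nonneg[of 1 "sqrt (1 + R\<^sup>2)"] real_less_rsqrt[of R "1 + R\<^sup>2"]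
    by (simp_all add: ball_radius_def)
  have \<rho>: "GDERIV \<rho> y :> - y" for y
  proof -
    have "GDERIV (\<lambda>y. 1 / 2 * (1 - y \<bullet> y)) y :> (1 / 2) *\<^sub>R (0 - 2 *\<^sub>R y)"
      by (intro GDERIV_cmult GDERIV_diff GDERIV_const GDERIV_inner_self)
    then show ?thesis by (simp add: \<rho>_def)
  qed
  note d\<rho> = partial_eq_gradient[OF \<rho>]
  have sphere: "gb y = mat 1" if "norm y = 1" for y
    using that by (simp add: gb_def compact_factor_sphere)
  have "conformal_compactification (cball 0 R) (pert_metric a c) \<delta> from_ball \<rho> gb"
    unfolding conformal_compactification_def
  proof (intro conjI ballI)
    show "0 < \<delta>" "\<delta> < 1" using br by (simp_all add: \<delta>_def)
    show "\<exists>E\<subseteq>- cball 0 R. compact (- E) \<and> diffeo_onto (open_collar \<delta>) E (from_ball :: real^'n \<Rightarrow> real^'n)"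
    proof (intro exI[of _ "{x. norm x > R}"] conjI)
      have "- {x::real^'n. norm x > R} = cball 0 R" by auto
      then show "compact (- {x::real^'n. norm x > R})" by simp
      show "diffeo_onto (open_collar \<delta>) {x. norm x > R} (from_ball :: real^'n \<Rightarrow> real^'n)"
        unfolding \<delta>_def by (rule diffeo_from_ball[OF R])
    qed auto
    show "filterlim from_ball at_infinity (at z within ball 0 1)" if "z \<in> sphere 0 1" for z :: "real^'n"
      using that by (intro filterlim_from_ball) simp
    show "\<exists>W. open W \<and> collar \<delta> \<subseteq> W \<and> smooth_on W \<rho>"
      unfolding \<rho>_def
      by (intro exI[of _ UNIV] conjI open_UNIV subset_UNIV smooth_onI Ck_on_divide Ck_on_diff Ck_on_const
         Ck_on_inner_self) simp
    fix y :: "real^'n" assume "y \<in> collar \<delta>"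
    then have "norm y \<le> 1" by (simp add: collar_def)
    then have "(norm y)\<^sup>2 \<le> 1" by (simp add: power_le_one)
    then show "0 \<le> \<rho> y" "(\<rho> y = 0) = (norm y = 1)"
      using norm_ge_zero[of y] by (auto simp: \<rho>_def dot_square_norm power2_eq_1_iff simp del: norm_ge_zero)
  next
    fix y :: "real^'n" assume "y \<in> sphere 0 1"
    then have "y \<noteq> 0" by auto
    then obtain i where "y $ i \<noteq> 0" by (auto simp: vec_eq_iff)
    then show "\<exists>i. partial i \<rho> y \<noteq> 0" by (auto simp: d\<rho>)
  next
    show "riemannian_metric_on (collar \<delta>) gb"
      unfolding riemannian_metric_on_def
    proof (intro conjI ballI allI impI)
      show "smooth_on (collar \<delta>) gb"
        unfolding gb_def
        by (intro smooth_onI Ck_on_scaleR Ck_on_compact_factor Ck_on_const open_UNIV)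
      fix y v :: "real^'n" assume y: "y \<in> collar \<delta>"
      show "transpose (gb y) = gb y"
        by (simp add: gb_def vec_eq_iff transpose_def mat_def)
      assume v: "v \<noteq> 0"
      have "compact_factor a c y > 0"
      proof (cases "norm y = 1")
        case False
        then have "norm y < 1" "norm y > ball_radius R" using y by (auto simp: collar_def \<delta>_def)
        then show ?thesis
          using pos[of "from_ball y"] less_norm_from_ball_iff[of y R] R by (simp add: compact_factor_eq)
      qed (simp add: compact_factor_sphere)
      then show "0 < v \<bullet> (gb y *v v)"
        using v by (simp add: gb_def scaleR_matrix_vector_assoc[symmetric])
    qed
  next
    fix y :: "real^'n" assume "y \<in> open_collar \<delta>"
    then have y: "norm y < 1" by (simp add: open_collar_def)
    then have "1 - y \<bullet> y \<noteq> 0" using inner_less_1_iff[of y] by simp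
    then have "(\<rho> y)\<^sup>2 * (2 / (1 - y \<bullet> y))\<^sup>2 = 1"
    proof -
      have "d / 2 * (2 / d) = 1" if "d \<noteq> 0" for d :: real using that by simp
      from this[OF \<open>1 - y \<bullet> y \<noteq> 0\<close>] show ?thesis
        unfolding power_mult_distrib[symmetric] \<rho>_def by (simp only: power_one)
    qed
    then have "(\<rho> y)\<^sup>2 * ((1 + pert a c (from_ball y)) * (2 / (1 - y \<bullet> y))\<^sup>2) = compact_factor a c y"
      by (simp add: compact_factor_eq[OF y] mult.left_commute)
    then show "gb y = (\<rho> y)\<^sup>2 *\<^sub>R pullback from_ball (pert_metric a c) y"
      unfolding pullback_pert_metric[OF y] gb_def by simp
  qed
  moreover have "differential_norm gb \<rho> y = 1" if "y \<in> sphere 0 1" for y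
  proof -
    have y: "norm y = 1" using that by simp
    have "inv_metric gb y = mat 1"
      unfolding inv_metric_def sphere[OF y] by (rule matrix_inv_eqI) simp_all
    then have "gradient gb \<rho> i y = - (y $ i)" for i
      by (simp add: gradient_def d\<rho> mat_def sum_negf if_distrib[of "\<lambda>t. t * _"] cong: if_cong)
    then have "differential_norm gb \<rho> y = sqrt (y \<bullet> y)"
      by (simp add: differential_norm_def d\<rho> inner_vec_eq)
    then show ?thesis using y by (simp add: norm_eq_sqrt_inner)
  qed
  moreover have "conformal_to_round gb"
    unfolding conformal_to_round_def
    by (rule exI[of _ "\<lambda>_. 1"]) (auto intro!: smooth_onI Ck_on_const simp: sphere)
  ultimately show ?thesis
    unfolding asymptotically_hyperbolic_def by blast
qed

section \<open>Decay and charge densities\<close>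

lemma inv_metric_hyperbolic: "inv_metric hyperbolic_metric x = hyperbolic_inverse x"
  using inv_metric_conformal[of 1 x] by (simp add: inv_metric_def)

lemma christoffel_hyperbolic:
  "christoffel hyperbolic_metric k i j x = - (hyperbolic_metric x $ i $ j * x $ k)"
  using christoffel_conformal[of "\<lambda>_. 1" x 0 k i j] GDERIV_const[of 1 x]
  by (simp add: conf_Gamma_def conf_Y_def)

lemma sum_hyperbolic_metric_self:
  "(\<Sum>l\<in>UNIV. hyperbolic_metric x $ k $ l * x $ l) = x $ k / (1 + x \<bullet> x)"
  unfolding sum_hyperbolic_metric using one_plus_inner_pos[of x] by (simp add: field_simps)

text \<open>The hyperbolic metric is parallel, so only the derivative of the factor survives.\<close>

lemma cov_deriv_factor:
  assumes "GDERIV f x :> df"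
  shows "cov_deriv hyperbolic_metric (\<lambda>y. f y *\<^sub>R hyperbolic_metric y) k i j x
    = df $ k * hyperbolic_metric x $ i $ j"
proof -
  let ?b = "hyperbolic_metric x" and ?q = "1 + x \<bullet> x"
  have "(\<Sum>l\<in>UNIV. christoffel hyperbolic_metric l k i x * (f x *\<^sub>R ?b) $ l $ j
       + christoffel hyperbolic_metric l k j x * (f x *\<^sub>R ?b) $ i $ l) =
    (\<Sum>l\<in>UNIV. - (f x * ?b $ k $ i) * (?b $ j $ l * x $ l) - (f x * ?b $ k $ j) * (?b $ i $ l * x $ l))"
    by (intro sum.cong refl)
      (simp add: christoffel_hyperbolic hyperbolic_symmetric(1)[of x _ j] algebra_simps)
  also have "\<dots> = - (f x * ?b $ k $ i) * (x $ j / ?q) - (f x * ?b $ k $ j) * (x $ i / ?q)"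
    by (simp only: sum_subtractf sum_distrib_left[symmetric] sum_hyperbolic_metric_self)
  also have "\<dots> = f x * d_hyp x k i j"
    by (simp add: d_hyp_def hyperbolic_metric_component algebra_simps add_divide_distrib diff_divide_distrib power2_eq_square)
  finally show ?thesis
    unfolding cov_deriv_def partial_eq_gradient[OF GDERIV_conformal[OF assms]] by simp
qed

lemma tensor_trace_factor:
  "tensor_trace hyperbolic_metric (\<lambda>y. f y *\<^sub>R hyperbolic_metric y) x = real CARD('n) * f x"
  for x :: "real^'n::finite"
proof -
  have "tensor_trace hyperbolic_metric (\<lambda>y. f y *\<^sub>R hyperbolic_metric y) x =
      hyp_trace x (\<lambda>i j. f x * hyperbolic_metric x $ i $ j)"
    by (simp add: tensor_trace_def hyp_trace_def inv_metric_hyperbolic)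
  then show ?thesis by (simp only: hyp_trace_linear hyp_trace_metric mult.commute)
qed

text \<open>The sum is the squared length of the metric measured by itself; contracting one pair of
  indices reduces it to a trace.\<close>

lemma hyperbolic_contraction:
  "(\<Sum>i\<in>UNIV. \<Sum>j\<in>UNIV. \<Sum>p\<in>UNIV. \<Sum>q\<in>UNIV. hyperbolic_inverse x $ i $ p * hyperbolic_inverse x $ j $ q
     * hyperbolic_metric x $ i $ j * hyperbolic_metric x $ p $ q) = real CARD('n)"
  for x :: "real^'n::finite"
proof -
  let ?b = "hyperbolic_metric x" and ?Q = "hyperbolic_inverse x"
  have "(\<Sum>p\<in>UNIV. \<Sum>q\<in>UNIV. ?Q $ i $ p * ?Q $ j $ q * ?b $ i $ j * ?b $ p $ q) = ?Q $ i $ j * ?b $ i $ j" for i j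
  proof -
    have "(\<Sum>p\<in>UNIV. \<Sum>q\<in>UNIV. ?Q $ i $ p * ?Q $ j $ q * ?b $ i $ j * ?b $ p $ q) =
        (\<Sum>p\<in>UNIV. ?Q $ i $ p * ?b $ i $ j * (\<Sum>q\<in>UNIV. ?Q $ j $ q * ?b $ p $ q))"
      by (simp add: sum_distrib_left mult_ac)
    then show ?thesis by (simp add: hyperbolic_inverse_mult)
  qed
  then show ?thesis using hyp_trace_metric[of x] by (simp add: hyp_trace_def)
qed

lemma tensor_norm_factor:
  "tensor_norm hyperbolic_metric (\<lambda>y. f y *\<^sub>R hyperbolic_metric y) x = sqrt (real CARD('n)) * \<bar>f x\<bar>"
  for x :: "real^'n::finite"
proof -
  let ?b = "hyperbolic_metric x" and ?Q = "hyperbolic_inverse x"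
  have "(\<Sum>i\<in>UNIV. \<Sum>j\<in>UNIV. \<Sum>p\<in>UNIV. \<Sum>q\<in>UNIV. ?Q $ i $ p * ?Q $ j $ q * (f x *\<^sub>R ?b) $ i $ j * (f x *\<^sub>R ?b) $ p $ q)
      = (f x)\<^sup>2 * (\<Sum>i\<in>UNIV. \<Sum>j\<in>UNIV. \<Sum>p\<in>UNIV. \<Sum>q\<in>UNIV. ?Q $ i $ p * ?Q $ j $ q * ?b $ i $ j * ?b $ p $ q)"
    by (simp add: sum_distrib_left power2_eq_square mult_ac)
  then show ?thesis
    unfolding tensor_norm_def inv_metric_hyperbolic hyperbolic_contraction
    by (simp add: real_sqrt_mult mult.commute)
qed

text \<open>By \<open>cov_deriv_factor\<close> the derivative is the tensor product of df and b, so
  its length is the product of theirs; the sums are reordered to separate the two.\<close>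

lemma cov_deriv_norm_factor:
  fixes x :: "real^'n::finite"
  assumes "GDERIV f x :> df"
  shows "cov_deriv_norm hyperbolic_metric (\<lambda>y. f y *\<^sub>R hyperbolic_metric y) x
     = sqrt (real CARD('n) * (df \<bullet> df + (x \<bullet> df)\<^sup>2))"
proof -
  let ?b = "hyperbolic_metric x" and ?Q = "hyperbolic_inverse x"
  have "(\<Sum>k\<in>UNIV. \<Sum>i\<in>UNIV. \<Sum>j\<in>UNIV. \<Sum>m\<in>UNIV. \<Sum>p\<in>UNIV. \<Sum>q\<in>UNIV.
      ?Q $ k $ m * ?Q $ i $ p * ?Q $ j $ q * (df $ k * ?b $ i $ j) * (df $ m * ?b $ p $ q))
     = (\<Sum>k\<in>UNIV. \<Sum>m\<in>UNIV. \<Sum>i\<in>UNIV. \<Sum>j\<in>UNIV. \<Sum>p\<in>UNIV. \<Sum>q\<in>UNIV.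
      ?Q $ k $ m * ?Q $ i $ p * ?Q $ j $ q * (df $ k * ?b $ i $ j) * (df $ m * ?b $ p $ q))"
    by (subst (2) sum.swap, subst (3) sum.swap) (rule refl)
  also have "\<dots> = (\<Sum>k\<in>UNIV. \<Sum>m\<in>UNIV. ?Q $ k $ m * (df $ k * df $ m) *
     (\<Sum>i\<in>UNIV. \<Sum>j\<in>UNIV. \<Sum>p\<in>UNIV. \<Sum>q\<in>UNIV. ?Q $ i $ p * ?Q $ j $ q * ?b $ i $ j * ?b $ p $ q))"
    by (simp add: sum_distrib_left mult_ac)
  also have "\<dots> = real CARD('n) * hyp_trace x (\<lambda>k m. df $ k * df $ m)"
    unfolding hyperbolic_contraction hyp_trace_def by (simp add: sum_distrib_left mult_ac)
  also have "\<dots> = real CARD('n) * (df \<bullet> df + (x \<bullet> df)\<^sup>2)"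
    unfolding hyp_trace_prod by (simp add: power2_eq_square)
  finally show ?thesis
    unfolding cov_deriv_norm_def inv_metric_hyperbolic cov_deriv_factor[OF assms] by simp
qed

lemma tensor_div_factor:
  assumes "GDERIV f x :> df"
  shows "tensor_div hyperbolic_metric (\<lambda>y. f y *\<^sub>R hyperbolic_metric y) j x = df $ j"
proof -
  have "tensor_div hyperbolic_metric (\<lambda>y. f y *\<^sub>R hyperbolic_metric y) j x =
     (\<Sum>i\<in>UNIV. df $ i * (\<Sum>k\<in>UNIV. hyperbolic_inverse x $ i $ k * hyperbolic_metric x $ j $ k))"
    unfolding tensor_div_def inv_metric_hyperbolic cov_deriv_factor[OF assms]
    by (simp add: sum_distrib_left hyperbolic_symmetric(1)[of x _ j] mult_ac)
  then show ?thesis by (simp add: hyperbolic_inverse_mult)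
qed

text \<open>Here div e = df and tr e = n f, so the first term is -(n-1) V df and the other two add
  up to (n-1) f dV: a Wronskian of f and V.\<close>

lemma charge_form_factor:
  fixes x :: "real^'n::finite"
  assumes f: "GDERIV f x :> df" and V: "GDERIV V x :> dV"
  shows "charge_form V (\<lambda>y. f y *\<^sub>R hyperbolic_metric y) j x
     = (real CARD('n) - 1) * (f x * dV $ j - V x * df $ j)"
proof -
  let ?b = "hyperbolic_metric x" and ?Q = "hyperbolic_inverse x"
  have "partial j (tensor_trace hyperbolic_metric (\<lambda>y. f y *\<^sub>R hyperbolic_metric y)) x = real CARD('n) * df $ j"
    using partial_eq_gradient[OF GDERIV_cmult[OF f, of "real CARD('n)"], of j]
    by (simp add: tensor_trace_factor[abs_def])
  moreover have "(\<Sum>i\<in>UNIV. gradient hyperbolic_metric V i x * (f x *\<^sub>R ?b) $ i $ j) = f x * dV $ j"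
  proof -
    have "(\<Sum>i\<in>UNIV. gradient hyperbolic_metric V i x * (f x *\<^sub>R ?b) $ i $ j) =
       (\<Sum>i\<in>UNIV. \<Sum>k\<in>UNIV. f x * dV $ k * (?Q $ k $ i * ?b $ j $ i))"
      by (simp add: gradient_def inv_metric_hyperbolic partial_eq_gradient[OF V] sum_distrib_right sum_distrib_left
        hyperbolic_symmetric[of x _ j] hyperbolic_symmetric(2)[of x] mult_ac)
    also have "\<dots> = (\<Sum>k\<in>UNIV. f x * dV $ k * (\<Sum>i\<in>UNIV. ?Q $ k $ i * ?b $ j $ i))"
      by (subst sum.swap) (simp add: sum_distrib_left)
    finally show ?thesis by (simp add: hyperbolic_inverse_mult)
  qed
  ultimately show ?thesis
    unfolding charge_form_def Let_def tensor_div_factor[OF f] partial_eq_gradient[OF V]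
    by (simp add: tensor_trace_factor algebra_simps)
qed

section \<open>The identity as a chart at infinity\<close>

lemma pullback_ident: "pullback (\<lambda>x. x) g = g" for g :: "'n::finite tensor2"
proof
  fix x :: "real^'n::finite"
  have "jacobian (\<lambda>x. x) (at x) = (mat 1 :: real^'n^'n)"
    by (simp add: jacobian_def vec_eq_iff matrix_def mat_def axis_def)
  then show "pullback (\<lambda>x. x) g x = g x" by (simp add: pullback_def transpose_mat)
qed

lemma chart_error_pert_metric:
  "chart_error (pert_metric a c) (\<lambda>x. x) = (\<lambda>x. pert a c x *\<^sub>R hyperbolic_metric x)"
  by (simp add: fun_eq_iff chart_error_def pullback_ident pert_metric_def scaleR_left_distrib)

theorem chart_at_infinity_pert_metric:
  fixes c :: "real^'n::finite"
  assumes R: "R > 0"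
  shows "chart_at_infinity (cball 0 R) (pert_metric a c) (R + 1) (\<lambda>x. x)"
  unfolding chart_at_infinity_def
proof (intro conjI)
  show "R + 1 > 0" using R by simp
  have "bounded (- {x::real^'n. R + 1 \<le> norm x})"
    by (rule bounded_subset[OF bounded_ball[of 0 "R + 1"]]) auto
  then have "compact (closure (- {x::real^'n. R + 1 \<le> norm x}))" by (simp add: compact_closure)
  moreover have "smooth_on S (\<lambda>x::real^'n. x)" for S
    by (intro smooth_onI Ck_on_linear open_UNIV bounded_linear_ident)
  then have "diffeo_onto {x::real^'n. R + 1 \<le> norm x} {x. R + 1 \<le> norm x} (\<lambda>x. x)"
    unfolding diffeo_onto_def by auto
  ultimately show "\<exists>M_ext\<subseteq>- cball 0 R. compact (closure (- M_ext)) \<and>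
      diffeo_onto {x::real^'n. R + 1 \<le> norm x} M_ext (\<lambda>x. x)"
    \<comment> \<open>The radius R + 1 keeps the closed exterior region away from the closed ball of
      radius \<open>R\<close>.\<close>
    by (intro exI[of _ "{x. R + 1 \<le> norm x}"]) auto
  let ?n = "real CARD('n)" and ?K = "pert_bound a c"
  define C where "C = sqrt ?n * ?K + sqrt (?n * (2 * ?K\<^sup>2))"
  have K: "?K \<ge> 0" using pert_bound_ge_1[of a c] by simp
  have C: "C \<ge> 0" using K by (simp add: C_def)
  let ?E = "\<lambda>x. tensor_norm hyperbolic_metric (chart_error (pert_metric a c) (\<lambda>x. x)) x
      + cov_deriv_norm hyperbolic_metric (chart_error (pert_metric a c) (\<lambda>x. x)) x"
  have bound: "norm (?E x) \<le> C * norm (norm x powr (- ?n))" if "norm x \<ge> 1" for x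
  proof -
    have v: "inv_V x \<le> 1 / norm x"
      by (subst pos_le_divide_eq) (use norm_mult_inv_V[of x] that in \<open>auto simp: mult.commute\<close>)
    have "?E x = sqrt ?n * \<bar>pert a c x\<bar>
       + sqrt (?n * (grad_pert a c x \<bullet> grad_pert a c x + (x \<bullet> grad_pert a c x)\<^sup>2))"
      unfolding chart_error_pert_metric tensor_norm_factor cov_deriv_norm_factor[OF GDERIV_pert] ..
    also have "\<dots> \<le> sqrt ?n * (?K * inv_V x ^ CARD('n)) + sqrt (?n * (2 * (?K * inv_V x ^ CARD('n))\<^sup>2))"
      by (intro add_mono mult_left_mono abs_pert_le real_sqrt_le_mono grad_pert_sq_le) auto
    also have "sqrt (?n * (2 * (?K * inv_V x ^ CARD('n))\<^sup>2)) = sqrt (?n * (2 * ?K\<^sup>2)) * inv_V x ^ CARD('n)"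
      using inv_V_pos[of x] by (simp add: power_mult_distrib real_sqrt_mult mult_ac)
    also have "sqrt ?n * (?K * inv_V x ^ CARD('n)) + sqrt (?n * (2 * ?K\<^sup>2)) * inv_V x ^ CARD('n)
      = C * inv_V x ^ CARD('n)" by (simp add: C_def algebra_simps)
    also have "\<dots> \<le> C * (1 / norm x) ^ CARD('n)"
      using v inv_V_pos[of x] C by (intro mult_left_mono power_mono) auto
    also have "(1 / norm x) ^ CARD('n) = norm (norm x powr (- ?n))"
      using powr_realpow[OF less_le_trans[OF zero_less_one that], of "CARD('n)"]
      by (simp add: powr_minus power_one_over inverse_eq_divide)
    finally have "?E x \<le> C * norm (norm x powr (- ?n))" .
    moreover have "?E x \<ge> 0"
      unfolding chart_error_pert_metric tensor_norm_factor cov_deriv_norm_factor[OF GDERIV_pert] by simp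
    ultimately show ?thesis by simp
  qed
  show "\<exists>\<tau>>?n / 2. ?E \<in> O[at_infinity](\<lambda>x. norm x powr (- \<tau>))"
  \<comment> \<open>The perturbation decays like r^(-n), so \<tau> = n is admissible.\<close>
  proof (intro exI[of _ ?n] conjI)
    show "?E \<in> O[at_infinity](\<lambda>x. norm x powr (- ?n))"
      by (rule bigoI[of _ C]) (use bound in \<open>auto simp: eventually_at_infinity intro!: exI[of _ 1]\<close>)
  qed simp
qed

section \<open>Integration over the sphere\<close>

lemma measurable_direction [measurable]:
  "(\<lambda>y::real^'n::finite. y /\<^sub>R norm y) \<in> borel_measurable borel"
  by simp

lemma measurable_component [measurable]:
  "(\<lambda>y::real^'n::finite. y $ i) \<in> borel_measurable borel"
  by (intro borel_measurable_continuous_onI continuous_on_component continuous_on_id)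

lemma measurable_ball_weight [measurable]:
  "(\<lambda>y::real^'n::finite. k * indicator (ball 0 1) y :: real) \<in> borel_measurable borel"
  by (intro borel_measurable_times borel_measurable_const borel_measurable_indicator) simp

text \<open>Presents the measure as the image of a density on the whole space, a form in which
  integrals and almost everywhere statements pass directly to Lebesgue measure.\<close>

lemma sphere_measure_eq:
  "(sphere_measure :: (real^'n::finite) measure) =
     distr (density lborel (\<lambda>y. ennreal (real CARD('n) * indicator (ball 0 1) y))) borel (\<lambda>y. y /\<^sub>R norm y)"
    (is "_ = ?M")
proof (rule measure_eqI)
  show "sets sphere_measure = sets ?M" by (simp add: sphere_measure_def)
  fix A :: "(real^'n) set" assume "A \<in> sets sphere_measure"
  then have A [measurable]: "A \<in> sets borel" by (simp add: sphere_measure_def)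
  let ?N = "\<lambda>y::real^'n. y /\<^sub>R norm y"
  have m [measurable]: "?N -` A \<in> sets borel"
    using measurable_sets[OF measurable_direction A] by simp
  have "emeasure sphere_measure A = of_nat CARD('n) * emeasure lborel (?N -` A \<inter> ball 0 1)"
    unfolding sphere_measure_def
    by (simp add: emeasure_distr measurable_restrict_space1 space_restrict_space emeasure_restrict_space)
  also have "\<dots> = emeasure ?M A"
  proof -
    have "emeasure ?M A = (\<integral>\<^sup>+ y. ennreal (real CARD('n)) * indicator (?N -` A \<inter> ball 0 1) y \<partial>lborel)"
    proof -
      have "emeasure ?M A = emeasure (density lborel (\<lambda>y. ennreal (real CARD('n) * indicator (ball 0 1) y))) (?N -` A)"
        by (subst emeasure_distr) auto
      also have "\<dots> = (\<integral>\<^sup>+ y. ennreal (real CARD('n) * indicator (ball 0 1) y) * indicator (?N -` A) y \<partial>lborel)"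
        by (rule emeasure_density) auto
      finally show ?thesis by (auto simp: indicator_def intro!: nn_integral_cong)
    qed
    also have "\<dots> = ennreal (real CARD('n)) * emeasure lborel (?N -` A \<inter> ball 0 1)"
      by (intro nn_integral_cmult_indicator) simp
    finally show ?thesis by (simp add: ennreal_of_nat_eq_real_of_nat)
  qed
  finally show "emeasure sphere_measure A = emeasure ?M A" .
qed

lemma sets_sphere_measure [measurable_cong, simp]: "sets sphere_measure = sets borel"
  by (simp add: sphere_measure_def)

lemma space_sphere_measure [simp]: "space sphere_measure = UNIV"
  by (simp add: sphere_measure_def space_scale_measure)

lemma AE_sphere_measure:
  assumes "\<And>y::real^'n::finite. norm y = 1 \<Longrightarrow> P y" "{y. P y} \<in> sets borel"
  shows "AE \<omega> in sphere_measure. P \<omega>"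
  unfolding sphere_measure_eq
proof (subst AE_distr_iff)
  show "AE y in density lborel (\<lambda>y. ennreal (real CARD('n) * indicator (ball 0 1) y)). P (y /\<^sub>R norm y)"
  proof (subst AE_density)
    \<comment> \<open>The direction of y has norm 1 except at the origin, where the division yields
      0; a single point is a null set.\<close>
    have "AE y::real^'n in lborel. y \<noteq> 0" by (rule AE_lborel_singleton)
    then show "AE y::real^'n in lborel. 0 < ennreal (real CARD('n) * indicator (ball 0 1) y) \<longrightarrow> P (y /\<^sub>R norm y)"
      by eventually_elim (auto intro!: assms(1))
  qed auto
qed (use assms(2) in auto)

lemma AE_norm_sphere_measure: "AE \<omega> in (sphere_measure :: (real^'n::finite) measure). norm \<omega> = 1"
  by (rule AE_sphere_measure) (auto simp: borel_measurable_norm intro!: measurable_sets_borel)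

lemma emeasure_sphere_measure:
  "emeasure (sphere_measure :: (real^'n::finite) measure) UNIV = of_nat CARD('n) * emeasure lborel (ball 0 1 :: (real^'n) set)"
  unfolding sphere_measure_def
  by (simp add: emeasure_distr measurable_restrict_space1 space_restrict_space emeasure_restrict_space)

lemma finite_sphere_measure: "finite_measure (sphere_measure :: (real^'n::finite) measure)"
proof
  have "emeasure lborel (ball 0 1 :: (real^'n) set) < \<infinity>"
    by (intro emeasure_bounded_finite bounded_ball)
  then show "emeasure (sphere_measure :: (real^'n) measure) (space sphere_measure) \<noteq> \<infinity>"
    by (simp add: emeasure_sphere_measure ennreal_mult_eq_top_iff less_top)
qed

lemma measure_sphere_measure_pos: "measure (sphere_measure :: (real^'n::finite) measure) UNIV > 0"
proof -
  interpret finite_measure "sphere_measure :: (real^'n) measure" by (rule finite_sphere_measure)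
  have "emeasure lborel (ball 0 1 :: (real^'n) set) \<noteq> 0"
    using content_ball_pos[of 1 "0 :: real^'n"] by (auto simp: measure_def)
  then have "emeasure (sphere_measure :: (real^'n) measure) UNIV \<noteq> 0"
    by (simp add: emeasure_sphere_measure)
  then show ?thesis by (metis emeasure_eq_measure ennreal_0 measure_nonneg order_le_less)
qed

lemma integral_sphere_cong:
  fixes f g :: "real^'n::finite \<Rightarrow> real"
  assumes [measurable]: "f \<in> borel_measurable borel" "g \<in> borel_measurable borel"
    and "\<And>\<omega>. norm \<omega> = 1 \<Longrightarrow> f \<omega> = g \<omega>"
  shows "(\<integral>\<omega>. f \<omega> \<partial>sphere_measure) = (\<integral>\<omega>. g \<omega> \<partial>sphere_measure)"
proof (rule integral_cong_AE)
  show "AE \<omega> in sphere_measure. f \<omega> = g \<omega>"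
    using AE_norm_sphere_measure by eventually_elim (rule assms(3))
qed auto

lemma integrable_sphere_bounded:
  fixes f :: "real^'n::finite \<Rightarrow> real"
  assumes [measurable]: "f \<in> borel_measurable borel"
    and "\<And>\<omega>. norm \<omega> = 1 \<Longrightarrow> \<bar>f \<omega>\<bar> \<le> C"
  shows "integrable sphere_measure f"
proof (rule finite_measure.integrable_const_bound[OF finite_sphere_measure])
  show "AE \<omega> in sphere_measure. norm (f \<omega>) \<le> C"
    using AE_norm_sphere_measure by eventually_elim (simp add: assms(2))
qed auto

lemma integrable_sphere_prod:
  "integrable sphere_measure (\<lambda>\<omega>::real^'n::finite. \<omega> $ i)"
  "integrable sphere_measure (\<lambda>\<omega>::real^'n::finite. \<omega> $ i * \<omega> $ j)"
proof -
  have "\<bar>\<omega> $ i\<bar> \<le> 1" if "norm \<omega> = 1" for \<omega> :: "real^'n" and i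
    using component_le_norm_cart[of \<omega> i] that by simp
  then show "integrable sphere_measure (\<lambda>\<omega>::real^'n. \<omega> $ i)"
    "integrable sphere_measure (\<lambda>\<omega>::real^'n. \<omega> $ i * \<omega> $ j)"
    by (auto intro!: integrable_sphere_bounded[of _ 1] simp: abs_mult mult_le_one)
qed

text \<open>A coordinate reflection. It preserves Lebesgue measure and norms, hence integrals over
  the sphere, and it supplies the vanishing moments.\<close>

definition flip :: "'n \<Rightarrow> real^'n::finite \<Rightarrow> real^'n" where
  "flip i y = (\<chi> j. if j = i then - y $ j else y $ j)"

lemma lborel_distr_flip: "distr lborel borel (flip i) = (lborel :: (real^'n::finite) measure)"
proof -
  let ?c = "\<lambda>b::real^'n. if b = axis i 1 then - 1 else (1::real)"
  have "(\<Sum>b\<in>Basis. (?c b * (x \<bullet> b)) *\<^sub>R b) = flip i x" for x :: "real^'n"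
  proof -
    have "flip i x \<bullet> b = ?c b * (x \<bullet> b)" if "b \<in> Basis" for b
      using that by (auto simp: Basis_vec_def inner_axis flip_def axis_eq_axis)
    then have "(\<Sum>b\<in>Basis. (?c b * (x \<bullet> b)) *\<^sub>R b) = (\<Sum>b\<in>Basis. (flip i x \<bullet> b) *\<^sub>R b)"
      by (intro sum.cong) auto
    then show ?thesis by (simp add: euclidean_representation)
  qed
  then have "lborel = density (distr lborel borel (flip i :: real^'n \<Rightarrow> _)) (\<lambda>_. \<Prod>b\<in>Basis. \<bar>?c b\<bar>)"
    using lborel_affine_euclidean[of ?c 0] by simp
  also have "(\<Prod>b\<in>Basis. \<bar>?c b\<bar>) = 1" by (intro prod.neutral) auto
  finally show ?thesis by (simp add: density_1)
qed

lemma measurable_flip [measurable]: "(flip i :: real^'n::finite \<Rightarrow> real^'n) \<in> borel_measurable borel"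
  unfolding flip_def
proof (intro borel_measurable_continuous_onI continuous_on_vec_lambda)
  show "continuous_on UNIV (\<lambda>x::real^'n. if j = i then - x $ j else x $ j)" for j :: 'n
    by (cases "j = i") (auto intro!: continuous_intros)
qed

lemma integral_sphere_flip:
  fixes f :: "real^'n::finite \<Rightarrow> real"
  assumes [measurable]: "f \<in> borel_measurable borel"
  shows "(\<integral>\<omega>. f (flip i \<omega>) \<partial>sphere_measure) = (\<integral>\<omega>. f \<omega> \<partial>sphere_measure)"
proof -
  have norm_flip: "norm (flip i y) = norm y" for y :: "real^'n"
    unfolding norm_vec_def L2_set_def by (intro arg_cong[of _ _ sqrt] sum.cong) (auto simp: flip_def)
  have I: "(\<integral>\<omega>. g \<omega> \<partial>sphere_measure) = (\<integral>y. real CARD('n) * indicator (ball 0 1) y * g (y /\<^sub>R norm y) \<partial>lborel)"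
    if [measurable]: "g \<in> borel_measurable borel" for g :: "real^'n \<Rightarrow> real"
    unfolding sphere_measure_eq by (subst integral_distr) (auto simp: integral_density)
  have "(\<integral>\<omega>. f \<omega> \<partial>sphere_measure) =
      (\<integral>y. real CARD('n) * indicator (ball 0 1) y * f (y /\<^sub>R norm y) \<partial>distr lborel borel (flip i))"
    by (simp add: I lborel_distr_flip)
  also have "\<dots> = (\<integral>y. real CARD('n) * indicator (ball 0 1) (flip i y) * f (flip i y /\<^sub>R norm (flip i y)) \<partial>lborel)"
    by (rule integral_distr) auto
  also have "\<dots> = (\<integral>y. real CARD('n) * indicator (ball 0 1) y * f (flip i (y /\<^sub>R norm y)) \<partial>lborel)"
  proof (intro Bochner_Integration.integral_cong refl)
    fix y :: "real^'n"
    have "flip i y /\<^sub>R norm y = flip i (y /\<^sub>R norm y)" by (simp add: vec_eq_iff flip_def)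
    then show "real CARD('n) * indicator (ball 0 1) (flip i y) * f (flip i y /\<^sub>R norm (flip i y)) =
        real CARD('n) * indicator (ball 0 1) y * f (flip i (y /\<^sub>R norm y))"
      by (simp add: norm_flip indicator_def)
  qed
  also have "\<dots> = (\<integral>\<omega>. f (flip i \<omega>) \<partial>sphere_measure)" by (simp add: I)
  finally show ?thesis by simp
qed

text \<open>The integrand changes sign under \<open>flip i\<close>, so its integral equals its own
  negative.\<close>

lemma integral_sphere_odd:
  "(\<integral>\<omega>. \<omega> $ i \<partial>sphere_measure) = 0"
  "i \<noteq> j \<Longrightarrow> (\<integral>\<omega>. \<omega> $ i * \<omega> $ j \<partial>sphere_measure) = 0"
  for i j :: "'n::finite"
proof -
  show "(\<integral>\<omega>. \<omega> $ i \<partial>sphere_measure) = 0"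
    using integral_sphere_flip[of "\<lambda>\<omega>. \<omega> $ i" i] by (simp add: flip_def)
  show "(\<integral>\<omega>. \<omega> $ i * \<omega> $ j \<partial>sphere_measure) = 0" if "i \<noteq> j"
    using integral_sphere_flip[of "\<lambda>\<omega>. \<omega> $ i * \<omega> $ j" i] that by (simp add: flip_def)
qed

text \<open>Were the integral zero, y_i would vanish almost everywhere in the unit ball. As the
  hyperplane y_i = 0 is null, the ball would be null too, against its positive volume.\<close>

lemma integral_sphere_square_pos: "(\<integral>\<omega>. (\<omega> $ i)\<^sup>2 \<partial>sphere_measure) > 0"
  for i :: "'n::finite"
proof (rule ccontr)
  let ?M = "sphere_measure :: (real^'n) measure"
  have int: "integrable ?M (\<lambda>\<omega>. (\<omega> $ i)\<^sup>2)"
    using integrable_sphere_prod(2)[of i i] by (simp add: power2_eq_square)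
  assume "\<not> (\<integral>\<omega>. (\<omega> $ i)\<^sup>2 \<partial>?M) > 0"
  moreover have "(\<integral>\<omega>. (\<omega> $ i)\<^sup>2 \<partial>?M) \<ge> 0" by (rule Bochner_Integration.integral_nonneg) simp
  ultimately have "(\<integral>\<omega>. (\<omega> $ i)\<^sup>2 \<partial>?M) = 0" by simp
  then have "AE \<omega> in ?M. (\<omega> $ i)\<^sup>2 = 0"
    using integral_nonneg_eq_0_iff_AE[OF int] by simp
  then have "AE y in density lborel (\<lambda>y::real^'n. ennreal (real CARD('n) * indicator (ball 0 1) y)). ((y /\<^sub>R norm y) $ i)\<^sup>2 = 0"
    unfolding sphere_measure_eq by (subst (asm) AE_distr_iff) auto
  then have "AE y::real^'n in lborel. y \<in> ball 0 1 \<longrightarrow> y $ i = 0"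
    by (subst (asm) AE_density) (auto elim!: eventually_mono simp: indicator_def split: if_splits)
  moreover have "AE y::real^'n in lborel. y $ i \<noteq> 0"
  proof -
    have "negligible {y::real^'n. y $ i = 0}" by (rule negligible_standard_hyperplane_cart)
    then have "{y::real^'n. y $ i = 0} \<in> null_sets lebesgue" by (simp add: negligible_iff_null_sets)
    moreover have "{y::real^'n. y $ i = 0} \<in> sets borel" by measurable
    ultimately have "{y::real^'n. y $ i = 0} \<in> null_sets lborel"
      by (simp add: null_sets_completion_iff)
    then show ?thesis by (auto dest: AE_not_in)
  qed
  ultimately have "AE y::real^'n in lborel. y \<notin> ball 0 1" by eventually_elim auto
  then have "emeasure lborel (ball 0 1 :: (real^'n) set) = 0"
    by (subst (asm) AE_iff_measurable[of "ball 0 1"]) auto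
  then have "measure ?M UNIV = 0" by (simp add: measure_def emeasure_sphere_measure)
  then show False using measure_sphere_measure_pos[where 'n = 'n] by simp
qed

section \<open>The energy-momentum vector\<close>

lemma continuous_on_GDERIV:
  assumes "\<And>x. GDERIV f x :> df x"
  shows "continuous_on S f"
  using assms unfolding gderiv_def
  by (auto intro!: continuous_at_imp_continuous_on has_derivative_continuous)

text \<open>Comparing integrals by \<open>integral_sphere_cong\<close> asks for measurability on the
  whole space, also off the unit sphere; the closed form of \<open>charge_form\<close> provides
  it.\<close>

lemma measurable_charge_integrand:
  fixes c :: "real^'n::finite" and V :: "real^'n \<Rightarrow> real"
  assumes V: "\<And>x. GDERIV V x :> dV x" and dV: "\<And>j. continuous_on UNIV (\<lambda>x. dV x $ j)"
  shows "(\<lambda>\<omega>. (\<Sum>j\<in>UNIV. charge_form V (\<lambda>x. pert a c x *\<^sub>R hyperbolic_metric x) j (R *\<^sub>R \<omega>)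
      * unit_normal (R *\<^sub>R \<omega>) $ j) * k) \<in> borel_measurable borel"
proof -
  have s: "(\<lambda>\<omega>::real^'n. R *\<^sub>R \<omega>) \<in> borel_measurable borel" by simp
  have m: "(\<lambda>\<omega>. h (R *\<^sub>R \<omega>)) \<in> borel_measurable borel" if "continuous_on UNIV h" for h :: "real^'n \<Rightarrow> real"
    by (rule measurable_compose[OF s borel_measurable_continuous_onI[OF that]])
  note [measurable] = m[OF continuous_on_GDERIV[OF GDERIV_pert]] m[OF continuous_on_GDERIV[OF GDERIV_grad_pert]]
    m[OF continuous_on_GDERIV[OF V]] m[OF dV]
  show ?thesis
    unfolding charge_form_factor[OF GDERIV_pert V] unit_normal_def vector_scaleR_component by measurable
qed

text \<open>The unit normal at R omega is sqrt(1 + R^2) omega, so the flux density is a radial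
  Wronskian. A closed form \<open>g\<close> has to match it on the unit sphere only.\<close>

lemma flux_eq:
  fixes c :: "real^'n::finite" and V :: "real^'n \<Rightarrow> real"
  assumes V: "\<And>x. GDERIV V x :> dV x" and dV: "\<And>j. continuous_on UNIV (\<lambda>x. dV x $ j)"
    and g: "g \<in> borel_measurable borel"
    and eq: "\<And>\<omega>. norm \<omega> = 1 \<Longrightarrow>
      (real CARD('n) - 1) * (pert a c (R *\<^sub>R \<omega>) * (dV (R *\<^sub>R \<omega>) \<bullet> \<omega>) - V (R *\<^sub>R \<omega>) * (grad_pert a c (R *\<^sub>R \<omega>) \<bullet> \<omega>))
        * sqrt (1 + R\<^sup>2) * R ^ (CARD('n) - 1) = g \<omega>"
    and R: "R > 0"
  shows "flux V (\<lambda>x. pert a c x *\<^sub>R hyperbolic_metric x) R = (\<integral>\<omega>. g \<omega> \<partial>sphere_measure)"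
  unfolding flux_def
proof (rule integral_sphere_cong[OF measurable_charge_integrand[OF V dV] g])
  fix \<omega> :: "real^'n" assume n: "norm \<omega> = 1"
  have "unit_normal (R *\<^sub>R \<omega>) $ j = sqrt (1 + R\<^sup>2) * \<omega> $ j" for j
    using R n by (simp add: unit_normal_def)
  then have "(\<Sum>j\<in>UNIV. charge_form V (\<lambda>x. pert a c x *\<^sub>R hyperbolic_metric x) j (R *\<^sub>R \<omega>) * unit_normal (R *\<^sub>R \<omega>) $ j)
     = (\<Sum>j\<in>UNIV. (real CARD('n) - 1) * sqrt (1 + R\<^sup>2) *
         (pert a c (R *\<^sub>R \<omega>) * (dV (R *\<^sub>R \<omega>) $ j * \<omega> $ j) - V (R *\<^sub>R \<omega>) * (grad_pert a c (R *\<^sub>R \<omega>) $ j * \<omega> $ j)))"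
    unfolding charge_form_factor[OF GDERIV_pert V] by (intro sum.cong refl) (simp add: algebra_simps)
  also have "\<dots> = (real CARD('n) - 1) * sqrt (1 + R\<^sup>2) *
         (pert a c (R *\<^sub>R \<omega>) * (dV (R *\<^sub>R \<omega>) \<bullet> \<omega>) - V (R *\<^sub>R \<omega>) * (grad_pert a c (R *\<^sub>R \<omega>) \<bullet> \<omega>))"
    by (simp only: sum_distrib_left[symmetric] sum_subtractf inner_vec_eq)
  finally show "(\<Sum>j\<in>UNIV. charge_form V (\<lambda>x. pert a c x *\<^sub>R hyperbolic_metric x) j (R *\<^sub>R \<omega>)
      * unit_normal (R *\<^sub>R \<omega>) $ j) * R ^ (CARD('n) - 1) = g \<omega>"
    using eq[OF n] by (simp add: mult_ac)
qed

lemma inv_V_scaled: "norm \<omega> = 1 \<Longrightarrow> inv_V (R *\<^sub>R \<omega>) = inverse (sqrt (1 + R\<^sup>2))"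
  by (simp add: inv_V_def V_time_def)

lemma pert_scaled:
  fixes c \<omega> :: "real^'n::finite" and a R :: real
  assumes "norm \<omega> = 1"
  defines "v \<equiv> inverse (sqrt (1 + R\<^sup>2))"
  shows "pert a c (R *\<^sub>R \<omega>) = v ^ CARD('n) * (a + (R * (c \<bullet> \<omega>) - 1) * v)"
    "grad_pert a c (R *\<^sub>R \<omega>) \<bullet> \<omega> = v ^ CARD('n) * (v * (c \<bullet> \<omega>)
       - R * (a * real CARD('n) * v\<^sup>2 + (real CARD('n) + 1) * (R * (c \<bullet> \<omega>) - 1) * v ^ 3))"
proof -
  have "\<omega> \<bullet> \<omega> = 1" using assms by (simp add: dot_square_norm)
  then show "pert a c (R *\<^sub>R \<omega>) = v ^ CARD('n) * (a + (R * (c \<bullet> \<omega>) - 1) * v)"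
    "grad_pert a c (R *\<^sub>R \<omega>) \<bullet> \<omega> = v ^ CARD('n) * (v * (c \<bullet> \<omega>)
       - R * (a * real CARD('n) * v\<^sup>2 + (real CARD('n) + 1) * (R * (c \<bullet> \<omega>) - 1) * v ^ 3))"
    unfolding pert_def grad_pert_def pert_radial_def inv_V_scaled[OF assms(1)] v_def[symmetric]
      inner_diff_left inner_scaleR_left inner_scaleR_right
    by (simp_all add: power_add power2_eq_square algebra_simps)
qed

text \<open>By parity only the constant survives in the first integral, and only the square of the
  component \<open>i\<close> in the second.\<close>

lemma integral_sphere_linear:
  fixes c :: "real^'n::finite"
  shows "(\<integral>\<omega>. A + B * (c \<bullet> \<omega>) \<partial>sphere_measure) = A * measure (sphere_measure :: (real^'n) measure) UNIV"
    "(\<integral>\<omega>. (A + B * (c \<bullet> \<omega>)) * \<omega> $ i \<partial>sphere_measure) = B * c $ i * (\<integral>\<omega>. (\<omega> $ i)\<^sup>2 \<partial>sphere_measure)"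
proof -
  let ?M = "sphere_measure :: (real^'n) measure"
  interpret finite_measure ?M by (rule finite_sphere_measure)
  have "(\<integral>\<omega>. A + B * (c \<bullet> \<omega>) \<partial>?M) = (\<integral>\<omega>. A + (\<Sum>k\<in>UNIV. (B * c $ k) * \<omega> $ k) \<partial>?M)"
    by (simp add: inner_vec_eq sum_distrib_left mult.assoc)
  also have "\<dots> = A * measure ?M UNIV"
    by (simp add: integrable_sphere_prod integral_sphere_odd integral_sum)
  finally show "(\<integral>\<omega>. A + B * (c \<bullet> \<omega>) \<partial>?M) = A * measure ?M UNIV" .
  have "(\<integral>\<omega>. (A + B * (c \<bullet> \<omega>)) * \<omega> $ i \<partial>?M) = (\<integral>\<omega>. A * \<omega> $ i + (\<Sum>k\<in>UNIV. (B * c $ k) * (\<omega> $ k * \<omega> $ i)) \<partial>?M)"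
    by (simp add: inner_vec_eq sum_distrib_left sum_distrib_right distrib_right mult.assoc)
  also have "\<dots> = (\<Sum>k\<in>UNIV. (B * c $ k) * (\<integral>\<omega>. \<omega> $ k * \<omega> $ i \<partial>?M))"
    by (simp add: integrable_sphere_prod integral_sphere_odd integral_sum)
  also have "\<dots> = (\<Sum>k\<in>UNIV. if k = i then B * c $ i * (\<integral>\<omega>. (\<omega> $ i)\<^sup>2 \<partial>?M) else 0)"
    by (intro sum.cong refl) (simp add: integral_sphere_odd power2_eq_square)
  finally show "(\<integral>\<omega>. (A + B * (c \<bullet> \<omega>)) * \<omega> $ i \<partial>?M) = B * c $ i * (\<integral>\<omega>. (\<omega> $ i)\<^sup>2 \<partial>?M)"
    by simp
qed

lemma tendsto_inverse_sqrt: "((\<lambda>R::real. inverse (sqrt (1 + R\<^sup>2))) \<longlongrightarrow> 0) at_top"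
  "((\<lambda>R::real. R * inverse (sqrt (1 + R\<^sup>2))) \<longlongrightarrow> 1) at_top"
  by real_asymp+

text \<open>To be read with s = \<open>V_time\<close>, z = v^n, r = R^(n-1) and \<beta> = c . omega.
  With these powers abstracted the identity is polynomial modulo v s = 1. The right side is sorted
  by degree in \<beta>, ready for \<open>integral_sphere_linear\<close>.\<close>

lemma flux_time_algebra:
  fixes v s n z a R \<beta> r :: real
  assumes "v * s = 1"
  shows "(n - 1) * (z * (a + (R * \<beta> - 1) * v) * (v * R)
      - s * (z * (v * \<beta> - R * (a * n * v\<^sup>2 + (n + 1) * (R * \<beta> - 1) * v ^ 3)))) * s * r
    = (n - 1) * (R * r * z * ((n + 1) * a - (n + 2) * v)) + (n - 1) * z * ((n + 2) * R\<^sup>2 * v - s) * r * \<beta>"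
  using assms by algebra

lemma flux_space_algebra:
  fixes v s n z a R \<beta> r w :: real
  assumes "v * s = 1"
  shows "(n - 1) * (z * (a + (R * \<beta> - 1) * v) * w
      - R * w * (z * (v * \<beta> - R * (a * n * v\<^sup>2 + (n + 1) * (R * \<beta> - 1) * v ^ 3)))) * s * r
    = ((n - 1) * s * r * z * (a - v + R\<^sup>2 * (a * n * v\<^sup>2 - (n + 1) * v ^ 3))
        + (n - 1) * ((n + 1) * (R * r * R\<^sup>2 * (z * v\<^sup>2))) * \<beta>) * w"
  using assms by algebra

text \<open>For every R the part linear in c . omega integrates to zero, so the limit is that of
  \<open>?A\<close>. There R v tends to 1, and -(n+2) v, the trace left by -v^(n+1), tends to
  0.\<close>

lemma flux_time_limit:
  fixes c :: "real^'n::finite"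
  shows "(flux V_time (\<lambda>x. pert a c x *\<^sub>R hyperbolic_metric x) \<longlongrightarrow>
     (real CARD('n) - 1) * ((real CARD('n) + 1) * a) * measure (sphere_measure :: (real^'n) measure) UNIV) at_top"
proof -
  let ?n = "real CARD('n)" and ?\<Omega> = "measure (sphere_measure :: (real^'n) measure) UNIV"
  let ?v = "\<lambda>R::real. inverse (sqrt (1 + R\<^sup>2))"
  let ?A = "\<lambda>R. (?n - 1) * ((R * ?v R) ^ CARD('n) * ((?n + 1) * a - (?n + 2) * ?v R))"
  have flux: "flux V_time (\<lambda>x. pert a c x *\<^sub>R hyperbolic_metric x) R = ?A R * ?\<Omega>" if R: "R > 0" for R
  proof -
    define v where "v = ?v R"
    define B where "B = (?n - 1) * v ^ CARD('n) * ((?n + 2) * R\<^sup>2 * v - sqrt (1 + R\<^sup>2)) * R ^ (CARD('n) - 1)"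
    have "flux V_time (\<lambda>x. pert a c x *\<^sub>R hyperbolic_metric x) R = (\<integral>\<omega>. ?A R + B * (c \<bullet> \<omega>) \<partial>sphere_measure)"
    proof (rule flux_eq[OF GDERIV_V_time _ _ _ R])
      show "continuous_on UNIV (\<lambda>x::real^'n. (inv_V x *\<^sub>R x) $ j)" for j
        by (auto intro!: continuous_intros continuous_on_GDERIV[OF GDERIV_inv_V])
      show "(\<lambda>\<omega>. ?A R + B * (c \<bullet> \<omega>)) \<in> borel_measurable borel" by measurable
      fix \<omega> :: "real^'n" assume w: "norm \<omega> = 1"
      define s where "s = sqrt (1 + R\<^sup>2)"
      define \<beta> where "\<beta> = c \<bullet> \<omega>"
      have s: "s > 0" by (simp add: s_def add_pos_nonneg)
      then have vs: "v * s = 1" by (simp add: v_def s_def)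
      have ww: "\<omega> \<bullet> \<omega> = 1" using w by (simp add: dot_square_norm)
      have V: "V_time (R *\<^sub>R \<omega>) = s" using w by (simp add: V_time_def s_def)
      have dV: "(inv_V (R *\<^sub>R \<omega>) *\<^sub>R R *\<^sub>R \<omega>) \<bullet> \<omega> = v * R"
        by (simp add: inv_V_scaled[OF w] v_def ww)
      have Rn: "R ^ CARD('n) = R * R ^ (CARD('n) - 1)" by (simp flip: power_Suc)
      define r where "r = R ^ (CARD('n) - 1)"
      define z where "z = v ^ CARD('n)"
      show "(?n - 1) * (pert a c (R *\<^sub>R \<omega>) * ((inv_V (R *\<^sub>R \<omega>) *\<^sub>R R *\<^sub>R \<omega>) \<bullet> \<omega>)
         - V_time (R *\<^sub>R \<omega>) * (grad_pert a c (R *\<^sub>R \<omega>) \<bullet> \<omega>)) * sqrt (1 + R\<^sup>2) * R ^ (CARD('n) - 1)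
         = ?A R + B * (c \<bullet> \<omega>)"
        unfolding dV V pert_scaled[OF w] B_def power_mult_distrib Rn
        unfolding v_def[symmetric] \<beta>_def[symmetric] r_def[symmetric]
        unfolding s_def[symmetric] z_def[symmetric]
        using flux_time_algebra[OF vs, of ?n z a R \<beta> r] by simp
    qed
    then show ?thesis by (simp add: integral_sphere_linear)
  qed
  have "((\<lambda>R. ?A R * ?\<Omega>) \<longlongrightarrow> (?n - 1) * (1 ^ CARD('n) * ((?n + 1) * a - (?n + 2) * 0)) * ?\<Omega>) at_top"
    by (intro tendsto_intros tendsto_inverse_sqrt)
  then show ?thesis
    by (rule Lim_transform_eventually[THEN tendsto_eq_rhs])
      (auto simp: flux eventually_at_top_dense intro!: exI[of _ 0])
qed

text \<open>Now the part independent of c . omega is multiplied by the odd function omega_i and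
  vanishes for every R. It contains \<open>a\<close> and the term -v^(n+1), which therefore drop out
  before the limit.\<close>

lemma flux_space_limit:
  fixes c :: "real^'n::finite"
  shows "(flux (V_space i) (\<lambda>x. pert a c x *\<^sub>R hyperbolic_metric x) \<longlongrightarrow>
     (real CARD('n) - 1) * (real CARD('n) + 1) * c $ i * (\<integral>\<omega>. (\<omega> $ i)\<^sup>2 \<partial>sphere_measure)) at_top"
proof -
  let ?n = "real CARD('n)" and ?m = "\<integral>\<omega>. (\<omega> $ i)\<^sup>2 \<partial>(sphere_measure :: (real^'n) measure)"
  let ?v = "\<lambda>R::real. inverse (sqrt (1 + R\<^sup>2))"
  let ?B = "\<lambda>R. (?n - 1) * ((?n + 1) * (R * ?v R) ^ (CARD('n) + 2))"
  have flux: "flux (V_space i) (\<lambda>x. pert a c x *\<^sub>R hyperbolic_metric x) R = ?B R * c $ i * ?m" if R: "R > 0" for R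
  proof -
    define v where "v = ?v R"
    define A where "A = (?n - 1) * sqrt (1 + R\<^sup>2) * R ^ (CARD('n) - 1) * v ^ CARD('n)
       * (a - v + R\<^sup>2 * (a * ?n * v\<^sup>2 - (?n + 1) * v ^ 3))"
    have "flux (V_space i) (\<lambda>x. pert a c x *\<^sub>R hyperbolic_metric x) R
       = (\<integral>\<omega>. (A + ?B R * (c \<bullet> \<omega>)) * \<omega> $ i \<partial>sphere_measure)"
    proof (rule flux_eq[where dV = "\<lambda>_. axis i 1", OF _ _ _ _ R])
      show "GDERIV (V_space i) x :> axis i 1" for x :: "real^'n"
        unfolding V_space_def[abs_def] by (rule GDERIV_component)
      show "(\<lambda>\<omega>. (A + ?B R * (c \<bullet> \<omega>)) * \<omega> $ i) \<in> borel_measurable borel" by measurable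
      fix \<omega> :: "real^'n" assume w: "norm \<omega> = 1"
      define s where "s = sqrt (1 + R\<^sup>2)"
      define \<beta> where "\<beta> = c \<bullet> \<omega>"
      have "s > 0" by (simp add: s_def add_pos_nonneg)
      then have vs: "v * s = 1" by (simp add: v_def s_def)
      have V: "V_space i (R *\<^sub>R \<omega>) = R * \<omega> $ i" by (simp add: V_space_def)
      have dV: "axis i 1 \<bullet> \<omega> = \<omega> $ i" by (simp add: inner_axis')
      have Rn: "R ^ CARD('n) = R * R ^ (CARD('n) - 1)" by (simp flip: power_Suc)
      define r where "r = R ^ (CARD('n) - 1)"
      define z where "z = v ^ CARD('n)"
      show "(?n - 1) * (pert a c (R *\<^sub>R \<omega>) * (axis i 1 \<bullet> \<omega>)
         - V_space i (R *\<^sub>R \<omega>) * (grad_pert a c (R *\<^sub>R \<omega>) \<bullet> \<omega>)) * sqrt (1 + R\<^sup>2) * R ^ (CARD('n) - 1)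
         = (A + ?B R * (c \<bullet> \<omega>)) * \<omega> $ i"
        unfolding dV V pert_scaled[OF w] A_def power_mult_distrib power_add[of R] power_add[of "inverse _"] Rn
        unfolding v_def[symmetric] \<beta>_def[symmetric] r_def[symmetric]
        unfolding s_def[symmetric] z_def[symmetric]
        using flux_space_algebra[OF vs, of ?n z a R \<beta> "\<omega> $ i" r] by simp
    qed simp
    then show ?thesis by (simp add: integral_sphere_linear)
  qed
  have "((\<lambda>R. ?B R * c $ i * ?m) \<longlongrightarrow> (?n - 1) * ((?n + 1) * 1 ^ (CARD('n) + 2)) * c $ i * ?m) at_top"
    by (intro tendsto_intros tendsto_inverse_sqrt)
  then show ?thesis
    by (rule Lim_transform_eventually[THEN tendsto_eq_rhs])
      (auto simp: flux eventually_at_top_dense intro!: exI[of _ 0])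
qed

theorem theorem1p1:
  fixes p :: "real \<times> (real^'n)"
  assumes "CARD('n) \<ge> 3"
  shows "\<exists>(K :: (real^'n) set) g.
    compact K \<and>
    riemannian_metric_on (- K) g \<and>
    asymptotically_hyperbolic K g \<and>
    (\<forall>x\<in>- K. scalar_curvature g x \<ge> - (real CARD('n) * (real CARD('n) - 1))) \<and>
    (\<exists>R0 \<Phi>. chart_at_infinity K g R0 \<Phi> \<and> has_energy_momentum g \<Phi> p)"
proof -
  let ?n = "real CARD('n)" and ?\<Omega> = "measure (sphere_measure :: (real^'n) measure) UNIV"
  let ?m = "\<lambda>i. \<integral>\<omega>. (\<omega> $ i)\<^sup>2 \<partial>(sphere_measure :: (real^'n) measure)"
  \<comment> \<open>Inverts the two limits component by component; each component of
    \<open>c\<close> is divided by the second moment of its own coordinate, which is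
    positive.\<close>
  define a where "a = fst p / ((?n - 1) * (?n + 1) * ?\<Omega>)"
  define c :: "real^'n" where "c = (\<chi> i. snd p $ i / ((?n - 1) * (?n + 1) * ?m i))"
  have nz: "?n - 1 \<noteq> 0" "?n + 1 \<noteq> 0" "?\<Omega> \<noteq> 0"
    using assms measure_sphere_measure_pos[where 'n = 'n] by auto
  have m: "?m i \<noteq> 0" for i using integral_sphere_square_pos[of i] by simp
  obtain R where R: "R > 0" "\<And>x. norm x > R \<Longrightarrow> 1 + pert a c x \<ge> 1 / 2"
    "\<And>x. norm x > R \<Longrightarrow> scalar_curvature (\<lambda>y. (1 + pert a c y) *\<^sub>R hyperbolic_metric y) x \<ge> - (?n * (?n - 1))"
    by (rule scalar_curvature_pert[OF assms, of a c], rule that)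
  have pos: "1 + pert a c x > 0" if "norm x > R" for x using R(2)[OF that] by linarith
  let ?g = "pert_metric a c" and ?K = "cball 0 R :: (real^'n) set"
  show ?thesis
  proof (intro exI conjI)
    show "compact ?K" by simp
    show "riemannian_metric_on (- ?K) ?g" by (rule riemannian_pert_metric) (simp add: pos)
    show "asymptotically_hyperbolic ?K ?g" by (rule asymptotically_hyperbolic_pert_metric[OF R(1) pos])
    show "\<forall>x\<in>- ?K. scalar_curvature ?g x \<ge> - (?n * (?n - 1))"
      using R(3) by (simp add: pert_metric_def[abs_def])
    show "chart_at_infinity ?K ?g (R + 1) (\<lambda>x. x)" by (rule chart_at_infinity_pert_metric[OF R(1)])
    have "(?n - 1) * ((?n + 1) * a) * ?\<Omega> = fst p" "(?n - 1) * (?n + 1) * c $ i * ?m i = snd p $ i" for i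
      using nz m[of i] by (simp_all add: a_def c_def)
    then show "has_energy_momentum ?g (\<lambda>x. x) p"
      unfolding has_energy_momentum_def chart_error_pert_metric
      using flux_time_limit[where a = a and c = c] flux_space_limit[where a = a and c = c] by simp
  qed
qed

end
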